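(* Let $r\in\mathbb{C}\setminus\mathbb{Z}_{\ge1}$. Then $\mathcal{B}_r(\mathbb{P}^1(\mathbb{R}))=\mathcal{H}_r(\mathbb{H})\oplus\mathcal{W}^\omega_r(\mathbb{P}^1(\mathbb{R}))$; that is, every $r$-harmonic boundary germ on $\mathbb{P}^1(\mathbb{R})$ is in a unique way the sum of the germ of an $r$-harmonic function on all of $\mathbb{H}$ and an analytic boundary germ.
   Context: $\mathbb{H}$ upper half-plane, $z=x+iy$. For open $V\subset\mathbb{H}$, $\mathcal{H}_r(V)$ is the space of $C^2$ functions $F$ on $V$ with $-4y^2\partial_z\partial_{\bar z}F+2iry\partial_{\bar z}F=0$. $\mathcal{B}_r(\mathbb{P}^1(\mathbb{R}))=\varinjlim_U\mathcal{H}_r(U\cap\mathbb{H})$, $U$ running over open neighbourhoods of $\mathbb{P}^1(\mathbb{R})$ in $\mathbb{P}^1(\mathbb{C})$ (germs of $r$-harmonic functions near the boundary); $\mathcal{H}_r(\mathbb{H})$ is identified with its image. $f_r(z)=\frac{2i}{z-i}\left(\frac{\bar z-i}{\bar z-z}\right)^{r-1}$ on $\mathbb{H}\setminus\{i\}$ (continuous branch on $\mathbb{H}$). $\mathcal{W}^\omega_r(\mathbb{P}^1(\mathbb{R}))\subset\mathcal{B}_r(\mathbb{P}^1(\mathbb{R}))$ consists of the germs represented by $F\in\mathcal{H}_r(U\cap\mathbb{H})$ such that $F/f_r$ has a real-analytic continuation to $U$. *)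

theory Defs
  imports "HOL-Analysis.Analysis"
begin

definition UHP :: "complex set" where
  "UHP = {z. Im z > 0}"

definition pdx :: "(complex \<Rightarrow> complex) \<Rightarrow> complex \<Rightarrow> complex" where
  "pdx F z = vector_derivative (\<lambda>t::real. F (z + of_real t)) (at 0)"

definition pdy :: "(complex \<Rightarrow> complex) \<Rightarrow> complex \<Rightarrow> complex" where
  "pdy F z = vector_derivative (\<lambda>t::real. F (z + of_real t * \<i>)) (at 0)"

definition has_pdx_on :: "complex set \<Rightarrow> (complex \<Rightarrow> complex) \<Rightarrow> bool" where
  "has_pdx_on V F \<longleftrightarrow> (\<forall>z\<in>V. (\<lambda>t::real. F (z + of_real t)) differentiable (at 0))"

definition has_pdy_on :: "complex set \<Rightarrow> (complex \<Rightarrow> complex) \<Rightarrow> bool" where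
  "has_pdy_on V F \<longleftrightarrow> (\<forall>z\<in>V. (\<lambda>t::real. F (z + of_real t * \<i>)) differentiable (at 0))"

definition C1_on :: "complex set \<Rightarrow> (complex \<Rightarrow> complex) \<Rightarrow> bool" where
  "C1_on V F \<longleftrightarrow> continuous_on V F \<and> has_pdx_on V F \<and> has_pdy_on V F
      \<and> continuous_on V (pdx F) \<and> continuous_on V (pdy F)"

definition C2_on :: "complex set \<Rightarrow> (complex \<Rightarrow> complex) \<Rightarrow> bool" where
  "C2_on V F \<longleftrightarrow> C1_on V F \<and> C1_on V (pdx F) \<and> C1_on V (pdy F)"

definition dz :: "(complex \<Rightarrow> complex) \<Rightarrow> complex \<Rightarrow> complex" where
  "dz F z = (pdx F z - \<i> * pdy F z) / 2"

definition dzbar :: "(complex \<Rightarrow> complex) \<Rightarrow> complex \<Rightarrow> complex" where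
  "dzbar F z = (pdx F z + \<i> * pdy F z) / 2"

definition Hr :: "complex \<Rightarrow> complex set \<Rightarrow> (complex \<Rightarrow> complex) set" where
  "Hr r V = {F. C2_on V F \<and>
     (\<forall>z\<in>V. - 4 * (of_real (Im z))^2 * dz (dzbar F) z
              + 2 * \<i> * r * of_real (Im z) * dzbar F z = 0)}"

text \<open>Open neighbourhoods of P^1(R) in P^1(C), represented by their finite part
  U \<subseteq> C: U open, containing R, and containing a punctured neighbourhood of \<infinity>.\<close>
definition bnbhd :: "complex set \<Rightarrow> bool" where
  "bnbhd U \<longleftrightarrow> open U \<and> (\<forall>x::real. complex_of_real x \<in> U) \<and>
     (\<exists>R. \<forall>z. norm z > R \<longrightarrow> z \<in> U)"

definition germ_eq :: "(complex \<Rightarrow> complex) \<Rightarrow> (complex \<Rightarrow> complex) \<Rightarrow> bool" where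
  "germ_eq F G \<longleftrightarrow> (\<exists>U. bnbhd U \<and> (\<forall>z\<in>U \<inter> UHP. F z = G z))"

definition Bgerm :: "complex \<Rightarrow> (complex \<Rightarrow> complex) \<Rightarrow> bool" where
  "Bgerm r F \<longleftrightarrow> (\<exists>U. bnbhd U \<and> F \<in> Hr r (U \<inter> UHP))"

definition real_analytic_at :: "(complex \<Rightarrow> complex) \<Rightarrow> complex \<Rightarrow> bool" where
  "real_analytic_at h z0 \<longleftrightarrow>
    (\<exists>a :: nat \<times> nat \<Rightarrow> complex. \<exists>e>0. \<forall>z. cmod (z - z0) < e \<longrightarrow>
       ((\<lambda>(m,n). a (m,n) * of_real (Re z - Re z0) ^ m * of_real (Im z - Im z0) ^ n)
          has_sum h z) UNIV)"

text \<open>Real analyticity on a neighbourhood U of P^1(R) in P^1(C) (finite part U plus \<infinity>);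
  at \<infinity> we use the chart w = 1/z, the value at \<infinity> being some c.\<close>
definition real_analytic_P1 :: "complex set \<Rightarrow> (complex \<Rightarrow> complex) \<Rightarrow> bool" where
  "real_analytic_P1 U h \<longleftrightarrow> (\<forall>z\<in>U. real_analytic_at h z) \<and>
     (\<exists>c. real_analytic_at (\<lambda>w. if w = 0 then c else h (1 / w)) 0)"

text \<open>f_r(z) = 2i/(z-i) ((zbar - i)/(zbar - z))^(r-1). On H the base has positive real
  part, so the principal branch of powr is a continuous branch.\<close>
definition fr :: "complex \<Rightarrow> complex \<Rightarrow> complex" where
  "fr r z = 2 * \<i> / (z - \<i>) * ((cnj z - \<i>) / (cnj z - z)) powr (r - 1)"

definition Wgerm :: "complex \<Rightarrow> (complex \<Rightarrow> complex) \<Rightarrow> bool" where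
  "Wgerm r F \<longleftrightarrow> Bgerm r F \<and>
     (\<exists>U W h. bnbhd U \<and> W \<in> Hr r (U \<inter> UHP) \<and> real_analytic_P1 U h \<and>
        (\<forall>z\<in>(U \<inter> UHP) - {\<i>}. W z / fr r z = h z) \<and> germ_eq F W)"

end

(* A function F is r-harmonic iff y^r times its derivative in conj(z) is antiholomorphic. In the disc
   coordinate w = (z-i)/(z+i), after removing the factor (1-w)^r, this reads
   dF/d(conj w) = (1-|w|^2)^(-r) A(conj w) with A holomorphic. For A(v) = v^k, k >= 0, there is a
   solution P_k that is regular on the whole disc, and for A(v) = v^n, n an integer, there is a
   solution Q_n that near the circle is (1-|w|^2)^(1-r) times a real-analytic function; for k >= 0
   these differ by P_k - Q_k = C_k w^(-k-1) with C_k = k!/((1-r)(2-r)...(k+1-r)), which is finite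
   for all k exactly because r is not a positive integer.

   Existence: expand A in a Laurent series on an annulus, subtract the solutions P_k and Q_n to be left
   with a holomorphic function, expand that in a Laurent series too, and write its negative powers as
   (P_k - Q_k)/C_k.

   Uniqueness: an r-harmonic function on the disc is a sum of multiples of the P_k and of the powers w^k,
   k >= 0. If it is f_r times a real-analytic function near the circle, then each of its Fourier modes,
   divided by (1-|w|^2)^(1-r), extends holomorphically in the radius to a neighbourhood of |w| = 1. Up to
   a holomorphic function this quotient is the coefficient of P_k or w^k times a unit times
   (1-|w|)^(r-1), which is not holomorphic at |w| = 1; hence all coefficients vanish. *)

theory Submission
  imports Defs "HOL-Complex_Analysis.Complex_Analysis"
begin

text \<open>Conj z is treated as an independent variable: a real-analytic function is the
  restriction of a function holomorphic in two variables to v = conj w, and the derivative in conj w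
  becomes the one in v. With s = w v, P_k is w^(-k-1) times the integral of u^k (1-u)^(-r) from 0 to
  s, and Q_k is minus w^(-k-1) times the integral from s to 1, both continued in r by termwise
  integrated series; so C_k is the beta value B(k+1, 1-r). The factor (1-w)^r comes from 1 - |w|^2 =
  |1-w|^2 y. The domains of convergence decide which solution is used. Nonnegative powers of A
  converge only inside the circle and must be matched with P_k; negative powers converge across the
  circle, so the Q_n formed with them are analytic there up to the power factor. The negative powers
  left in the holomorphic remainder also converge across the circle, and 1/C_k grows
  subexponentially, so dividing by C_k costs no radius. For uniqueness, a continuation is given only
  locally near each boundary point; compactness supplies a common radial depth.\<close>

section \<open>Functions holomorphic in two variables\<close>

text \<open>Continuity and separate holomorphy are easy to verify for limits and series; joint
  differentiability and holomorphy of the partial derivatives follow by Osgood's lemma.\<close>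

definition hol2 :: "(complex \<times> complex) set \<Rightarrow> (complex \<times> complex \<Rightarrow> complex) \<Rightarrow> bool" where
  "hol2 \<Omega> \<Phi> \<longleftrightarrow> continuous_on \<Omega> \<Phi> \<and>
     (\<forall>p\<in>\<Omega>. (\<lambda>x. \<Phi> (x, snd p)) field_differentiable at (fst p) \<and>
            (\<lambda>y. \<Phi> (fst p, y)) field_differentiable at (snd p))"

definition d1 :: "(complex \<times> complex \<Rightarrow> complex) \<Rightarrow> complex \<times> complex \<Rightarrow> complex" where
  "d1 \<Phi> p = deriv (\<lambda>x. \<Phi> (x, snd p)) (fst p)"

definition d2 :: "(complex \<times> complex \<Rightarrow> complex) \<Rightarrow> complex \<times> complex \<Rightarrow> complex" where
  "d2 \<Phi> p = deriv (\<lambda>y. \<Phi> (fst p, y)) (snd p)"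

lemma hol2_subset: "hol2 \<Omega> \<Phi> \<Longrightarrow> \<Omega>' \<subseteq> \<Omega> \<Longrightarrow> hol2 \<Omega>' \<Phi>"
  unfolding hol2_def by (meson continuous_on_subset subsetD)

lemma hol2_cont: "hol2 \<Omega> \<Phi> \<Longrightarrow> continuous_on \<Omega> \<Phi>"
  by (simp add: hol2_def)

lemma hol2_d1_has: "hol2 \<Omega> \<Phi> \<Longrightarrow> (a, b) \<in> \<Omega> \<Longrightarrow>
    ((\<lambda>x. \<Phi> (x, b)) has_field_derivative d1 \<Phi> (a, b)) (at a)"
  by (force simp: hol2_def d1_def field_differentiable_derivI)

lemma hol2_d2_has: "hol2 \<Omega> \<Phi> \<Longrightarrow> (a, b) \<in> \<Omega> \<Longrightarrow>
    ((\<lambda>y. \<Phi> (a, y)) has_field_derivative d2 \<Phi> (a, b)) (at b)"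
  by (force simp: hol2_def d2_def field_differentiable_derivI)

lemma d2_eqI: "((\<lambda>y. \<Phi> (a, y)) has_field_derivative D) (at b) \<Longrightarrow> d2 \<Phi> (a, b) = D"
  by (simp add: d2_def DERIV_imp_deriv)

lemma hol2I:
  assumes "continuous_on \<Omega> \<Phi>"
    and "\<And>a b. (a, b) \<in> \<Omega> \<Longrightarrow> (\<lambda>x. \<Phi> (x, b)) field_differentiable at a"
    and "\<And>a b. (a, b) \<in> \<Omega> \<Longrightarrow> (\<lambda>y. \<Phi> (a, y)) field_differentiable at b"
  shows "hol2 \<Omega> \<Phi>"
  using assms by (auto simp: hol2_def)

lemma hol2_fd1: "hol2 \<Omega> \<Phi> \<Longrightarrow> (a, b) \<in> \<Omega> \<Longrightarrow> (\<lambda>x. \<Phi> (x, b)) field_differentiable at a"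
  by (force simp: hol2_def)

lemma hol2_fd2: "hol2 \<Omega> \<Phi> \<Longrightarrow> (a, b) \<in> \<Omega> \<Longrightarrow> (\<lambda>y. \<Phi> (a, y)) field_differentiable at b"
  by (force simp: hol2_def)

lemma hol2_slice1: "hol2 \<Omega> \<Phi> \<Longrightarrow> S \<times> {b} \<subseteq> \<Omega> \<Longrightarrow> (\<lambda>x. \<Phi> (x, b)) holomorphic_on S"
  unfolding holomorphic_on_def using hol2_fd1 field_differentiable_at_within by fast

lemma hol2_slice2: "hol2 \<Omega> \<Phi> \<Longrightarrow> {a} \<times> S \<subseteq> \<Omega> \<Longrightarrow> (\<lambda>y. \<Phi> (a, y)) holomorphic_on S"
  unfolding holomorphic_on_def using hol2_fd2 field_differentiable_at_within by fast

lemma open_contains_cpolydisc: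
  fixes \<Omega> :: "(complex \<times> complex) set"
  assumes "open \<Omega>" "(a, b) \<in> \<Omega>"
  obtains \<rho> where "\<rho> > 0" "cball a \<rho> \<times> cball b \<rho> \<subseteq> \<Omega>"
proof -
  obtain A B where AB: "open A" "open B" "a \<in> A" "b \<in> B" "A \<times> B \<subseteq> \<Omega>"
    using open_prod_elim[OF assms] by (metis SigmaE2)
  obtain e1 where e1: "e1 > 0" "cball a e1 \<subseteq> A"
    using AB open_contains_cball by meson
  obtain e2 where e2: "e2 > 0" "cball b e2 \<subseteq> B"
    using AB open_contains_cball by meson
  have "cball a (min e1 e2) \<times> cball b (min e1 e2) \<subseteq> \<Omega>"
    using e1 e2 AB by (auto simp: subset_iff)
  then show ?thesis using that e1(1) e2(1) by (meson min_less_iff_conj)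
qed

lemma slice_open:
  fixes \<Omega> :: "(complex \<times> complex) set"
  assumes "open \<Omega>" "(a, b) \<in> \<Omega>"
  obtains e where "e > 0" "ball a e \<times> {b} \<subseteq> \<Omega>" "{a} \<times> ball b e \<subseteq> \<Omega>"
proof -
  from open_contains_cpolydisc[OF assms] obtain e where e: "e > 0" "cball a e \<times> cball b e \<subseteq> \<Omega>" .
  from e have "ball a e \<times> {b} \<subseteq> \<Omega>" "{a} \<times> ball b e \<subseteq> \<Omega>" by auto
  with e(1) that show ?thesis by blast
qed

text \<open>First-order Taylor expansion, with the second derivative bounded by Cauchy's estimate.
  The rate depends only on \<open>M\<close> and \<open>R\<close>, so it is uniform over all slices
  that share a bound.\<close>

lemma deriv_quotient_error:
  fixes f :: "complex \<Rightarrow> complex"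
  assumes f: "f holomorphic_on ball x R" and R: "R > 0"
    and M: "\<And>y. y \<in> ball x R \<Longrightarrow> norm (f y) \<le> M"
    and h: "h \<noteq> 0" "norm h < R/2"
  shows "norm ((f (x + h) - f x) / h - deriv f x) \<le> 32 * M / R^2 * norm h"
proof -
  \<comment> \<open>Discs of radius \<open>R/4\<close> about points of the half ball stay inside the
    ball; Cauchy's estimate on them gives 2! M / (R/4)^2, hence the 32.\<close>
  have B: "norm (deriv (deriv f) y) \<le> 32 * M / R^2" if y: "y \<in> ball x (R/2)" for y
  proof -
    have sub: "cball y (R/4) \<subseteq> ball x R"
    proof
      fix u assume "u \<in> cball y (R/4)"
      then have "dist x u < R/2 + R/4"
        using y dist_triangle[of x u y] by (auto simp: dist_commute)
      then show "u \<in> ball x R" using R by simp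
    qed
    have "norm ((deriv ^^ 2) f y) \<le> fact 2 * M / (R/4)^2"
    proof (rule Cauchy_inequality)
      show "f holomorphic_on ball y (R/4)"
        using f sub by (meson ball_subset_cball holomorphic_on_subset subset_trans)
      show "continuous_on (cball y (R/4)) f"
        by (rule continuous_on_subset[OF holomorphic_on_imp_continuous_on[OF f] sub])
      show "norm (f u) \<le> M" if "norm (y - u) = R/4" for u
        using M sub that by (auto simp: dist_norm)
    qed (use R in auto)
    moreover have "(deriv ^^ 2) f y = deriv (deriv f) y" by (simp add: eval_nat_numeral)
    moreover have "fact 2 * M / (R/4)^2 = 32 * M / R^2" by (simp add: power2_eq_square)
    ultimately show ?thesis by simp
  qed
  have T: "norm (f (x + h) - (\<Sum>i\<le>1. (deriv ^^ i) f x * (x + h - x)^i / fact i))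
        \<le> 32 * M / R^2 * norm (x + h - x) ^ Suc 1 / fact 1"
  proof (rule complex_Taylor[where S = "ball x (R/2)" and f = "\<lambda>i. (deriv ^^ i) f", simplified funpow_0])
    fix i y assume y: "y \<in> ball x (R/2)"
    have "(deriv ^^ i) f holomorphic_on ball x R"
      using f by (simp add: holomorphic_higher_deriv)
    then have "((deriv ^^ i) f has_field_derivative deriv ((deriv ^^ i) f) y) (at y)"
      by (rule holomorphic_derivI) (use y R in auto)
    then show "((deriv ^^ i) f has_field_derivative (deriv ^^ Suc i) f y) (at y within ball x (R/2))"
      by (simp add: has_field_derivative_at_within)
  qed (use B h R in \<open>auto simp: dist_norm\<close>)
  have "(f (x + h) - f x) / h - deriv f x = (f (x + h) - (f x + deriv f x * h)) / h"
    using h by (simp add: field_simps)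
  then have "norm ((f (x + h) - f x) / h - deriv f x) = norm (f (x + h) - (f x + deriv f x * h)) / norm h"
    by (simp add: norm_divide)
  also have "\<dots> \<le> 32 * M / R^2 * norm h"
  proof -
    have "norm (f (x + h) - (f x + deriv f x * h)) \<le> (32 * M / R^2 * norm h) * norm h"
      using T by (simp add: power2_eq_square mult_ac)
    then show ?thesis using h by (simp add: pos_divide_le_eq)
  qed
  finally show ?thesis .
qed

text \<open>Osgood's lemma: the partial difference quotients converge locally uniformly, by Cauchy's
  estimate for the second derivative.\<close>
lemma hol2_d1:
  assumes op: "open \<Omega>" and H: "hol2 \<Omega> \<Phi>"
  shows "hol2 \<Omega> (d1 \<Phi>)"
proof -
  have loc: "\<exists>e>0. hol2 (ball a e \<times> ball b e) (d1 \<Phi>) \<and> ball a e \<times> ball b e \<subseteq> \<Omega>" if ab: "(a, b) \<in> \<Omega>" for a b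
  proof -
    obtain \<rho> where \<rho>: "\<rho> > 0" "cball a \<rho> \<times> cball b \<rho> \<subseteq> \<Omega>"
      using open_contains_cpolydisc[OF op ab] .
    have "compact (\<Phi> ` (cball a \<rho> \<times> cball b \<rho>))"
      by (intro compact_continuous_image compact_Times continuous_on_subset[OF hol2_cont[OF H]]) (use \<rho> in auto)
    then obtain M where "\<And>u. u \<in> \<Phi> ` (cball a \<rho> \<times> cball b \<rho>) \<Longrightarrow> norm u \<le> M"
      using compact_imp_bounded bounded_iff by metis
    then have M: "\<And>x y. x \<in> cball a \<rho> \<Longrightarrow> y \<in> cball b \<rho> \<Longrightarrow> norm (\<Phi> (x, y)) \<le> M" by blast
    \<comment> \<open>Half the radius leaves room for the shift by \<open>h n\<close> inside the
      polydisc on which \<open>M\<close> is a bound.\<close>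
    define R where "R = \<rho>/2"
    have R: "R > 0" using \<rho> by (simp add: R_def)
    \<comment> \<open>A real null sequence of modulus at most \<open>R/4\<close>, below the
      \<open>R/2\<close> that the quotient estimate demands.\<close>
    define h where "h n = complex_of_real (R / (2 * (real n + 2)))" for n :: nat
    have nh: "norm (h n) = R / (2 * (real n + 2))" for n
      unfolding h_def norm_of_real using R by simp
    have h: "h n \<noteq> 0" "norm (h n) < R/2" for n
    proof -
      show "h n \<noteq> 0" using R unfolding h_def of_real_eq_0_iff by simp
      have "R / (2 * (real n + 2)) \<le> R / 4" using R by (intro divide_left_mono) auto
      then show "norm (h n) < R/2" using R unfolding nh by linarith
    qed
    define U where "U = ball a R \<times> ball b R"
    define q where "q n p = (\<Phi> (fst p + h n, snd p) - \<Phi> p) / h n" for n p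
    have inball: "x + k \<in> cball a \<rho>" if "x \<in> ball a R" "norm k < R" for x k
    proof -
      have "dist a (x + k) \<le> dist a x + norm k"
        using norm_triangle_ineq4[of "a - x" k] by (simp add: dist_norm algebra_simps)
      then show ?thesis using that R_def by auto
    qed
    have xin: "x \<in> cball a \<rho>" if "x \<in> ball a R" for x using that R R_def by auto
    have yin: "y \<in> cball b \<rho>" if "y \<in> ball b R" for y using that R R_def by auto
    have hn1: "norm (h n) < R" for n using h(2)[of n] R by simp
    have err: "norm (q n p - d1 \<Phi> p) \<le> 32 * M / R^2 * norm (h n)" if pU: "p \<in> U" for n p
    proof -
      obtain x y where p: "p = (x, y)" "x \<in> ball a R" "y \<in> ball b R" using pU unfolding U_def by blast
      have in2: "u \<in> cball a \<rho>" if "u \<in> ball x R" for u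
        using inball[OF p(2), of "u - x"] that by (simp add: dist_norm norm_minus_commute)
      have "norm ((\<Phi> (x + h n, y) - \<Phi> (x, y)) / h n - deriv (\<lambda>x. \<Phi> (x, y)) x) \<le> 32 * M / R^2 * norm (h n)"
      proof (rule deriv_quotient_error)
        show "(\<lambda>x. \<Phi> (x, y)) holomorphic_on ball x R"
          by (rule hol2_slice1[OF H]) (use in2 yin p \<rho> in auto)
      qed (use M in2 yin p h R in auto)
      then show ?thesis by (simp add: q_def d1_def p)
    qed
    have lim0: "(\<lambda>n. 32 * M / R^2 * norm (h n)) \<longlonglongrightarrow> 0"
      unfolding nh by real_asymp
    have ul: "uniform_limit U q (d1 \<Phi>) sequentially"
    proof (rule uniform_limitI)
      fix e :: real assume "e > 0"
      then have "\<forall>\<^sub>F n in sequentially. 32 * M / R^2 * norm (h n) < e"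
        using order_tendstoD(2)[OF lim0] by simp
      then show "\<forall>\<^sub>F n in sequentially. \<forall>x\<in>U. dist (q n x) (d1 \<Phi> x) < e"
        by eventually_elim (auto simp: dist_norm intro: le_less_trans[OF err])
    qed
    have qc: "continuous_on U (q n)" for n
      unfolding q_def
    proof (intro continuous_intros)
      have "(\<lambda>p. (fst p + h n, snd p)) ` U \<subseteq> \<Omega>"
        using \<rho>(2) inball[OF _ hn1] yin unfolding U_def by fastforce
      then show "continuous_on U (\<lambda>p. \<Phi> (fst p + h n, snd p))"
        by (intro continuous_on_compose2[OF hol2_cont[OF H]] continuous_intros)
      show "continuous_on U \<Phi>"
        by (rule continuous_on_subset[OF hol2_cont[OF H]]) (use \<rho>(2) xin yin in \<open>auto simp: U_def\<close>)
    qed (use h in auto)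
    have c: "continuous_on U (d1 \<Phi>)"
      by (rule uniform_limit_theorem[OF _ ul]) (use qc in auto)
    have hx: "(\<lambda>x. d1 \<Phi> (x, y)) field_differentiable at x" if "x \<in> ball a R" "y \<in> ball b R" for x y
    proof -
      have "(\<lambda>x. \<Phi> (x, y)) holomorphic_on ball a R"
        by (rule hol2_slice1[OF H]) (use \<rho>(2) xin yin that in auto)
      then have "deriv (\<lambda>x. \<Phi> (x, y)) holomorphic_on ball a R"
        by (simp add: holomorphic_deriv)
      then show ?thesis using that unfolding d1_def
        by (simp add: holomorphic_on_imp_differentiable_at)
    qed
    \<comment> \<open>In the second variable the quotients \<open>q n\<close> are themselves
      holomorphic, hence so is their locally uniform limit.\<close>
    have hy: "(\<lambda>y. d1 \<Phi> (x, y)) field_differentiable at y" if xy: "x \<in> ball a R" "y \<in> ball b R" for x y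
    proof -
      have "(\<lambda>y. d1 \<Phi> (x, y)) holomorphic_on ball b R"
      proof (rule holomorphic_uniform_sequence[where f = "\<lambda>n y. q n (x, y)"])
        show "(\<lambda>y. q n (x, y)) holomorphic_on ball b R" for n
        proof -
          have "(\<lambda>y. \<Phi> (x + h n, y)) holomorphic_on ball b R" "(\<lambda>y. \<Phi> (x, y)) holomorphic_on ball b R"
            by (rule hol2_slice2[OF H]; use \<rho>(2) inball[OF xy(1) hn1] yin xin xy in auto)+
          then show ?thesis unfolding q_def by (auto intro!: holomorphic_intros simp: h)
        qed
        fix y assume "y \<in> ball b R"
        then obtain d where d: "d > 0" "cball y d \<subseteq> ball b R"
          by (meson open_ball open_contains_cball)
        have "uniform_limit (cball y d) (\<lambda>n y. q n (x, y)) (\<lambda>y. d1 \<Phi> (x, y)) sequentially"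
        proof (rule uniform_limitI)
          fix e :: real assume "e > 0"
          from uniform_limitD[OF ul this]
          show "\<forall>\<^sub>F n in sequentially. \<forall>y\<in>cball y d. dist (q n (x, y)) (d1 \<Phi> (x, y)) < e"
            by eventually_elim (use d xy in \<open>auto simp: U_def\<close>)
        qed
        then show "\<exists>d>0. cball y d \<subseteq> ball b R \<and>
           uniform_limit (cball y d) (\<lambda>n y. q n (x, y)) (\<lambda>y. d1 \<Phi> (x, y)) sequentially"
          using d by blast
      qed auto
      then show ?thesis using that by (simp add: holomorphic_on_imp_differentiable_at)
    qed
    have "hol2 U (d1 \<Phi>)" using c hx hy by (auto simp: hol2_def U_def)
    moreover have "U \<subseteq> \<Omega>" using \<rho>(2) xin yin by (auto simp: U_def)
    ultimately show ?thesis using R unfolding U_def by blast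
  qed
  have "continuous_on \<Omega> (d1 \<Phi>)"
  proof (subst continuous_on_eq_continuous_at[OF op], safe)
    fix a b assume "(a, b) \<in> \<Omega>"
    from loc[OF this] obtain e where e: "e > 0" "hol2 (ball a e \<times> ball b e) (d1 \<Phi>)" by blast
    then have "continuous_on (ball a e \<times> ball b e) (d1 \<Phi>)" by (simp add: hol2_def)
    moreover have "open (ball a e \<times> ball b e)" by (simp add: open_Times)
    ultimately show "isCont (d1 \<Phi>) (a, b)"
      using e(1) by (simp add: continuous_on_eq_continuous_at)
  qed
  moreover have "(\<lambda>x. d1 \<Phi> (x, b)) field_differentiable at a" "(\<lambda>y. d1 \<Phi> (a, y)) field_differentiable at b"
    if "(a, b) \<in> \<Omega>" for a b
    using loc[OF that] by (auto simp: hol2_def)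
  ultimately show ?thesis by (auto simp: hol2_def)
qed

lemma hol2_swap:
  assumes "hol2 \<Omega> \<Phi>" shows "hol2 (prod.swap ` \<Omega>) (\<Phi> \<circ> prod.swap)"
proof -
  have *: "continuous_on (prod.swap ` \<Omega>) (\<Phi> \<circ> prod.swap)"
    by (rule continuous_on_compose) (use assms in \<open>auto simp: hol2_def image_image intro!: continuous_intros\<close>)
  show ?thesis by (rule hol2I[OF *]) (use assms in \<open>auto simp: hol2_def\<close>)
qed

lemma open_swap_image:
  fixes \<Omega> :: "(complex \<times> complex) set"
  assumes "open \<Omega>" shows "open (prod.swap ` \<Omega>)"
proof -
  have "prod.swap ` \<Omega> = prod.swap -` \<Omega>" by (force simp: image_iff)
  moreover have "open (prod.swap -` \<Omega>)"
    by (intro open_vimage assms continuous_intros)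
  ultimately show ?thesis by simp
qed

lemma hol2_d2:
  assumes op: "open \<Omega>" and H: "hol2 \<Omega> \<Phi>"
  shows "hol2 \<Omega> (d2 \<Phi>)"
proof -
  have "hol2 (prod.swap ` prod.swap ` \<Omega>) (d1 (\<Phi> \<circ> prod.swap) \<circ> prod.swap)"
    by (intro hol2_swap hol2_d1 open_swap_image op H)
  moreover have "d1 (\<Phi> \<circ> prod.swap) \<circ> prod.swap = d2 \<Phi>"
    by (auto simp: d1_def d2_def fun_eq_iff)
  ultimately show ?thesis by (simp add: image_image)
qed

text \<open>Joint differentiability follows from one partial derivative at the point, the other on a
  neighbourhood, and continuity of the latter; Osgood's lemma supplies this continuity.\<close>

lemma hol2_has_derivative:
  assumes op: "open \<Omega>" and H: "hol2 \<Omega> \<Phi>" and p: "(a, b) \<in> \<Omega>"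
  shows "(\<Phi> has_derivative (\<lambda>(h, k). d1 \<Phi> (a, b) * h + d2 \<Phi> (a, b) * k)) (at (a, b))"
proof -
  obtain \<rho> where \<rho>: "\<rho> > 0" "cball a \<rho> \<times> cball b \<rho> \<subseteq> \<Omega>"
    using open_contains_cpolydisc[OF op p] .
  define X where "X = ball a \<rho>"
  define Y where "Y = ball b \<rho>"
  have XY: "open X" "open Y" "a \<in> X" "b \<in> Y" "convex Y" "X \<times> Y \<subseteq> \<Omega>"
    using \<rho> by (auto simp: X_def Y_def)
  have cont: "continuous (at (a, b) within X \<times> Y) (\<lambda>(x, y). blinfun_mult_right (d2 \<Phi> (x, y)))"
  proof -
    have "continuous_on \<Omega> (d2 \<Phi>)" using hol2_d2[OF op H] by (simp add: hol2_def)
    then have "isCont (d2 \<Phi>) (a, b)" using p op continuous_on_eq_continuous_at by blast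
    then have "isCont (\<lambda>p. blinfun_mult_right (d2 \<Phi> p)) (a, b)"
      using bounded_linear.isCont[OF bounded_linear_blinfun_mult_right] by blast
    then show ?thesis by (simp add: case_prod_beta' continuous_at_imp_continuous_at_within)
  qed
  have "((\<lambda>(x, y). \<Phi> (x, y)) has_derivative (\<lambda>(tx, ty). d1 \<Phi> (a, b) * tx +
        blinfun_apply (blinfun_mult_right (d2 \<Phi> (a, b))) ty)) (at (a, b) within X \<times> Y)"
  proof (rule has_derivative_partialsI[where fy = "\<lambda>x y. blinfun_mult_right (d2 \<Phi> (x, y))"])
    show "((\<lambda>x. \<Phi> (x, b)) has_derivative (*) (d1 \<Phi> (a, b))) (at a within X)"
      using hol2_d1_has[OF H p] by (simp add: has_field_derivative_def has_derivative_at_withinI)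
    show "((\<lambda>y. \<Phi> (x, y)) has_derivative blinfun_apply (blinfun_mult_right (d2 \<Phi> (x, y)))) (at y within Y)"
      if "x \<in> X" "y \<in> Y" for x y
    proof -
      have "(x, y) \<in> \<Omega>" using that XY by auto
      from hol2_d2_has[OF H this] show ?thesis
        by (auto simp: has_field_derivative_def intro: has_derivative_at_withinI)
    qed
  qed (use XY cont in auto)
  moreover have "at (a, b) within X \<times> Y = at (a, b)"
    using XY by (intro at_within_open) (auto simp: open_Times)
  ultimately show ?thesis by simp
qed

lemma hol2_chain:
  assumes op: "open \<Omega>" and H: "hol2 \<Omega> \<Phi>" and p: "(f s, g s) \<in> \<Omega>"
    and f: "(f has_field_derivative f') (at s)" and g: "(g has_field_derivative g') (at s)"
  shows "((\<lambda>s. \<Phi> (f s, g s)) has_field_derivative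
           d1 \<Phi> (f s, g s) * f' + d2 \<Phi> (f s, g s) * g') (at s)"
proof -
  have "((\<lambda>s. \<Phi> (f s, g s)) has_derivative
      (\<lambda>h. (\<lambda>(h, k). d1 \<Phi> (f s, g s) * h + d2 \<Phi> (f s, g s) * k) (f' * h, g' * h))) (at s)"
    by (rule has_derivative_compose[where f = "\<lambda>s. (f s, g s)" and f' = "\<lambda>h. (f' * h, g' * h)",
          OF has_derivative_Pair hol2_has_derivative[OF op H p]])
      (use f g in \<open>auto simp: has_field_derivative_def\<close>)
  then show ?thesis
    unfolding has_field_derivative_def by (rule has_derivative_eq_rhs) (auto simp: algebra_simps)
qed

text \<open>The coefficient of \<open>cnj h\<close> is \<open>d2 \<Phi>\<close>: the Wirtinger
  derivative in conj z becomes an ordinary complex derivative in the second variable.\<close>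

lemma hol2_chain_cnj:
  assumes op: "open \<Omega>" and H: "hol2 \<Omega> \<Phi>" and p: "(z, cnj z) \<in> \<Omega>"
  shows "((\<lambda>z. \<Phi> (z, cnj z)) has_derivative
           (\<lambda>h. d1 \<Phi> (z, cnj z) * h + d2 \<Phi> (z, cnj z) * cnj h)) (at z)"
proof -
  have "((\<lambda>s. \<Phi> (s, cnj s)) has_derivative
      (\<lambda>h. (\<lambda>(h, k). d1 \<Phi> (z, cnj z) * h + d2 \<Phi> (z, cnj z) * k) (h, cnj h))) (at z)"
    by (rule has_derivative_compose[where f = "\<lambda>s. (s, cnj s)" and f' = "\<lambda>h. (h, cnj h)",
          OF has_derivative_Pair hol2_has_derivative[OF op H p]])
      (auto intro: has_derivative_cnj has_derivative_ident)
  then show ?thesis by simp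
qed

lemma hol2_comp_hol:
  assumes op: "open \<Omega>" and H: "hol2 \<Omega> \<Phi>" and S: "open S"
    and f: "f holomorphic_on S" and g: "g holomorphic_on S"
    and m: "\<And>s. s \<in> S \<Longrightarrow> (f s, g s) \<in> \<Omega>"
  shows "(\<lambda>s. \<Phi> (f s, g s)) holomorphic_on S"
  unfolding holomorphic_on_open[OF S]
proof (intro ballI)
  fix s assume s: "s \<in> S"
  from hol2_chain[OF op H m[OF s] holomorphic_derivI[OF f S s] holomorphic_derivI[OF g S s]]
  show "\<exists>f'. ((\<lambda>s. \<Phi> (f s, g s)) has_field_derivative f') (at s)" by blast
qed

lemma hol2_compose2:
  assumes op: "open \<Omega>" and H: "hol2 \<Omega> \<Phi>" and f: "hol2 \<Omega>' f" and g: "hol2 \<Omega>' g"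
    and m: "\<And>p. p \<in> \<Omega>' \<Longrightarrow> (f p, g p) \<in> \<Omega>"
  shows "hol2 \<Omega>' (\<lambda>p. \<Phi> (f p, g p))"
proof (rule hol2I)
  show "continuous_on \<Omega>' (\<lambda>p. \<Phi> (f p, g p))"
    by (rule continuous_on_compose2[OF hol2_cont[OF H]])
      (use m in \<open>auto intro!: continuous_intros hol2_cont f g\<close>)
  fix a b assume p: "(a, b) \<in> \<Omega>'"
  from hol2_chain[OF op H _ hol2_d1_has[OF f p] hol2_d1_has[OF g p]] m[OF p]
  show "(\<lambda>x. \<Phi> (f (x, b), g (x, b))) field_differentiable at a"
    unfolding field_differentiable_def by blast
  from hol2_chain[OF op H _ hol2_d2_has[OF f p] hol2_d2_has[OF g p]] m[OF p]
  show "(\<lambda>x. \<Phi> (f (a, x), g (a, x))) field_differentiable at b"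
    unfolding field_differentiable_def by blast
qed

section \<open>Closure properties of holomorphy in two variables\<close>

lemma hol2_const: "hol2 \<Omega> (\<lambda>_. c)"
  by (rule hol2I) auto

lemma hol2_fst: "hol2 \<Omega> fst"
  by (rule hol2I) (auto intro!: continuous_intros)

lemma hol2_snd: "hol2 \<Omega> snd"
  by (rule hol2I) (auto intro!: continuous_intros)

lemma hol2_add: "hol2 \<Omega> f \<Longrightarrow> hol2 \<Omega> g \<Longrightarrow> hol2 \<Omega> (\<lambda>p. f p + g p)"
  by (simp add: hol2_def continuous_on_add field_differentiable_add)

lemma hol2_diff: "hol2 \<Omega> f \<Longrightarrow> hol2 \<Omega> g \<Longrightarrow> hol2 \<Omega> (\<lambda>p. f p - g p)"
  by (simp add: hol2_def continuous_on_diff field_differentiable_diff)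

lemma hol2_mult: "hol2 \<Omega> f \<Longrightarrow> hol2 \<Omega> g \<Longrightarrow> hol2 \<Omega> (\<lambda>p. f p * g p)"
  by (simp add: hol2_def continuous_on_mult field_differentiable_mult)

lemma hol2_uminus: "hol2 \<Omega> f \<Longrightarrow> hol2 \<Omega> (\<lambda>p. - f p)"
  by (simp add: hol2_def continuous_on_minus field_differentiable_minus)

lemma hol2_divide:
  "hol2 \<Omega> f \<Longrightarrow> hol2 \<Omega> g \<Longrightarrow> (\<And>p. p \<in> \<Omega> \<Longrightarrow> g p \<noteq> 0) \<Longrightarrow> hol2 \<Omega> (\<lambda>p. f p / g p)"
  by (simp add: hol2_def continuous_on_divide field_differentiable_divide)

lemma hol2_power: "hol2 \<Omega> f \<Longrightarrow> hol2 \<Omega> (\<lambda>p. f p ^ n)"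
  by (induction n) (auto intro: hol2_const hol2_mult)

lemma hol2_comp1:
  assumes f: "f holomorphic_on S" and S: "open S" and H: "hol2 \<Omega> \<Phi>" and m: "\<And>p. p \<in> \<Omega> \<Longrightarrow> \<Phi> p \<in> S"
  shows "hol2 \<Omega> (\<lambda>p. f (\<Phi> p))"
proof -
  have "hol2 (S \<times> UNIV) (\<lambda>p. f (fst p))"
  proof (rule hol2I)
    show "continuous_on (S \<times> UNIV) (\<lambda>p. f (fst p))"
      by (rule continuous_on_compose2[OF holomorphic_on_imp_continuous_on[OF f]])
        (auto intro!: continuous_intros)
  qed (use f S in \<open>auto simp: holomorphic_on_imp_differentiable_at\<close>)
  from hol2_compose2[OF _ this H hol2_const[of _ 0]] show ?thesis using m S by (simp add: open_Times)
qed

lemma hol2_powr: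
  assumes "hol2 \<Omega> f" "\<And>p. p \<in> \<Omega> \<Longrightarrow> f p \<notin> \<real>\<^sub>\<le>\<^sub>0"
  shows "hol2 \<Omega> (\<lambda>p. f p powr c)"
  by (rule hol2_comp1[of "\<lambda>z. z powr c" "- \<real>\<^sub>\<le>\<^sub>0"])
    (use assms in \<open>auto intro!: holomorphic_intros closed_nonpos_Reals_complex\<close>)

lemma hol2_sum:
  "(\<And>k. k \<in> A \<Longrightarrow> hol2 \<Omega> (f k)) \<Longrightarrow> hol2 \<Omega> (\<lambda>p. \<Sum>k\<in>A. f k p)"
  by (induction A rule: infinite_finite_induct) (auto intro: hol2_const hol2_add)

section \<open>Locally uniformly convergent series in two variables\<close>

lemma hol2_local:
  assumes "open \<Omega>" "\<And>p. p \<in> \<Omega> \<Longrightarrow> \<exists>N. open N \<and> p \<in> N \<and> hol2 N f"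
  shows "hol2 \<Omega> f"
proof -
  have "isCont f p" if "p \<in> \<Omega>" for p
    using assms(2)[OF that] hol2_cont continuous_on_eq_continuous_at by blast
  then have "continuous_on \<Omega> f" by (simp add: continuous_at_imp_continuous_on)
  then show ?thesis using assms(2) unfolding hol2_def by blast
qed

text \<open>A Weierstrass majorant near every point. Local majorants suffice for holomorphy of the
  sum and exist where a single one on all of \<Omega> may fail to, as for a power series on its open
  disc of convergence.\<close>

definition locally_summable :: "(complex \<times> complex) set \<Rightarrow> (nat \<Rightarrow> complex \<times> complex \<Rightarrow> complex) \<Rightarrow> bool" where
  "locally_summable \<Omega> f \<longleftrightarrow> (\<forall>p\<in>\<Omega>. \<exists>N M. open N \<and> p \<in> N \<and> summable M \<and> (\<forall>k. \<forall>q\<in>N \<inter> \<Omega>. norm (f k q) \<le> M k))"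

lemma loc_summableI:
  assumes "\<And>p. p \<in> \<Omega> \<Longrightarrow> \<exists>N M. open N \<and> p \<in> N \<and> summable M \<and> (\<forall>k. \<forall>q\<in>N \<inter> \<Omega>. norm (f k q) \<le> M k)"
  shows "locally_summable \<Omega> f"
  using assms by (simp add: locally_summable_def)

lemma locally_summable_norm:
  assumes "locally_summable \<Omega> f" "p \<in> \<Omega>" shows "summable (\<lambda>k. norm (f k p))"
proof -
  obtain N M where "p \<in> N" "summable M" "\<forall>k. \<forall>q\<in>N \<inter> \<Omega>. norm (f k q) \<le> M k"
    using bspec[OF assms(1)[unfolded locally_summable_def] assms(2)] by blast
  then show ?thesis using assms(2) by (intro summable_comparison_test[of "\<lambda>k. norm (f k p)" M]) auto
qed

lemma locally_summable_sums:
  assumes "locally_summable \<Omega> f" "p \<in> \<Omega>" shows "(\<lambda>k. f k p) sums (\<Sum>k. f k p)"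
  by (intro summable_sums summable_norm_cancel[OF locally_summable_norm[OF assms]])

lemma hol2_series:
  assumes op: "open \<Omega>" and f: "\<And>k. hol2 \<Omega> (f k)" and ls: "locally_summable \<Omega> f"
  shows "hol2 \<Omega> (\<lambda>p. \<Sum>k. f k p)"
proof (rule hol2_local[OF op])
  fix p assume p: "p \<in> \<Omega>"
  obtain N M where N: "open N" "p \<in> N" "summable M" "\<forall>k. \<forall>q\<in>N \<inter> \<Omega>. norm (f k q) \<le> M k"
    using bspec[OF ls[unfolded locally_summable_def] p] by meson
  define U where "U = N \<inter> \<Omega>"
  have U: "open U" "p \<in> U" "U \<subseteq> \<Omega>" using N p op by (auto simp: U_def)
  have ul: "uniform_limit U (\<lambda>n q. \<Sum>k<n. f k q) (\<lambda>q. \<Sum>k. f k q) sequentially"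
    by (rule Weierstrass_m_test[OF _ N(3)]) (use N(4) U_def in auto)
  have h: "hol2 U (\<lambda>q. \<Sum>k<n. f k q)" for n
    by (intro hol2_sum hol2_subset[OF f U(3)])
  have "hol2 U (\<lambda>q. \<Sum>k. f k q)"
  proof (rule hol2I)
    show "continuous_on U (\<lambda>q. \<Sum>k. f k q)"
      by (rule uniform_limit_theorem[OF _ ul]) (use h hol2_cont in auto)
    fix a b assume ab: "(a, b) \<in> U"
    obtain e where e: "e > 0" "ball a e \<times> {b} \<subseteq> U" "{a} \<times> ball b e \<subseteq> U"
      using slice_open[OF U(1) ab] .
    have "(\<lambda>x. \<Sum>k. f k (x, b)) holomorphic_on ball a e"
    proof (rule holomorphic_uniform_sequence[OF _ hol2_slice1[OF h e(2)]])
      fix x assume "x \<in> ball a e"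
      then obtain d where d: "d > 0" "cball x d \<subseteq> ball a e" by (meson open_ball open_contains_cball)
      have "uniform_limit (cball x d) (\<lambda>n x. \<Sum>k<n. f k (x, b)) (\<lambda>x. \<Sum>k. f k (x, b)) sequentially"
        by (rule uniform_limit_compose'[OF ul]) (use d e in auto)
      then show "\<exists>d>0. cball x d \<subseteq> ball a e \<and>
          uniform_limit (cball x d) (\<lambda>n x. \<Sum>k<n. f k (x, b)) (\<lambda>x. \<Sum>k. f k (x, b)) sequentially"
        using d by blast
    qed auto
    then show "(\<lambda>x. \<Sum>k. f k (x, b)) field_differentiable at a"
      using e(1) by (simp add: holomorphic_on_imp_differentiable_at)
    have "(\<lambda>x. \<Sum>k. f k (a, x)) holomorphic_on ball b e"
    proof (rule holomorphic_uniform_sequence[OF _ hol2_slice2[OF h e(3)]])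
      fix x assume "x \<in> ball b e"
      then obtain d where d: "d > 0" "cball x d \<subseteq> ball b e" by (meson open_ball open_contains_cball)
      have "uniform_limit (cball x d) (\<lambda>n x. \<Sum>k<n. f k (a, x)) (\<lambda>x. \<Sum>k. f k (a, x)) sequentially"
        by (rule uniform_limit_compose'[OF ul]) (use d e in auto)
      then show "\<exists>d>0. cball x d \<subseteq> ball b e \<and>
          uniform_limit (cball x d) (\<lambda>n x. \<Sum>k<n. f k (a, x)) (\<lambda>x. \<Sum>k. f k (a, x)) sequentially"
        using d by blast
    qed auto
    then show "(\<lambda>x. \<Sum>k. f k (a, x)) field_differentiable at b"
      using e(1) by (simp add: holomorphic_on_imp_differentiable_at)
  qed
  with U show "\<exists>N. open N \<and> p \<in> N \<and> hol2 N (\<lambda>p. \<Sum>k. f k p)" by blast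
qed

text \<open>For holomorphic terms a majorant of the terms already controls the derivatives, so the
  series may be differentiated termwise on each slice.\<close>

lemma hol2_series_d2:
  assumes op: "open \<Omega>" and f: "\<And>k. hol2 \<Omega> (f k)" and ls: "locally_summable \<Omega> f" and p: "p \<in> \<Omega>"
  shows "(\<lambda>k. d2 (f k) p) sums d2 (\<lambda>p. \<Sum>k. f k p) p"
proof -
  obtain a b where ab: "p = (a, b)" by (cases p)
  obtain N M where N: "open N" "p \<in> N" "summable M" "\<forall>k. \<forall>q\<in>N \<inter> \<Omega>. norm (f k q) \<le> M k"
    using bspec[OF ls[unfolded locally_summable_def] p] by meson
  have "open (N \<inter> \<Omega>)" "(a, b) \<in> N \<inter> \<Omega>" using N op p ab by auto
  from slice_open[OF this] obtain e where e: "e > 0" "{a} \<times> ball b e \<subseteq> N \<inter> \<Omega>" by metis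
  have der: "\<And>n x. x \<in> ball b e \<Longrightarrow> ((\<lambda>y. f n (a, y)) has_field_derivative d2 (f n) (a, x)) (at x)"
    using e by (intro hol2_d2_has[OF f]) auto
  have bd: "\<forall>\<^sub>F n in sequentially. \<forall>x\<in>ball b e. norm (f n (a, x)) \<le> M n"
    using N(4) e(2) by (intro always_eventually allI ballI) (metis SigmaI insertI1 subsetD)
  obtain g g' where gg: "\<forall>x\<in>ball b e. (\<lambda>n. f n (a, x)) sums g x \<and>
      (\<lambda>n. d2 (f n) (a, x)) sums g' x \<and> (g has_field_derivative g' x) (at x)"
    by (rule series_and_derivative_comparison[where f = "\<lambda>n x. f n (a, x)" and
          f' = "\<lambda>n x. d2 (f n) (a, x)", OF open_ball N(3) der bd])
  then have g: "\<And>x. x \<in> ball b e \<Longrightarrow> (\<lambda>n. f n (a, x)) sums g x"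
    "\<And>x. x \<in> ball b e \<Longrightarrow> (\<lambda>n. d2 (f n) (a, x)) sums g' x"
    "\<And>x. x \<in> ball b e \<Longrightarrow> (g has_field_derivative g' x) (at x)" by simp_all
  have "((\<lambda>x. \<Sum>k. f k (a, x)) has_field_derivative g' b) (at b)"
    by (rule has_field_derivative_transform_within_open[OF g(3) open_ball[of b e]])
      (use e g(1) sums_unique in auto)
  then have "d2 (\<lambda>p. \<Sum>k. f k p) (a, b) = g' b" by (rule d2_eqI)
  then show ?thesis using g(2)[of b] e ab by simp
qed

section \<open>Wirtinger derivatives and r-harmonic functions\<close>

lemma has_derivative_partial_x:
  assumes "(F has_derivative D) (at z)"
  shows "((\<lambda>t::real. F (z + of_real t)) has_vector_derivative D 1) (at 0)"
proof -
  interpret D: bounded_linear D using assms by (rule has_derivative_bounded_linear)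
  have "((\<lambda>t::real. F (z + of_real t)) has_derivative (\<lambda>t. D (of_real t))) (at 0)"
    by (rule has_derivative_compose[where f = "\<lambda>t::real. z + of_real t" and g = F])
      (use assms in \<open>auto intro!: derivative_eq_intros\<close>)
  then show ?thesis
    unfolding has_vector_derivative_def of_real_def by (simp add: D.scaleR)
qed

lemma has_derivative_partial_y:
  assumes "(F has_derivative D) (at z)"
  shows "((\<lambda>t::real. F (z + of_real t * \<i>)) has_vector_derivative D \<i>) (at 0)"
proof -
  interpret D: bounded_linear D using assms by (rule has_derivative_bounded_linear)
  have "((\<lambda>t::real. F (z + of_real t * \<i>)) has_derivative (\<lambda>t. D (of_real t * \<i>))) (at 0)"
    by (rule has_derivative_compose[where f = "\<lambda>t::real. z + of_real t * \<i>" and g = F])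
      (use assms in \<open>auto intro!: derivative_eq_intros\<close>)
  then show ?thesis
    unfolding has_vector_derivative_def of_real_def by (simp add: D.scaleR)
qed

lemma pdx_eqI: "(F has_derivative D) (at z) \<Longrightarrow> pdx F z = D 1"
  unfolding pdx_def by (rule vector_derivative_at[OF has_derivative_partial_x])

lemma pdy_eqI: "(F has_derivative D) (at z) \<Longrightarrow> pdy F z = D \<i>"
  unfolding pdy_def by (rule vector_derivative_at[OF has_derivative_partial_y])

lemma C1_onI:
  assumes "\<And>z. z \<in> V \<Longrightarrow> (F has_derivative (\<lambda>h. P z * h + Q z * cnj h)) (at z)"
    and "continuous_on V P" "continuous_on V Q"
  shows "C1_on V F"
proof -
  have "continuous_on V F"
    using assms(1) has_derivative_continuous by (blast intro: continuous_at_imp_continuous_on)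
  moreover have "continuous_on V (pdx F)"
  proof (rule continuous_on_eq)
    show "continuous_on V (\<lambda>z. P z + Q z)" by (intro continuous_intros assms)
  qed (simp add: pdx_eqI[OF assms(1)])
  moreover have "continuous_on V (pdy F)"
  proof (rule continuous_on_eq)
    show "continuous_on V (\<lambda>z. P z * \<i> + Q z * (- \<i>))" by (intro continuous_intros assms)
  qed (simp add: pdy_eqI[OF assms(1)])
  ultimately show ?thesis
    unfolding C1_on_def has_pdx_on_def has_pdy_on_def
    using has_derivative_partial_x[OF assms(1)] has_derivative_partial_y[OF assms(1)] differentiableI_vector
    by blast
qed

text \<open>Continuous partial derivatives give a total derivative, here in Wirtinger form. This
  turns the definitions by partial derivatives into statements to which the chain and product rules
  apply.\<close>

lemma C1_on_derivative:
  assumes op: "open V" and F: "C1_on V F" and z: "z \<in> V"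
  shows "(F has_derivative (\<lambda>h. dz F z * h + dzbar F z * cnj h)) (at z)"
proof -
  obtain e where e: "e > 0" "cball z e \<subseteq> V" using op z open_contains_cball by meson
  define X where "X = ball (Re z) (e/2)"
  define Y where "Y = ball (Im z) (e/2)"
  have XYV: "Complex x y \<in> V" if "x \<in> X" "y \<in> Y" for x y
  proof -
    have "norm (z - Complex x y) \<le> \<bar>Re z - x\<bar> + \<bar>Im z - y\<bar>"
      using cmod_le[of "z - Complex x y"] by simp
    also have "\<dots> \<le> e" using that by (simp add: X_def Y_def dist_real_def)
    finally show ?thesis using e by (auto simp: dist_norm)
  qed
  define f where "f x y = F (Complex x y)" for x y
  have fx: "((\<lambda>x. f x y) has_derivative (\<lambda>h. h *\<^sub>R pdx F (Complex x y))) (at x within X)"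
    if "x \<in> X" "y \<in> Y" for x y
  proof -
    have "((\<lambda>t::real. F (Complex x y + of_real t)) has_vector_derivative pdx F (Complex x y)) (at 0)"
      using F XYV[OF that] unfolding C1_on_def has_pdx_on_def pdx_def vector_derivative_works[symmetric] by blast
    then have "((\<lambda>t::real. F (Complex x y + of_real t)) has_derivative (\<lambda>h. h *\<^sub>R pdx F (Complex x y))) (at (x - x))"
      by (simp add: has_vector_derivative_def)
    moreover have "((\<lambda>u. u - x) has_derivative (\<lambda>h. h)) (at x within X)"
      by (auto intro!: derivative_eq_intros)
    ultimately
    have "((\<lambda>u. F (Complex x y + of_real (u - x))) has_derivative (\<lambda>h. h *\<^sub>R pdx F (Complex x y))) (at x within X)"
      by (rule has_derivative_compose[where f = "\<lambda>u. u - x", rotated])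
    moreover have "Complex x y + of_real (u - x) = Complex u y" for u by (simp add: complex_eq_iff)
    ultimately show ?thesis by (simp add: f_def)
  qed
  have fy: "((\<lambda>y. f x y) has_derivative (\<lambda>h. h *\<^sub>R pdy F (Complex x y))) (at y within Y)"
    if "x \<in> X" "y \<in> Y" for x y
  proof -
    have "((\<lambda>t::real. F (Complex x y + of_real t * \<i>)) has_vector_derivative pdy F (Complex x y)) (at 0)"
      using F XYV[OF that] unfolding C1_on_def has_pdy_on_def pdy_def vector_derivative_works[symmetric] by blast
    then have "((\<lambda>t::real. F (Complex x y + of_real t * \<i>)) has_derivative (\<lambda>h. h *\<^sub>R pdy F (Complex x y))) (at (y - y))"
      by (simp add: has_vector_derivative_def)
    moreover have "((\<lambda>u. u - y) has_derivative (\<lambda>h. h)) (at y within Y)"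
      by (auto intro!: derivative_eq_intros)
    ultimately
    have "((\<lambda>u. F (Complex x y + of_real (u - y) * \<i>)) has_derivative (\<lambda>h. h *\<^sub>R pdy F (Complex x y))) (at y within Y)"
      by (rule has_derivative_compose[where f = "\<lambda>u. u - y", rotated])
    moreover have "Complex x y + of_real (u - y) * \<i> = Complex x u" for u by (simp add: complex_eq_iff)
    ultimately show ?thesis by (simp add: f_def)
  qed
  have inXY: "Re z \<in> X" "Im z \<in> Y" using e by (auto simp: X_def Y_def)
  have "continuous_on (X \<times> Y) (\<lambda>p. Complex (fst p) (snd p))"
    unfolding Complex_eq by (intro continuous_intros)
  then have "continuous_on (X \<times> Y) (\<lambda>p. pdy F (Complex (fst p) (snd p)))"
    by (rule continuous_on_compose2[where g = "pdy F" and t = V, rotated]) (use F XYV in \<open>auto simp: C1_on_def\<close>)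
  then have "continuous_on (X \<times> Y) (\<lambda>(x, y). blinfun_scaleR_left (pdy F (Complex x y)))"
    unfolding case_prod_beta' by (rule bounded_linear.continuous_on[OF bounded_linear_blinfun_scaleR_left])
  then have cont: "continuous (at (Re z, Im z) within X \<times> Y) (\<lambda>(x, y). blinfun_scaleR_left (pdy F (Complex x y)))"
    using inXY by (auto simp: continuous_on_eq_continuous_within)
  have "((\<lambda>(x, y). f x y) has_derivative (\<lambda>(tx, ty). tx *\<^sub>R pdx F (Complex (Re z) (Im z)) +
          blinfun_apply (blinfun_scaleR_left (pdy F (Complex (Re z) (Im z)))) ty)) (at (Re z, Im z) within X \<times> Y)"
    by (rule has_derivative_partialsI[where fy = "\<lambda>x y. blinfun_scaleR_left (pdy F (Complex x y))", OF fx _ cont])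
      (use fy inXY in \<open>auto simp: Y_def blinfun_scaleR_left.rep_eq\<close>)
  moreover have "at (Re z, Im z) within X \<times> Y = at (Re z, Im z)"
    by (rule at_within_open) (use inXY in \<open>auto simp: X_def Y_def open_Times\<close>)
  ultimately have *: "((\<lambda>(x, y). f x y) has_derivative (\<lambda>(tx, ty). tx *\<^sub>R pdx F z + ty *\<^sub>R pdy F z)) (at (Re z, Im z))"
    by (simp add: blinfun_scaleR_left.rep_eq)
  have "((\<lambda>w. (\<lambda>(x, y). f x y) (Re w, Im w)) has_derivative
      (\<lambda>h. (\<lambda>(tx, ty). tx *\<^sub>R pdx F z + ty *\<^sub>R pdy F z) (Re h, Im h))) (at z)"
    by (rule has_derivative_compose[where f = "\<lambda>w. (Re w, Im w)", OF _ *])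
      (auto intro!: derivative_eq_intros)
  then have "(F has_derivative (\<lambda>h. Re h *\<^sub>R pdx F z + Im h *\<^sub>R pdy F z)) (at z)"
    by (simp add: f_def)
  then show ?thesis
  proof (rule has_derivative_eq_rhs)
    show "(\<lambda>h. Re h *\<^sub>R pdx F z + Im h *\<^sub>R pdy F z) = (\<lambda>h. dz F z * h + dzbar F z * cnj h)"
    proof
      fix h
      have "dz F z * h + dzbar F z * cnj h = pdx F z * ((h + cnj h)/2) + pdy F z * (- \<i> * (h - cnj h) / 2)"
        by (simp add: dz_def dzbar_def field_simps)
      also have "(h + cnj h)/2 = of_real (Re h)" by (simp add: complex_add_cnj)
      also have "- \<i> * (h - cnj h) / 2 = of_real (Im h)" by (simp add: complex_eq_iff)
      finally show "Re h *\<^sub>R pdx F z + Im h *\<^sub>R pdy F z = dz F z * h + dzbar F z * cnj h"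
        by (simp add: scaleR_conv_of_real mult.commute)
    qed
  qed
qed

lemma dz_eqI: "(F has_derivative D) (at z) \<Longrightarrow> dz F z = (D 1 - \<i> * D \<i>) / 2"
  by (simp add: dz_def pdx_eqI pdy_eqI)

lemma dzbar_eqI: "(F has_derivative D) (at z) \<Longrightarrow> dzbar F z = (D 1 + \<i> * D \<i>) / 2"
  by (simp add: dzbar_def pdx_eqI pdy_eqI)

lemma C1_on_hol2:
  assumes "open \<Omega>" "hol2 \<Omega> \<Phi>" "\<And>z. z \<in> V \<Longrightarrow> (z, cnj z) \<in> \<Omega>"
  shows "C1_on V (\<lambda>z. \<Phi> (z, cnj z))"
proof (rule C1_onI)
  show "((\<lambda>z. \<Phi> (z, cnj z)) has_derivative (\<lambda>h. d1 \<Phi> (z, cnj z) * h + d2 \<Phi> (z, cnj z) * cnj h)) (at z)"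
    if "z \<in> V" for z
    using hol2_chain_cnj assms that by blast
  show "continuous_on V (\<lambda>z. d1 \<Phi> (z, cnj z))"
    by (rule continuous_on_compose2[OF hol2_cont[OF hol2_d1[OF assms(1,2)]]])
      (use assms(3) in \<open>auto intro!: continuous_intros\<close>)
  show "continuous_on V (\<lambda>z. d2 \<Phi> (z, cnj z))"
    by (rule continuous_on_compose2[OF hol2_cont[OF hol2_d2[OF assms(1,2)]]])
      (use assms(3) in \<open>auto intro!: continuous_intros\<close>)
qed

lemma C1_on_cong:
  assumes op: "open V" and F: "C1_on V F" and eq: "\<And>z. z \<in> V \<Longrightarrow> F z = G z"
  shows "C1_on V G" "\<And>z. z \<in> V \<Longrightarrow> pdx G z = pdx F z" "\<And>z. z \<in> V \<Longrightarrow> pdy G z = pdy F z"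
proof -
  have d: "(G has_derivative (\<lambda>h. dz F z * h + dzbar F z * cnj h)) (at z)" if "z \<in> V" for z
    using C1_on_derivative[OF op F that] has_derivative_transform_within_open[OF _ op that] eq by blast
  show x: "pdx G z = pdx F z" "pdy G z = pdy F z" if "z \<in> V" for z
    using pdx_eqI[OF d[OF that]] pdx_eqI[OF C1_on_derivative[OF op F that]]
      pdy_eqI[OF d[OF that]] pdy_eqI[OF C1_on_derivative[OF op F that]] by simp_all
  show "C1_on V G"
    by (rule C1_onI[OF d]) (use F in \<open>auto simp: C1_on_def dz_def dzbar_def intro!: continuous_intros\<close>)
qed

text \<open>\<open>pdx F\<close> and \<open>pdy F\<close> extend to d1 + d2 and i (d1 - d2) of
  \<Phi>, which are again holomorphic in two variables; second-order regularity then repeats the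
  first-order argument.\<close>

lemma C2_on_hol2:
  assumes op: "open V" "open \<Omega>" and H: "hol2 \<Omega> \<Phi>" and V: "\<And>z. z \<in> V \<Longrightarrow> (z, cnj z) \<in> \<Omega>"
    and eq: "\<And>z. z \<in> V \<Longrightarrow> F z = \<Phi> (z, cnj z)"
  shows "C2_on V F" "\<And>z. z \<in> V \<Longrightarrow> dzbar F z = d2 \<Phi> (z, cnj z)"
proof -
  let ?G = "\<lambda>z. \<Phi> (z, cnj z)"
  note C = C1_on_cong[OF op(1) C1_on_hol2[OF op(2) H V], of F, OF _ eq[symmetric]]
  have d: "(?G has_derivative (\<lambda>h. d1 \<Phi> (z, cnj z) * h + d2 \<Phi> (z, cnj z) * cnj h)) (at z)" if "z \<in> V" for z
    using hol2_chain_cnj op(2) H V that by blast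
  have h1: "hol2 \<Omega> (d1 \<Phi>)" and h2: "hol2 \<Omega> (d2 \<Phi>)"
    using hol2_d1[OF op(2) H] hol2_d2[OF op(2) H] .
  have x: "pdx F z = d1 \<Phi> (z, cnj z) + d2 \<Phi> (z, cnj z)" if "z \<in> V" for z
    using C(2)[OF _ _ that] pdx_eqI[OF d[OF that]] by simp
  have y: "pdy F z = \<i> * (d1 \<Phi> (z, cnj z) - d2 \<Phi> (z, cnj z))" if "z \<in> V" for z
    using C(3)[OF _ _ that] pdy_eqI[OF d[OF that]] by (simp add: algebra_simps)
  show "dzbar F z = d2 \<Phi> (z, cnj z)" if "z \<in> V" for z
    using x[OF that] y[OF that] by (simp add: dzbar_def)
  have "C1_on V F" by (rule C(1))
  moreover have "C1_on V (pdx F)"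
    by (rule C1_on_cong(1)[OF op(1) C1_on_hol2[OF op(2) hol2_add[OF h1 h2] V]]) (use x in auto)
  moreover have "C1_on V (pdy F)"
    by (rule C1_on_cong(1)[OF op(1) C1_on_hol2[OF op(2) hol2_mult[OF hol2_const hol2_diff[OF h1 h2]] V]])
      (use y in auto)
  ultimately show "C2_on V F" by (simp add: C2_on_def)
qed

lemma open_image_cnj: "open V \<Longrightarrow> open (cnj ` V)"
proof -
  assume "open V"
  moreover have "cnj ` V = cnj -` V" by (force simp: image_iff)
  ultimately show ?thesis by (auto intro!: open_vimage continuous_intros)
qed

section \<open>The r-harmonic equation as a condition on the derivative in conj z\<close>

lemma has_derivative_Im_powr:
  assumes "Im z > 0"
  shows "((\<lambda>z. complex_of_real (Im z) powr a) has_derivative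
     (\<lambda>h. a * of_real (Im z) powr (a - 1) * of_real (Im h))) (at z)"
proof -
  have "((\<lambda>w. w powr a) has_field_derivative a * of_real (Im z) powr (a - 1)) (at (complex_of_real (Im z)))"
    by (rule has_field_derivative_powr) (use assms in \<open>auto simp: complex_nonpos_Reals_iff\<close>)
  then have "((\<lambda>w. w powr a) has_derivative (*) (a * of_real (Im z) powr (a - 1))) (at (complex_of_real (Im z)))"
    by (simp add: has_field_derivative_def)
  moreover have "((\<lambda>z. complex_of_real (Im z)) has_derivative (\<lambda>h. complex_of_real (Im h))) (at z)"
    by (auto intro!: derivative_eq_intros)
  ultimately show ?thesis by (rule has_derivative_compose[where f = "\<lambda>z. complex_of_real (Im z)", rotated])
qed

text \<open>Applied to y^(-r) B(conj z), the derivative in z sees only y^(-r), because B(conj z) is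
  antiholomorphic. As y has derivative -i/2 in z, the result is (i r / 2) y^(-r-1) B(conj z), and
  the two terms of the equation cancel.\<close>

lemma Hr_hol2I:
  assumes op: "open V" "open \<Omega>" and VU: "V \<subseteq> UHP" and H: "hol2 \<Omega> \<Phi>"
    and V: "\<And>z. z \<in> V \<Longrightarrow> (z, cnj z) \<in> \<Omega>"
    and eq: "\<And>z. z \<in> V \<Longrightarrow> F z = \<Phi> (z, cnj z)"
    and B: "B holomorphic_on cnj ` V"
    and pde: "\<And>z. z \<in> V \<Longrightarrow> d2 \<Phi> (z, cnj z) = of_real (Im z) powr (- r) * B (cnj z)"
  shows "F \<in> Hr r V" "\<And>z. z \<in> V \<Longrightarrow> dzbar F z = of_real (Im z) powr (- r) * B (cnj z)"
proof -
  note C = C2_on_hol2[OF op H V eq]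
  show dzb: "dzbar F z = of_real (Im z) powr (- r) * B (cnj z)" if "z \<in> V" for z
    using C(2) pde that by simp
  have "- 4 * (of_real (Im z))^2 * dz (dzbar F) z + 2 * \<i> * r * of_real (Im z) * dzbar F z = 0"
    if z: "z \<in> V" for z
  proof -
    have y: "Im z > 0" using z VU by (auto simp: UHP_def)
    have "open (cnj ` V)" by (simp add: op(1) open_image_cnj)
    then obtain B' where B': "(B has_field_derivative B') (at (cnj z))"
      using B z by (meson holomorphic_on_open imageI)
    have "((\<lambda>z. B (cnj z)) has_derivative (\<lambda>h. B' * cnj h)) (at z)"
      by (rule has_derivative_compose[where f = cnj and g = B])
        (use B' in \<open>auto simp: has_field_derivative_def intro: has_derivative_cnj has_derivative_ident\<close>)
    from has_derivative_mult[OF has_derivative_Im_powr[OF y, of "- r"] this]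
    have "((\<lambda>z. of_real (Im z) powr (- r) * B (cnj z)) has_derivative
        (\<lambda>h. of_real (Im z) powr (- r) * (B' * cnj h) + - r * of_real (Im z) powr (- r - 1) * of_real (Im h) * B (cnj z))) (at z)"
      by simp
    from has_derivative_transform_within_open[OF this op(1) z, of "dzbar F"] dzb
    have D: "(dzbar F has_derivative
        (\<lambda>h. of_real (Im z) powr (- r) * (B' * cnj h) + - r * of_real (Im z) powr (- r - 1) * of_real (Im h) * B (cnj z))) (at z)"
      by simp
    define y' where "y' = complex_of_real (Im z)"
    have d: "dz (dzbar F) z = \<i> * r * y' powr (- r - 1) * B (cnj z) / 2"
      unfolding y'_def by (simp add: dz_eqI[OF D] algebra_simps)
    have p: "y' powr (- r) = y' * y' powr (- r - 1)"
      using y by (simp add: powr_diff y'_def)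
    show ?thesis
      unfolding dzb[OF z] y'_def[symmetric] d p by (simp add: power2_eq_square)
  qed
  then show "F \<in> Hr r V" using C(1) by (simp add: Hr_def)
qed

lemma C1_on_dzbar:
  assumes op: "open V" and F: "C2_on V F"
  shows "C1_on V (dzbar F)"
proof -
  have x: "C1_on V (pdx F)" and y: "C1_on V (pdy F)" using F by (auto simp: C2_on_def)
  have c: "continuous_on V (dz G)" "continuous_on V (dzbar G)" if "C1_on V G" for G
    using that by (auto simp: C1_on_def dz_def dzbar_def intro!: continuous_intros)
  show ?thesis
  proof (rule C1_onI)
    fix z assume z: "z \<in> V"
    show "(dzbar F has_derivative (\<lambda>h. ((dz (pdx F) z + \<i> * dz (pdy F) z) / 2) * h
        + ((dzbar (pdx F) z + \<i> * dzbar (pdy F) z) / 2) * cnj h)) (at z)"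
      unfolding dzbar_def[of F, abs_def]
      using C1_on_derivative[OF op x z] C1_on_derivative[OF op y z]
      by (auto intro!: derivative_eq_intros simp: field_simps fun_eq_iff)
  qed (auto intro!: continuous_intros c x y)
qed

text \<open>Converse of \<open>Hr_hol2I\<close>: the equation says that y^r \<open>dzbar F\<close>
  has vanishing derivative in z, so it is complex differentiable as a function of conj z.\<close>

lemma Hr_dzbar_antihol:
  assumes op: "open V" and VU: "V \<subseteq> UHP" and F: "F \<in> Hr r V"
  obtains B where "B holomorphic_on cnj ` V"
    "\<And>z. z \<in> V \<Longrightarrow> dzbar F z = of_real (Im z) powr (- r) * B (cnj z)"
proof -
  define B where "B \<zeta> = of_real (Im (cnj \<zeta>)) powr r * dzbar F (cnj \<zeta>)" for \<zeta>
  have "dzbar F z = of_real (Im z) powr (- r) * B (cnj z)" if "z \<in> V" for z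
    using that VU by (auto simp: B_def UHP_def powr_minus divide_simps)
  moreover have "B holomorphic_on cnj ` V"
    unfolding holomorphic_on_open[OF open_image_cnj[OF op]]
  proof safe
    fix z assume z: "z \<in> V"
    have y: "Im z > 0" using z VU by (auto simp: UHP_def)
    have "C1_on V (dzbar F)" using F op by (simp add: Hr_def C1_on_dzbar)
    note D = C1_on_derivative[OF op this z]
    define q where "q = dzbar F z"
    define y' where "y' = complex_of_real (Im z)"
    have y'0: "y' \<noteq> 0" using y by (simp add: y'_def)
    have "- 4 * y'^2 * dz (dzbar F) z + 2 * \<i> * r * y' * q = 0"
      using F z by (simp add: Hr_def q_def y'_def)
    then have "4 * y' * (\<i> * r * q / 2) - 4 * y' * (y' * dz (dzbar F) z) = 0"
      by (simp add: power2_eq_square algebra_simps)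
    then have "4 * y' * (y' * dz (dzbar F) z) = 4 * y' * (\<i> * r * q / 2)"
      unfolding right_minus_eq by (rule sym)
    then have p: "y' * dz (dzbar F) z = \<i> * r * q / 2" using y'0 unfolding mult_cancel_left by simp
    have pw: "y' powr r = y' * y' powr (r - 1)" using y'0 by (simp add: powr_diff)
    have "((\<lambda>z. of_real (Im z) powr r * dzbar F z) has_derivative
       (\<lambda>h. y' powr r * (dz (dzbar F) z * h + dzbar (dzbar F) z * cnj h)
          + r * y' powr (r - 1) * of_real (Im h) * q)) (at z)"
      using has_derivative_mult[OF has_derivative_Im_powr[OF y, of r] D] by (simp add: y'_def q_def)
    \<comment> \<open>The relation \<open>p\<close> balances the coefficient of h against the
      contribution of Im h = -i (h - conj h) / 2; only a multiple of \<open>cnj h\<close>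
      survives.\<close>
    then have "((\<lambda>z. of_real (Im z) powr r * dzbar F z) has_derivative
       (\<lambda>h. (y' powr r * dzbar (dzbar F) z + \<i> * r * y' powr (r - 1) * q / 2) * cnj h)) (at z)"
    proof (rule has_derivative_eq_rhs, intro ext)
      fix h
      have Im_h: "complex_of_real (Im h) = - \<i> * (h - cnj h) / 2" by (simp add: complex_eq_iff)
      have "y' powr r * (dz (dzbar F) z * h + dzbar (dzbar F) z * cnj h)
          + r * y' powr (r - 1) * of_real (Im h) * q =
        y' powr (r - 1) * ((y' * dz (dzbar F) z) * h) + y' powr r * dzbar (dzbar F) z * cnj h
          + r * y' powr (r - 1) * of_real (Im h) * q"
        by (simp add: pw algebra_simps)
      also have "\<dots> = (y' powr r * dzbar (dzbar F) z + \<i> * r * y' powr (r - 1) * q / 2) * cnj h"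
        unfolding p Im_h by (simp add: field_simps)
      finally show "y' powr r * (dz (dzbar F) z * h + dzbar (dzbar F) z * cnj h)
          + r * y' powr (r - 1) * of_real (Im h) * q =
        (y' powr r * dzbar (dzbar F) z + \<i> * r * y' powr (r - 1) * q / 2) * cnj h" .
    qed
    then have "((\<lambda>z. of_real (Im z) powr r * dzbar F z) has_derivative
       (\<lambda>h. (y' powr r * dzbar (dzbar F) z + \<i> * r * y' powr (r - 1) * q / 2) * cnj h)) (at (cnj (cnj z)))"
      by simp
    from has_derivative_compose[where f = cnj, OF has_derivative_cnj[OF has_derivative_ident] this]
    show "\<exists>f'. (B has_field_derivative f') (at (cnj z))"
      unfolding has_field_derivative_def B_def[abs_def] by auto
  qed
  ultimately show ?thesis using that by blast
qed

lemma C1_on_same_dzbar_holomorphic: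
  assumes op: "open V" and F: "C1_on V F" and G: "C1_on V G"
    and eq: "\<And>z. z \<in> V \<Longrightarrow> dzbar F z = dzbar G z"
  shows "(\<lambda>z. F z - G z) holomorphic_on V"
  unfolding holomorphic_on_open[OF op]
proof
  fix z assume z: "z \<in> V"
  have "((\<lambda>z. F z - G z) has_derivative (\<lambda>h. (dz F z - dz G z) * h)) (at z)"
    using has_derivative_diff[OF C1_on_derivative[OF op F z] C1_on_derivative[OF op G z]] eq[OF z]
    by (simp add: algebra_simps)
  then show "\<exists>f'. ((\<lambda>z. F z - G z) has_field_derivative f') (at z)"
    unfolding has_field_derivative_def by blast
qed

section \<open>Real analyticity and holomorphy in two variables\<close>

lemma funpow_d1: "(d1 ^^ m) \<Psi> (a, b) = (deriv ^^ m) (\<lambda>x. \<Psi> (x, b)) a"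
proof (induction m arbitrary: a)
  case (Suc m)
  then show ?case by (simp add: d1_def)
qed simp

lemma hol2_funpow_d1: "open \<Omega> \<Longrightarrow> hol2 \<Omega> \<Psi> \<Longrightarrow> hol2 \<Omega> ((d1 ^^ m) \<Psi>)"
  by (induction m) (auto intro: hol2_d1)

text \<open>Cauchy's estimates in one variable after the other bound the Taylor coefficients by M /
  \<rho>^(m+n). The double series is thus dominated by a product of geometric series and is
  absolutely summable, as the unordered sum in the definition demands.\<close>

lemma real_analytic_hol2:
  assumes op: "open \<Omega>" and H: "hol2 \<Omega> \<Phi>" and z0: "(z0, cnj z0) \<in> \<Omega>"
  shows "real_analytic_at (\<lambda>z. \<Phi> (z, cnj z)) z0"
proof -
  \<comment> \<open>Complexified real coordinates: real (x, y) goes to (z, conj z) with z = z0 + x +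
    i y, so the power series of \<Psi> restricts to one in real and imaginary parts.\<close>
  define \<sigma> where "\<sigma> p = (z0 + fst p + \<i> * snd p, cnj z0 + fst p - \<i> * snd p)" for p :: "complex \<times> complex"
  define \<Omega>' where "\<Omega>' = \<sigma> -` \<Omega>"
  define \<Psi> where "\<Psi> p = \<Phi> (\<sigma> p)" for p
  have op': "open \<Omega>'"
    unfolding \<Omega>'_def \<sigma>_def by (intro open_vimage op continuous_intros)
  have H': "hol2 \<Omega>' \<Psi>"
    unfolding \<Psi>_def \<sigma>_def
    by (intro hol2_compose2[OF op H] hol2_add hol2_diff hol2_mult hol2_const hol2_fst hol2_snd)
      (auto simp: \<Omega>'_def \<sigma>_def)
  have "(0, 0) \<in> \<Omega>'" using z0 by (simp add: \<Omega>'_def \<sigma>_def)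
  then obtain \<rho> where \<rho>: "\<rho> > 0" "cball 0 \<rho> \<times> cball 0 \<rho> \<subseteq> \<Omega>'"
    using open_contains_cpolydisc[OF op'] by metis
  have "compact (\<Psi> ` (cball 0 \<rho> \<times> cball 0 \<rho>))"
    by (intro compact_continuous_image compact_Times continuous_on_subset[OF hol2_cont[OF H'] \<rho>(2)]) auto
  then obtain M where M: "\<And>u. u \<in> \<Psi> ` (cball 0 \<rho> \<times> cball 0 \<rho>) \<Longrightarrow> norm u \<le> M"
    using compact_imp_bounded bounded_iff by metis
  \<comment> \<open>The coefficient of X^m, as a holomorphic function of Y that is expanded in
    turn.\<close>
  define g where "g m Y = (d1 ^^ m) \<Psi> (0, Y) / fact m" for m Y
  have sub1: "cball 0 \<rho> \<times> {Y} \<subseteq> \<Omega>'" if "Y \<in> cball 0 \<rho>" for Y using \<rho> that by auto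
  have sub2: "{0} \<times> cball 0 \<rho> \<subseteq> \<Omega>'" using \<rho> by auto
  have holX: "(\<lambda>X. \<Psi> (X, Y)) holomorphic_on cball 0 \<rho>" if "Y \<in> cball 0 \<rho>" for Y
    by (rule hol2_slice1[OF H' sub1[OF that]])
  have holg: "g m holomorphic_on cball 0 \<rho>" for m
    unfolding g_def by (intro holomorphic_intros hol2_slice2[OF hol2_funpow_d1[OF op' H'] sub2]) auto
  have gb: "norm (g m Y) \<le> M / \<rho>^m" if Y: "Y \<in> cball 0 \<rho>" for m Y
  proof -
    have "norm ((deriv ^^ m) (\<lambda>x. \<Psi> (x, Y)) 0) \<le> fact m * M / \<rho>^m"
    proof (rule Cauchy_inequality)
      show "(\<lambda>x. \<Psi> (x, Y)) holomorphic_on ball 0 \<rho>"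
        using holX[OF Y] ball_subset_cball holomorphic_on_subset by blast
      show "continuous_on (cball 0 \<rho>) (\<lambda>x. \<Psi> (x, Y))"
        by (rule holomorphic_on_imp_continuous_on[OF holX[OF Y]])
      show "norm (\<Psi> (x, Y)) \<le> M" if "norm (0 - x) = \<rho>" for x
        using that Y by (intro M imageI) auto
    qed (use \<rho> in auto)
    then show ?thesis by (simp add: g_def funpow_d1 norm_divide divide_le_eq mult_ac)
  qed
  define a where "a m n = (deriv ^^ n) (g m) 0 / fact n" for m n
  have ab: "norm (a m n) \<le> M / \<rho>^m / \<rho>^n" for m n
  proof -
    have "norm ((deriv ^^ n) (g m) 0) \<le> fact n * (M / \<rho>^m) / \<rho>^n"
    proof (rule Cauchy_inequality)
      show "g m holomorphic_on ball 0 \<rho>"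
        using holg ball_subset_cball holomorphic_on_subset by blast
      show "continuous_on (cball 0 \<rho>) (g m)"
        by (rule holomorphic_on_imp_continuous_on[OF holg])
    qed (use gb \<rho> in auto)
    then show ?thesis by (simp add: a_def norm_divide divide_le_eq mult_ac)
  qed
  have main: "((\<lambda>(m,n). a m n * X ^ m * Y ^ n) has_sum \<Psi> (X, Y)) UNIV"
    if X: "norm X < \<rho>" and Y: "norm Y < \<rho>" for X Y
  proof -
    define p where "p = norm X / \<rho>"
    define q where "q = norm Y / \<rho>"
    have pq: "0 \<le> p" "p < 1" "0 \<le> q" "q < 1" using X Y \<rho> by (auto simp: p_def q_def)
    have tb: "norm (a m n * X ^ m * Y ^ n) \<le> M * p^m * q^n" for m n
    proof -
      have "norm (a m n * X ^ m * Y ^ n) \<le> M / \<rho>^m / \<rho>^n * norm X ^ m * norm Y ^ n"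
        unfolding norm_mult norm_power by (intro mult_right_mono ab) auto
      then show ?thesis by (simp add: p_def q_def power_divide field_simps)
    qed
    have M0: "M \<ge> 0" using M[of "\<Psi> (0, 0)"] \<rho> by (meson SigmaI centre_in_cball imageI less_imp_le norm_ge_zero order_trans)
    have sg: "(\<lambda>n. c * t ^ n) sums (c / (1 - t))" if "0 \<le> t" "t < 1" for c t :: real
      using sums_mult[OF geometric_sums[of t], of c] that by simp
    have gs: "((\<lambda>n. c * t ^ n) has_sum (c / (1 - t))) UNIV" if "0 \<le> t" "t < 1" "c \<ge> 0" for c t :: real
      by (rule norm_summable_imp_has_sum) (use sg[OF that(1,2), of c] that in \<open>auto simp: sums_iff\<close>)
    have "(\<lambda>(m, n). M * p^m * q^n) summable_on UNIV \<times> UNIV"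
    proof (rule summable_on_SigmaI)
      show "((\<lambda>n. (\<lambda>(m, n). M * p^m * q^n) (m, n)) has_sum (M * p^m / (1 - q))) UNIV" for m
        using gs[OF pq(3,4), of "M * p^m"] M0 pq by simp
      have "(\<lambda>m. M / (1 - q) * p ^ m) summable_on UNIV"
        using gs[OF pq(1,2), of "M / (1 - q)"] M0 pq by (auto simp: summable_on_def)
      then show "(\<lambda>m. M * p^m / (1 - q)) summable_on UNIV" by (simp add: mult_ac)
    qed (use M0 pq in auto)
    then have "(\<lambda>(m,n). M * p^m * q^n) summable_on UNIV" by simp
    then have "(\<lambda>x. norm ((\<lambda>(m,n). a m n * X ^ m * Y ^ n) x)) summable_on UNIV"
      by (rule Infinite_Sum.abs_summable_on_comparison_test') (use tb in auto)
    then have sm: "(\<lambda>(m,n). a m n * X ^ m * Y ^ n) summable_on UNIV \<times> UNIV"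
      by (simp add: summable_on_iff_abs_summable_on_complex)
    have in1: "((\<lambda>n. a m n * X ^ m * Y ^ n) has_sum (g m Y * X ^ m)) UNIV" for m
    proof (rule norm_summable_imp_has_sum)
      have "summable (\<lambda>n. M * p^m * q^n)" using sg[OF pq(3,4)] by (auto simp: sums_iff)
      then show "summable (\<lambda>n. norm (a m n * X ^ m * Y ^ n))"
        by (rule summable_comparison_test_ev[rotated]) (use tb in auto)
      have "(\<lambda>n. (deriv ^^ n) (g m) 0 / fact n * (Y - 0)^n) sums g m Y"
        by (rule holomorphic_power_series[where f = "g m" and z = 0 and r = \<rho>])
          (use holomorphic_on_subset[OF holg ball_subset_cball] Y in auto)
      from sums_mult[OF this, of "X^m"]
      show "(\<lambda>n. a m n * X ^ m * Y ^ n) sums (g m Y * X ^ m)"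
        by (simp add: a_def mult_ac)
    qed
    have in2: "((\<lambda>m. g m Y * X ^ m) has_sum \<Psi> (X, Y)) UNIV"
    proof (rule norm_summable_imp_has_sum)
      have Y': "Y \<in> cball 0 \<rho>" using Y by simp
      have "summable (\<lambda>m. M * p^m)" using sg[OF pq(1,2)] by (auto simp: sums_iff)
      moreover have "norm (g m Y * X ^ m) \<le> M * p^m" for m
      proof -
        have "norm (g m Y * X ^ m) \<le> M / \<rho>^m * norm X ^ m"
          unfolding norm_mult norm_power by (intro mult_right_mono gb[OF Y']) auto
        then show ?thesis by (simp add: p_def power_divide)
      qed
      ultimately show "summable (\<lambda>m. norm (g m Y * X ^ m))"
        by (intro summable_comparison_test_ev[of "\<lambda>m. norm (g m Y * X ^ m)" "\<lambda>m. M * p^m"]) auto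
      have "(\<lambda>n. (deriv ^^ n) (\<lambda>x. \<Psi> (x, Y)) 0 / fact n * (X - 0)^n) sums \<Psi> (X, Y)"
        by (rule holomorphic_power_series[where f = "\<lambda>x. \<Psi> (x, Y)" and z = 0 and r = \<rho>])
          (use holomorphic_on_subset[OF holX[OF Y'] ball_subset_cball] X in auto)
      then show "(\<lambda>m. g m Y * X ^ m) sums \<Psi> (X, Y)"
        by (simp add: g_def funpow_d1)
    qed
    have "((\<lambda>(m,n). a m n * X ^ m * Y ^ n) has_sum \<Psi> (X, Y)) (UNIV \<times> UNIV)"
      by (rule has_sum_SigmaI[OF _ in2 sm]) (use in1 in simp)
    then show ?thesis by simp
  qed
  show ?thesis
    unfolding real_analytic_at_def
  proof (intro exI conjI allI impI)
    show "\<rho> > 0" by fact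
    fix z assume z: "norm (z - z0) < \<rho>"
    define x where "x = Re z - Re z0"
    define y where "y = Im z - Im z0"
    have "\<bar>x\<bar> < \<rho>" "\<bar>y\<bar> < \<rho>"
      using z abs_Re_le_cmod[of "z - z0"] abs_Im_le_cmod[of "z - z0"] by (auto simp: x_def y_def)
    then have "((\<lambda>(m,n). a m n * of_real x ^ m * of_real y ^ n) has_sum \<Psi> (of_real x, of_real y)) UNIV"
      by (intro main) auto
    moreover have "\<sigma> (of_real x, of_real y) = (z, cnj z)"
      by (auto simp: \<sigma>_def x_def y_def complex_eq_iff)
    ultimately show "((\<lambda>(m,n). (\<lambda>(m,n). a m n) (m,n) * of_real (Re z - Re z0) ^ m * of_real (Im z - Im z0) ^ n)
          has_sum \<Phi> (z, cnj z)) UNIV"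
      by (simp add: \<Psi>_def x_def y_def)
  qed
qed

text \<open>Absolute convergence at the single real point (t, t) majorizes the series on the complex
  bidisc of radius t, where it defines a holomorphic function of two variables; a linear change of
  coordinates then replaces x and y by z and conj z.\<close>

lemma real_analytic_imp_hol2:
  assumes "real_analytic_at h z0"
  obtains \<Phi> \<eta> where "\<eta> > 0" "hol2 (ball z0 \<eta> \<times> ball (cnj z0) \<eta>) \<Phi>"
    "\<And>z. z \<in> ball z0 \<eta> \<Longrightarrow> h z = \<Phi> (z, cnj z)"
proof -
  obtain a e where e: "e > 0" and S: "\<And>z. norm (z - z0) < e \<Longrightarrow>
       ((\<lambda>(m,n). a (m,n) * of_real (Re z - Re z0) ^ m * of_real (Im z - Im z0) ^ n) has_sum h z) UNIV"
    using assms unfolding real_analytic_at_def by blast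
  \<comment> \<open>The point with both coordinates \<open>e/2\<close> has modulus sqrt 2 e/2 < e,
    so the given expansion converges there.\<close>
  define t where "t = e / 2"
  have t: "t > 0" using e by (simp add: t_def)
  define c where "c m n = norm (a (m, n)) * t ^ m * t ^ n" for m n
  have sm: "(\<lambda>(m, n). c m n) summable_on UNIV \<times> UNIV"
  proof -
    have "norm (complex_of_real t + \<i> * of_real t) < e"
    proof -
      have "norm (complex_of_real t + \<i> * of_real t) = sqrt 2 * t"
        using t by (simp add: cmod_def real_sqrt_mult)
      also have "\<dots> < 2 * t" using t sqrt2_less_2 by (intro mult_strict_right_mono) auto
      finally show ?thesis by (simp add: t_def)
    qed
    then have "(\<lambda>(m,n). a (m,n) * of_real t ^ m * of_real t ^ n) summable_on UNIV"
      using S[of "z0 + of_real t + \<i> * of_real t"] by (auto simp: summable_on_def add.assoc)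
    then have "(\<lambda>x. norm ((\<lambda>(m,n). a (m,n) * of_real t ^ m * of_real t ^ n) x)) summable_on UNIV"
      by (subst (asm) summable_on_iff_abs_summable_on_complex)
    then show ?thesis
      using t by (simp add: c_def case_prod_unfold norm_mult norm_power)
  qed
  have c0: "c m n \<ge> 0" for m n using t by (simp add: c_def)
  have abs: "(\<lambda>x. norm ((\<lambda>(m, n). c m n) x)) summable_on UNIV \<times> UNIV"
    using sm c0 by (simp add: case_prod_unfold)
  have sm1: "summable (\<lambda>n. c m n)" for m
  proof -
    have "(\<lambda>n. norm ((\<lambda>(m, n). c m n) (m, n))) summable_on UNIV"
      using conjunct1[OF iffD1[OF Infinite_Sum.abs_summable_on_Sigma_iff abs]] by blast
    then show ?thesis using c0 summable_on_imp_summable by simp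
  qed
  have sm2: "summable (\<lambda>m. \<Sum>n. c m n)"
  proof -
    have "(\<lambda>m. norm (infsum (\<lambda>n. norm ((\<lambda>(m, n). c m n) (m, n))) UNIV)) summable_on UNIV"
      using conjunct2[OF iffD1[OF Infinite_Sum.abs_summable_on_Sigma_iff abs]] by blast
    moreover have "infsum (\<lambda>n. norm ((\<lambda>(m, n). c m n) (m, n))) UNIV = (\<Sum>n. c m n)" for m
    proof (rule infsumI, rule norm_summable_imp_has_sum)
      show "summable (\<lambda>n. norm (norm ((\<lambda>(m, n). c m n) (m, n))))" using sm1 c0 by simp
      show "(\<lambda>n. norm ((\<lambda>(m, n). c m n) (m, n))) sums (\<Sum>n. c m n)"
        using sm1 c0 by (simp add: summable_sums)
    qed
    moreover have "norm (\<Sum>n. c m n) = (\<Sum>n. c m n)" for m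
      using suminf_nonneg[OF sm1 c0] by simp
    ultimately show ?thesis using summable_on_imp_summable by simp
  qed
  define \<Omega> where "\<Omega> = ball (0::complex) t \<times> ball (0::complex) t"
  have op: "open \<Omega>" by (simp add: \<Omega>_def open_Times)
  define f where "f m p = (\<Sum>n. a (m, n) * fst p ^ m * snd p ^ n)" for m p
  have tb: "norm (a (m, n) * fst p ^ m * snd p ^ n) \<le> c m n" if "p \<in> \<Omega>" for m n p
  proof -
    have "norm (fst p) \<le> t" "norm (snd p) \<le> t" using that by (auto simp: \<Omega>_def)
    then show ?thesis unfolding c_def norm_mult norm_power
      using t by (intro mult_mono power_mono) auto
  qed
  have hf: "hol2 \<Omega> (f m)" for m
    unfolding f_def
  proof (rule hol2_series[OF op])
    show "hol2 \<Omega> (\<lambda>p. a (m, n) * fst p ^ m * snd p ^ n)" for n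
      by (intro hol2_mult hol2_const hol2_power hol2_fst hol2_snd)
    show "locally_summable \<Omega> (\<lambda>n p. a (m, n) * fst p ^ m * snd p ^ n)"
      by (rule loc_summableI, rule exI[of _ \<Omega>], rule exI[of _ "c m"]) (use op sm1 tb in auto)
  qed
  have fb: "norm (f m p) \<le> (\<Sum>n. c m n)" if "p \<in> \<Omega>" for m p
    unfolding f_def by (rule norm_suminf_le[OF tb[OF that] sm1])
  define \<Psi> where "\<Psi> p = (\<Sum>m. f m p)" for p
  have h\<Psi>: "hol2 \<Omega> \<Psi>"
    unfolding \<Psi>_def
  proof (rule hol2_series[OF op hf])
    show "locally_summable \<Omega> f"
      by (rule loc_summableI, rule exI[of _ \<Omega>], rule exI[of _ "\<lambda>m. \<Sum>n. c m n"]) (use op sm2 fb in auto)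
  qed
  have val: "h z = \<Psi> (of_real (Re z - Re z0), of_real (Im z - Im z0))" if z: "z \<in> ball z0 t" for z
  proof -
    define x where "x = complex_of_real (Re z - Re z0)"
    define y where "y = complex_of_real (Im z - Im z0)"
    have nz: "norm (z - z0) < t" using z by (simp add: dist_norm norm_minus_commute)
    have xy: "(x, y) \<in> \<Omega>"
      using nz abs_Re_le_cmod[of "z - z0"] abs_Im_le_cmod[of "z - z0"]
      by (auto simp: \<Omega>_def x_def y_def simp del: of_real_diff)
    have "((\<lambda>(m,n). a (m,n) * x ^ m * y ^ n) has_sum h z) (UNIV \<times> UNIV)"
      using S[of z] nz t by (simp add: x_def y_def t_def)
    moreover have "((\<lambda>n. (\<lambda>(m,n). a (m,n) * x ^ m * y ^ n) (m, n)) has_sum f m (x, y)) UNIV" for m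
    proof -
      have s: "summable (\<lambda>n. norm (a (m,n) * x ^ m * y ^ n))"
        by (rule summable_comparison_test_ev[OF _ sm1[of m]]) (use tb[OF xy] in auto)
      have "((\<lambda>n. a (m,n) * x ^ m * y ^ n) has_sum (\<Sum>n. a (m,n) * x ^ m * y ^ n)) UNIV"
        by (rule norm_summable_imp_has_sum[OF s summable_sums[OF summable_norm_cancel[OF s]]])
      then show ?thesis by (simp add: f_def)
    qed
    ultimately have "((\<lambda>m. f m (x, y)) has_sum h z) UNIV"
      by (rule has_sum_SigmaD)
    then have "(\<lambda>m. f m (x, y)) sums h z" by (rule has_sum_imp_sums)
    then show ?thesis by (simp add: \<Psi>_def x_def y_def sums_iff)
  qed
  \<comment> \<open>Real and imaginary part relative to \<open>z0\<close>, expressed by z and conj z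
    as independent variables; the bidisc of radius t is mapped into one of the same radius.\<close>
  define X where "X p = (fst p - z0 + (snd p - cnj z0)) / 2" for p
  define Y where "Y p = (fst p - z0 - (snd p - cnj z0)) / (2 * \<i>)" for p
  show ?thesis
  proof (rule that[OF t, of "\<lambda>p. \<Psi> (X p, Y p)"])
    show "hol2 (ball z0 t \<times> ball (cnj z0) t) (\<lambda>p. \<Psi> (X p, Y p))"
    proof (rule hol2_compose2[OF op h\<Psi>])
      show "hol2 (ball z0 t \<times> ball (cnj z0) t) X" "hol2 (ball z0 t \<times> ball (cnj z0) t) Y"
        unfolding X_def Y_def by (intro hol2_divide hol2_add hol2_diff hol2_fst hol2_snd hol2_const; simp)+
      fix p assume p: "p \<in> ball z0 t \<times> ball (cnj z0) t"
      have "norm (fst p - z0) < t" "norm (snd p - cnj z0) < t"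
        using p by (auto simp: dist_norm norm_minus_commute)
      then show "(X p, Y p) \<in> \<Omega>"
        using norm_triangle_ineq[of "fst p - z0" "snd p - cnj z0"] norm_triangle_ineq4[of "fst p - z0" "snd p - cnj z0"]
        unfolding \<Omega>_def X_def Y_def by (simp add: norm_divide norm_mult)
    qed
    fix z assume z: "z \<in> ball z0 t"
    have "X (z, cnj z) = of_real (Re z - Re z0)" "Y (z, cnj z) = of_real (Im z - Im z0)"
      unfolding X_def Y_def fst_conv snd_conv complex_cnj_diff[symmetric] complex_diff_cnj complex_add_cnj
      by (simp_all add: algebra_simps diff_divide_distrib)
    then show "h z = \<Psi> (X (z, cnj z), Y (z, cnj z))" using val[OF z] by simp
  qed
qed

section \<open>The special functions of the separated solutions\<close>

text \<open>The derivative is multiplied by z so that it becomes the series with coefficients n a_n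
  in unshifted powers; the differential equations below can then be checked coefficient by
  coefficient.\<close>

lemma powser_has_derivative:
  fixes a :: "nat \<Rightarrow> complex"
  assumes s: "\<And>z. norm z < R \<Longrightarrow> summable (\<lambda>n. a n * z ^ n)" and z: "norm z < R"
  obtains D where "((\<lambda>z. \<Sum>n. a n * z ^ n) has_field_derivative D) (at z)"
    "(\<lambda>n. of_nat n * a n * z ^ n) sums (z * D)"
proof -
  define D where "D = (\<Sum>n. diffs a n * z ^ n)"
  have D: "((\<lambda>z. \<Sum>n. a n * z ^ n) has_field_derivative D) (at z)"
    unfolding D_def by (rule termdiffs_strong'[OF s z])
  have "(\<lambda>n. of_nat n * a n * z ^ (n - Suc 0)) sums D"
    unfolding D_def by (rule diffs_equiv[OF termdiff_converges[OF z s]])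
  from sums_mult[OF this, of z]
  have "(\<lambda>n. z * (of_nat n * a n * z ^ (n - Suc 0))) sums (z * D)" .
  also have "(\<lambda>n. z * (of_nat n * a n * z ^ (n - Suc 0))) = (\<lambda>n. of_nat n * a n * z ^ n)"
  proof
    fix n show "z * (of_nat n * a n * z ^ (n - Suc 0)) = of_nat n * a n * z ^ n"
      by (cases n) auto
  qed
  finally show ?thesis using that D by blast
qed

lemma powser_norm_summable:
  fixes a :: "nat \<Rightarrow> complex"
  assumes "\<And>z. norm z < R \<Longrightarrow> summable (\<lambda>n. a n * z ^ n)" and "norm z < R"
  shows "summable (\<lambda>n. norm (a n * z ^ n))"
proof -
  obtain t where t: "norm z < t" "t < R" using assms(2) dense by blast
  have "t > 0" using t(1) norm_ge_zero[of z] by linarith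
  then show ?thesis
    using powser_insidea[OF assms(1)[of "of_real t"], of z] t by simp
qed

lemma gbinomial_norm_summable:
  fixes a z :: complex
  assumes "norm z < 1"
  shows "summable (\<lambda>n. norm (a gchoose n) * norm z ^ n)"
  using powser_norm_summable[of 1 "\<lambda>n. a gchoose n" z, OF sums_summable[OF gen_binomial_complex] assms]
  by (simp add: norm_mult norm_power)

text \<open>For \<open>s > 0\<close>, \<open>s ^ (k + 1) * beta_ser r k s\<close> is the incomplete beta integral of
  \<open>u ^ k * (1 - u) powr (- r)\<close> from \<open>0\<close> to \<open>s\<close>.\<close>
definition beta_ser :: "complex \<Rightarrow> nat \<Rightarrow> complex \<Rightarrow> complex" where
  "beta_ser r k s = (\<Sum>j. ((- r) gchoose j) * (-1) ^ j / of_nat (j + k + 1) * s ^ j)"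

lemma beta_ser_term_bound:
  "norm (((- r) gchoose j) * (-1) ^ j / of_nat (j + k + 1) * s ^ j :: complex) \<le> norm ((- r) gchoose j) * norm s ^ j"
proof -
  have "norm (((- r) gchoose j) * (-1) ^ j / of_nat (j + k + 1) * s ^ j :: complex)
      = norm ((- r) gchoose j) * norm s ^ j / real (j + k + 1)"
    by (simp add: norm_mult norm_divide norm_power del: of_nat_add of_nat_Suc)
  also have "\<dots> \<le> norm ((- r) gchoose j) * norm s ^ j / 1"
    by (intro divide_left_mono) auto
  finally show ?thesis by simp
qed

lemma beta_ser_summable:
  assumes "norm s < 1"
  shows "summable (\<lambda>j. ((- r) gchoose j) * (-1) ^ j / of_nat (j + k + 1) * s ^ j :: complex)"
  by (rule summable_comparison_test[OF _ gbinomial_norm_summable[OF assms, of "- r"]])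
    (use beta_ser_term_bound in blast)

text \<open>Since 1 / (j+k+1) is at most 1, the bound does not depend on \<open>k\<close>; a sum
  over \<open>k\<close> then converges wherever the power series of its coefficients does.\<close>

lemma beta_ser_bound:
  assumes "norm s \<le> t" "t < 1"
  shows "norm (beta_ser r k s) \<le> (\<Sum>j. norm ((- r) gchoose j) * t ^ j)"
  unfolding beta_ser_def
proof (rule norm_suminf_le)
  have t: "0 \<le> t" using assms(1) norm_ge_zero order_trans by blast
  show "norm (((- r) gchoose j) * (-1) ^ j / of_nat (j + k + 1) * s ^ j) \<le> norm ((- r) gchoose j) * t ^ j" for j
    by (rule order_trans[OF beta_ser_term_bound]) (use assms in \<open>auto intro!: mult_left_mono power_mono\<close>)
  show "summable (\<lambda>j. norm ((- r) gchoose j) * t ^ j)"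
    using gbinomial_norm_summable[of "of_real t" "- r"] t assms by simp
qed

text \<open>The derivative of the incomplete beta integral is its integrand; the common factor s^k
  is cancelled so that the equation also holds at s = 0.\<close>

lemma beta_ser_ode:
  assumes s: "norm s < 1"
  obtains D where "(beta_ser r k has_field_derivative D) (at s)"
    "of_nat (k + 1) * beta_ser r k s + s * D = (1 - s) powr (- r)"
proof -
  define a where "a j = ((- r) gchoose j) * (-1) ^ j / of_nat (j + k + 1)" for j
  have sm: "summable (\<lambda>n. a n * z ^ n)" if "norm z < 1" for z
    unfolding a_def by (rule beta_ser_summable[OF that])
  obtain D where D: "((\<lambda>z. \<Sum>n. a n * z ^ n) has_field_derivative D) (at s)"
    "(\<lambda>n. of_nat n * a n * s ^ n) sums (s * D)"
    using powser_has_derivative[OF sm s] by blast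
  have b: "beta_ser r k = (\<lambda>z. \<Sum>n. a n * z ^ n)" by (simp add: beta_ser_def a_def fun_eq_iff)
  have "(\<lambda>n. of_nat (k + 1) * (a n * s ^ n) + of_nat n * a n * s ^ n) sums (of_nat (k + 1) * beta_ser r k s + s * D)"
    unfolding b by (intro sums_add sums_mult summable_sums sm s D)
  also have "(\<lambda>n. of_nat (k + 1) * (a n * s ^ n) + of_nat n * a n * s ^ n) = (\<lambda>n. ((- r) gchoose n) * (- s) ^ n)"
  proof
    fix n
    have "of_nat (k + 1) * (a n * s ^ n) + of_nat n * a n * s ^ n = of_nat (n + k + 1) * a n * s ^ n"
      by (simp add: algebra_simps)
    also have "of_nat (n + k + 1) * a n = ((- r) gchoose n) * (-1) ^ n"
      unfolding a_def by (simp del: of_nat_add of_nat_Suc)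
    also have "((- r) gchoose n) * (-1) ^ n * s ^ n = ((- r) gchoose n) * (- s) ^ n"
      by (simp flip: power_mult_distrib)
    finally show "of_nat (k + 1) * (a n * s ^ n) + of_nat n * a n * s ^ n = ((- r) gchoose n) * (- s) ^ n" .
  qed
  finally have "of_nat (k + 1) * beta_ser r k s + s * D = (1 - s) powr (- r)"
    using sums_unique2 gen_binomial_complex[of "- s" "- r"] s by (metis norm_minus_cancel uminus_add_conv_diff add.commute)
  then show ?thesis using that D(1) b by simp
qed

text \<open>For \<open>Re r < 1\<close>, \<open>(1 - x) powr (1 - r) * tau_ser r a x\<close> is the integral of
  \<open>u powr a * (1 - u) powr (- r)\<close> from \<open>x\<close> to \<open>1\<close>; the termwise integrated series continues it in \<open>r\<close>.\<close>
definition tau_ser :: "complex \<Rightarrow> complex \<Rightarrow> complex \<Rightarrow> complex" where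
  "tau_ser r a x = (\<Sum>j. (a gchoose j) / (of_nat j + 1 - r) * (x - 1) ^ j)"

text \<open>The shifted numbers tend to infinity, so their inverses form a null sequence; a
  vanishing denominator would contribute 0 by the convention for division.\<close>

lemma inverse_shift_bounded:
  fixes r :: complex
  obtains C where "C > 0" "\<And>j. 1 / norm (of_nat j + 1 - r) \<le> C"
proof -
  have "filterlim (\<lambda>j. of_nat j + (1 - r)) at_infinity sequentially"
    by (rule tendsto_add_filterlim_at_infinity'[OF tendsto_of_nat tendsto_const])
  then have "(\<lambda>j. inverse (of_nat j + (1 - r))) \<longlonglongrightarrow> 0"
    by (rule filterlim_compose[OF tendsto_inverse_0])
  then have "Bseq (\<lambda>j. inverse (of_nat j + (1 - r)))" by (rule convergentI[THEN convergent_imp_Bseq])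
  then obtain C where "C > 0" "\<And>j. norm (inverse (of_nat j + (1 - r))) \<le> C" by (auto elim: BseqE)
  then show ?thesis using that[of C] by (simp add: norm_inverse inverse_eq_divide add_diff_eq norm_divide)
qed

lemma tau_ser_term_bound:
  fixes r a y :: complex
  assumes "\<And>j. 1 / norm (of_nat j + 1 - r) \<le> C"
  shows "norm ((a gchoose j) / (of_nat j + 1 - r) * y ^ j) \<le> C * (norm (a gchoose j) * norm y ^ j)"
proof -
  have "norm ((a gchoose j) / (of_nat j + 1 - r) * y ^ j)
     = (1 / norm (of_nat j + 1 - r)) * (norm (a gchoose j) * norm y ^ j)"
    by (simp add: norm_mult norm_divide norm_power)
  also have "\<dots> \<le> C * (norm (a gchoose j) * norm y ^ j)"
    by (intro mult_right_mono assms) auto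
  finally show ?thesis .
qed

lemma tau_ser_summable:
  fixes y :: complex
  assumes "norm y < 1"
  shows "summable (\<lambda>j. (a gchoose j) / (of_nat j + 1 - r) * y ^ j)"
proof -
  obtain C where C: "\<And>j. 1 / norm (of_nat j + 1 - r) \<le> C" using inverse_shift_bounded by blast
  show ?thesis
    by (rule summable_comparison_test[OF _ summable_mult[OF gbinomial_norm_summable[OF assms, of a], of C]])
      (use tau_ser_term_bound[OF C] in blast)
qed

text \<open>The derivative of (1-x)^(1-r) \<open>tau_ser r a x\<close> is minus the integrand;
  dividing by -(1-x)^(-r) removes the singular power, so the equation stays valid at x = 1, which
  corresponds to the boundary circle.\<close>

lemma tau_ser_ode:
  assumes r: "\<And>j. of_nat j + 1 - r \<noteq> 0" and x: "norm (x - 1) < 1"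
  obtains D where "(tau_ser r a has_field_derivative D) (at x)"
    "(x - 1) * D + (1 - r) * tau_ser r a x = x powr a"
proof -
  define c where "c j = (a gchoose j) / (of_nat j + 1 - r)" for j
  have sm: "summable (\<lambda>n. c n * z ^ n)" if "norm z < 1" for z
    unfolding c_def by (rule tau_ser_summable[OF that])
  obtain D where D: "((\<lambda>z. \<Sum>n. c n * z ^ n) has_field_derivative D) (at (x - 1))"
    "(\<lambda>n. of_nat n * c n * (x - 1) ^ n) sums ((x - 1) * D)"
    using powser_has_derivative[OF sm x] by blast
  have t: "tau_ser r a = (\<lambda>x. (\<lambda>z. \<Sum>n. c n * z ^ n) (x - 1))" by (simp add: tau_ser_def c_def fun_eq_iff)
  have "(\<lambda>n. of_nat n * c n * (x - 1) ^ n + (1 - r) * (c n * (x - 1) ^ n)) sums ((x - 1) * D + (1 - r) * tau_ser r a x)"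
    unfolding t by (intro sums_add sums_mult summable_sums sm x D)
  also have "(\<lambda>n. of_nat n * c n * (x - 1) ^ n + (1 - r) * (c n * (x - 1) ^ n)) = (\<lambda>n. (a gchoose n) * (x - 1) ^ n)"
  proof
    fix n
    have "of_nat n * c n * (x - 1) ^ n + (1 - r) * (c n * (x - 1) ^ n) = (of_nat n + 1 - r) * c n * (x - 1) ^ n"
      by (simp add: algebra_simps)
    also have "(of_nat n + 1 - r) * c n = (a gchoose n)" unfolding c_def using r[of n] by simp
    finally show "of_nat n * c n * (x - 1) ^ n + (1 - r) * (c n * (x - 1) ^ n) = (a gchoose n) * (x - 1) ^ n" .
  qed
  finally have "(x - 1) * D + (1 - r) * tau_ser r a x = x powr a"
    using sums_unique2 gen_binomial_complex[OF x, of a] by fastforce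
  moreover have "(tau_ser r a has_field_derivative D) (at x)"
    unfolding t using DERIV_shift[of "\<lambda>z. \<Sum>n. c n * z ^ n" D x "- 1"] D(1) by simp
  ultimately show ?thesis using that by blast
qed

text \<open>For a natural exponent the binomial coefficients are nonnegative, so the majorant sums
  to a multiple of (1+q)^k. This rate governs the size of the neighbourhood of the circle on which
  the series over \<open>k\<close> converges.\<close>

lemma tau_ser_bound_nat:
  assumes C: "\<And>j. 1 / norm (of_nat j + 1 - r) \<le> C" and x: "norm (x - 1) \<le> q" "q < 1"
  shows "norm (tau_ser r (of_nat k) x) \<le> C * (1 + q) ^ k"
proof -
  have q: "0 \<le> q" using x(1) norm_ge_zero order_trans by blast
  have C0: "C \<ge> 0" using C[of 0] by (meson norm_ge_zero order_trans zero_le_divide_1_iff)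
  have "(\<lambda>j. (real k gchoose j) * q ^ j) sums (1 + q) powr real k"
    by (rule gen_binomial_real) (use q x in auto)
  also have "(1 + q) powr real k = (1 + q) ^ k" using q by (simp add: powr_realpow)
  finally have *: "(\<lambda>j. C * ((real k gchoose j) * q ^ j)) sums (C * (1 + q) ^ k)" by (rule sums_mult)
  have "norm (tau_ser r (of_nat k) x) \<le> (\<Sum>j. C * ((real k gchoose j) * q ^ j))"
    unfolding tau_ser_def
  proof (rule norm_suminf_le)
    fix j
    have "norm ((of_nat k gchoose j) / (of_nat j + 1 - r) * (x - 1) ^ j)
        \<le> C * (norm (of_nat k gchoose j :: complex) * norm (x - 1) ^ j)"
      by (rule tau_ser_term_bound[OF C])
    also have "norm (of_nat k gchoose j :: complex) = (real k gchoose j)"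
      by (simp flip: binomial_gbinomial)
    also have "C * ((real k gchoose j) * norm (x - 1) ^ j) \<le> C * ((real k gchoose j) * q ^ j)"
      using x C0 by (intro mult_left_mono power_mono) (auto simp flip: binomial_gbinomial)
    finally show "norm ((of_nat k gchoose j) / (of_nat j + 1 - r) * (x - 1) ^ j) \<le> C * ((real k gchoose j) * q ^ j)" .
  qed (use * in \<open>auto simp: sums_iff\<close>)
  then show ?thesis using * by (simp add: sums_iff)
qed

lemma gbinomial_neg_Suc:
  "((- of_nat (Suc m)) gchoose j :: 'a :: field_char_0) = (-1) ^ j * of_nat ((m + j) choose j)"
proof -
  have "((- of_nat (Suc m)) gchoose j :: 'a) = (-1) ^ j * ((of_nat (Suc m) + of_nat j - 1) gchoose j)"
    by (rule gbinomial_minus)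
  also have "of_nat (Suc m) + of_nat j - 1 = (of_nat (m + j) :: 'a)" by simp
  finally show ?thesis by (simp only: binomial_gbinomial)
qed

text \<open>The binomial coefficients now alternate in sign; their moduli are those in the expansion
  of (1-q)^(-m-1).\<close>

lemma tau_ser_bound_neg:
  assumes C: "\<And>j. 1 / norm (of_nat j + 1 - r) \<le> C" and x: "norm (x - 1) \<le> q" "q < 1"
  shows "norm (tau_ser r (- of_nat (Suc m)) x) \<le> C / (1 - q) ^ Suc m"
proof -
  have q: "0 \<le> q" using x(1) norm_ge_zero order_trans by blast
  have C0: "C \<ge> 0" using C[of 0] by (meson norm_ge_zero order_trans zero_le_divide_1_iff)
  have "(\<lambda>j. ((- real (Suc m)) gchoose j) * (- q) ^ j) sums (1 + - q) powr (- real (Suc m))"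
    by (rule gen_binomial_real) (use q x in auto)
  also have "(1 + - q) powr (- real (Suc m)) = 1 / (1 - q) ^ Suc m"
    using x q by (simp add: powr_minus powr_realpow divide_inverse del: of_nat_Suc power_Suc)
  also have "(\<lambda>j. ((- real (Suc m)) gchoose j) * (- q) ^ j) = (\<lambda>j. real ((m + j) choose j) * q ^ j)"
  proof
    fix j
    have "(-1) ^ j * (- q) ^ j = q ^ j" by (simp flip: power_mult_distrib)
    then show "((- real (Suc m)) gchoose j) * (- q) ^ j = real ((m + j) choose j) * q ^ j"
      unfolding gbinomial_neg_Suc by (metis mult.assoc mult.commute)
  qed
  finally have *: "(\<lambda>j. C * (real ((m + j) choose j) * q ^ j)) sums (C * (1 / (1 - q) ^ Suc m))" by (rule sums_mult)
  have "norm (tau_ser r (- of_nat (Suc m)) x) \<le> (\<Sum>j. C * (real ((m + j) choose j) * q ^ j))"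
    unfolding tau_ser_def
  proof (rule norm_suminf_le)
    fix j
    have "norm ((- of_nat (Suc m) gchoose j) / (of_nat j + 1 - r) * (x - 1) ^ j)
        \<le> C * (norm (- of_nat (Suc m) gchoose j :: complex) * norm (x - 1) ^ j)"
      by (rule tau_ser_term_bound[OF C])
    also have "norm (- of_nat (Suc m) gchoose j :: complex) = real ((m + j) choose j)"
      unfolding gbinomial_neg_Suc by (simp add: norm_mult norm_power)
    also have "C * (real ((m + j) choose j) * norm (x - 1) ^ j) \<le> C * (real ((m + j) choose j) * q ^ j)"
      using x C0 by (intro mult_left_mono power_mono) auto
    finally show "norm ((- of_nat (Suc m) gchoose j) / (of_nat j + 1 - r) * (x - 1) ^ j)
       \<le> C * (real ((m + j) choose j) * q ^ j)" .
  qed (use * in \<open>auto simp: sums_iff\<close>)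
  then show ?thesis using * by (simp add: sums_iff)
qed

text \<open>Being a polynomial, the series can be evaluated at x = 0, on the edge of its disc of
  definition, where the connection constant is read off.\<close>

lemma tau_ser_nat_finite: "tau_ser r (of_nat k) x = (\<Sum>j\<le>k. of_nat (k choose j) / (of_nat j + 1 - r) * (x - 1) ^ j)"
  unfolding tau_ser_def by (subst suminf_finite[of "{..k}"]) (auto simp: binomial_eq_0 simp flip: binomial_gbinomial)

text \<open>Partial fractions of k! / (x (x+1) ... (x+k)). Pascal's rule turns the sum for k+1 into
  the difference of the sums for k at x and at x+1.\<close>

lemma sum_binomial_alternating_inverse:
  fixes x :: complex
  assumes "\<And>j. of_nat j + x \<noteq> 0"
  shows "(\<Sum>j\<le>k. of_nat (k choose j) * (-1) ^ j / (of_nat j + x)) = fact k / pochhammer x (Suc k)"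
  using assms
proof (induction k arbitrary: x)
  case 0
  then show ?case by simp
next
  case (Suc k)
  have x0: "x \<noteq> 0" using Suc.prems[of 0] by simp
  have nz: "of_nat j + (x + 1) \<noteq> 0" for j using Suc.prems[of "Suc j"] by (simp add: algebra_simps)
  have pn: "pochhammer y n \<noteq> 0" if "\<And>j. of_nat j + y \<noteq> 0" for y :: complex and n
    using that by (auto simp: pochhammer_eq_0_iff eq_neg_iff_add_eq_0 add.commute)
  have "(\<Sum>j\<le>Suc k. of_nat (Suc k choose j) * (-1) ^ j / (of_nat j + x))
      = 1 / x + (\<Sum>j\<le>k. of_nat (Suc k choose Suc j) * (-1) ^ Suc j / (of_nat (Suc j) + x))"
    by (subst sum.atMost_Suc_shift) simp
  also have "(\<Sum>j\<le>k. of_nat (Suc k choose Suc j) * (-1) ^ Suc j / (of_nat (Suc j) + x))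
     = (\<Sum>j\<le>k. of_nat (k choose Suc j) * (-1) ^ Suc j / (of_nat (Suc j) + x))
       - (\<Sum>j\<le>k. of_nat (k choose j) * (-1) ^ j / (of_nat j + (x + 1)))"
    unfolding sum_subtractf[symmetric]
  proof (intro sum.cong refl)
    fix j
    have e: "of_nat j + (x + 1) = of_nat (Suc j) + x" by simp
    show "of_nat (Suc k choose Suc j) * (-1) ^ Suc j / (of_nat (Suc j) + x)
      = of_nat (k choose Suc j) * (-1) ^ Suc j / (of_nat (Suc j) + x) - of_nat (k choose j) * (-1) ^ j / (of_nat j + (x + 1))"
      unfolding binomial_Suc_Suc of_nat_add e
      by (simp add: add_divide_distrib diff_divide_distrib distrib_right del: of_nat_Suc)
  qed
  also have "(\<Sum>j\<le>k. of_nat (k choose Suc j) * (-1) ^ Suc j / (of_nat (Suc j) + x))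
      = (\<Sum>j\<le>Suc k. of_nat (k choose j) * (-1) ^ j / (of_nat j + x)) - 1 / x"
    by (subst sum.atMost_Suc_shift) simp
  also have "(\<Sum>j\<le>Suc k. of_nat (k choose j) * (-1) ^ j / (of_nat j + x)) = fact k / pochhammer x (Suc k)"
    using Suc.IH[OF Suc.prems] by simp
  also have "(\<Sum>j\<le>k. of_nat (k choose j) * (-1) ^ j / (of_nat j + (x + 1))) = fact k / pochhammer (x + 1) (Suc k)"
    by (rule Suc.IH[OF nz])
  finally have "(\<Sum>j\<le>Suc k. of_nat (Suc k choose j) * (-1) ^ j / (of_nat j + x))
      = fact k / pochhammer x (Suc k) - fact k / pochhammer (x + 1) (Suc k)" by simp
  also have "\<dots> = fact (Suc k) / pochhammer x (Suc (Suc k))"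
  proof -
    define P where "P = pochhammer (x + 1) k"
    define y where "y = x + of_nat k + 1"
    have P: "P \<noteq> 0" "y \<noteq> 0" using pn[of "x + 1" k] nz Suc.prems[of "Suc k"] by (auto simp: P_def y_def algebra_simps)
    have p1: "pochhammer (x + 1) (Suc k) = P * y"
      by (simp add: P_def y_def pochhammer_Suc algebra_simps)
    have p2: "pochhammer x (Suc k) = x * P" unfolding P_def by (rule pochhammer_rec)
    have p3: "pochhammer x (Suc (Suc k)) = x * (P * y)" unfolding p1[symmetric] by (rule pochhammer_rec)
    note p1 p2 p3
    moreover have "fact (Suc k) = (y - x) * (fact k :: complex)" by (simp add: y_def algebra_simps)
    ultimately show ?thesis using P x0 by (simp add: field_simps)
  qed
  finally show ?case .
qed

text \<open>The beta value B(k+1, 1-r), in a form that continues it in r.\<close>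

definition connection_coeff :: "complex \<Rightarrow> nat \<Rightarrow> complex" where
  "connection_coeff r k = fact k / pochhammer (1 - r) (Suc k)"

text \<open>For Re r < 1 this splits the beta integral at s. In general the two differential
  equations show that the left-hand side has derivative 0 on the lens where both series converge,
  and its value is found by letting s tend to 0.\<close>

lemma beta_ser_tau_ser_connection:
  assumes r: "\<And>j. of_nat j + 1 - r \<noteq> 0" and s: "norm s < 1" "norm (s - 1) < 1"
  shows "s ^ Suc k * beta_ser r k s + (1 - s) powr (1 - r) * tau_ser r (of_nat k) s = connection_coeff r k"
proof -
  define S where "S = ball (0::complex) 1 \<inter> ball 1 1"
  define h where "h s = s ^ Suc k * beta_ser r k s + (1 - s) powr (1 - r) * tau_ser r (of_nat k) s" for s
  have der: "(h has_field_derivative 0) (at s)" if "s \<in> S" for s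
  proof -
    have s: "norm s < 1" "norm (s - 1) < 1" using that by (auto simp: S_def dist_norm norm_minus_commute)
    have s1: "1 - s \<notin> \<real>\<^sub>\<le>\<^sub>0"
      using s(1) complex_Re_le_cmod[of s] by (auto simp: complex_nonpos_Reals_iff)
    have s0: "1 - s \<noteq> 0" "s \<noteq> 0" using s by auto
    obtain D where D: "(beta_ser r k has_field_derivative D) (at s)"
      "of_nat (k + 1) * beta_ser r k s + s * D = (1 - s) powr (- r)" using beta_ser_ode[OF s(1)] by blast
    obtain E where E: "(tau_ser r (of_nat k) has_field_derivative E) (at s)"
      "(s - 1) * E + (1 - r) * tau_ser r (of_nat k) s = s powr of_nat k" using tau_ser_ode[OF r s(2)] by blast
    have "(h has_field_derivative (of_nat (Suc k) * s ^ k * beta_ser r k s + s ^ Suc k * D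
        + (- (1 - r) * (1 - s) powr (- r) * tau_ser r (of_nat k) s + (1 - s) powr (1 - r) * E))) (at s)"
    proof -
      have p1: "((\<lambda>s. s ^ Suc k) has_field_derivative of_nat (Suc k) * s ^ k) (at s)"
        using DERIV_power[OF DERIV_ident, of "Suc k" s UNIV] by simp
      have p2: "((\<lambda>s. (1 - s) powr (1 - r)) has_field_derivative - (1 - r) * (1 - s) powr (- r)) (at s)"
        using s1 by (auto intro!: derivative_eq_intros simp: algebra_simps)
      show ?thesis
        unfolding h_def using DERIV_add[OF DERIV_mult[OF p1 D(1)] DERIV_mult[OF p2 E(1)]]
        by (simp add: algebra_simps)
    qed
    also have "of_nat (Suc k) * s ^ k * beta_ser r k s + s ^ Suc k * D
        + (- (1 - r) * (1 - s) powr (- r) * tau_ser r (of_nat k) s + (1 - s) powr (1 - r) * E)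
       = s ^ k * (of_nat (k + 1) * beta_ser r k s + s * D)
          - (1 - s) powr (- r) * ((s - 1) * E + (1 - r) * tau_ser r (of_nat k) s)"
    proof -
      have "(1 - s) powr (1 - r) = (1 - s) * (1 - s) powr (- r)" using s0 by (simp add: powr_diff powr_minus field_simps)
      then have e: "(1 - s) powr (1 - r) * E = (1 - s) powr (- r) * ((1 - s) * E)" by simp
      show ?thesis unfolding e by (simp add: algebra_simps)
    qed
    also have "\<dots> = 0" unfolding D(2) E(2) using s0 by (simp add: powr_nat')
    finally show ?thesis .
  qed
  have "convex S" by (simp add: S_def convex_Int)
  have c: "\<exists>c. \<forall>s\<in>S. h s = c"
    by (rule has_field_derivative_zero_constant[OF \<open>convex S\<close>])
      (use der has_field_derivative_at_within in blast)
  then obtain c where c: "\<And>s. s \<in> S \<Longrightarrow> h s = c" by blast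
  \<comment> \<open>The point 0 lies on the edge of the lens; these points of the lens tend to it,
    so continuity of \<open>h\<close> at 0 identifies the constant.\<close>
  define u where "u n = complex_of_real (1 / (real n + 2))" for n :: nat
  have u: "u n \<in> S" for n
  proof -
    have n1: "norm (u n) = 1 / (real n + 2)" unfolding u_def norm_of_real by simp
    have "1 - u n = complex_of_real (1 - 1 / (real n + 2))" by (simp add: u_def)
    then have "norm (1 - u n) = \<bar>1 - 1 / (real n + 2)\<bar>" by (simp only: norm_of_real)
    then have n2: "norm (1 - u n) = 1 - 1 / (real n + 2)" by simp
    show ?thesis unfolding S_def using n1 n2 by (simp add: dist_norm)
  qed
  have lu: "u \<longlonglongrightarrow> 0"
    unfolding u_def by (rule tendsto_of_real[where a = 0, simplified of_real_0]) real_asymp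
  have cont: "isCont h 0"
  proof -
    obtain D where "(beta_ser r k has_field_derivative D) (at 0)" using beta_ser_ode[of 0 r k] by auto
    then have c1: "isCont (beta_ser r k) 0" by (rule DERIV_isCont)
    have c2: "isCont (\<lambda>s. (1 - s) powr (1 - r)) 0"
      by (intro continuous_intros) (auto simp: complex_nonpos_Reals_iff)
    have c3: "isCont (\<lambda>s::complex. s ^ Suc k) 0" by (intro continuous_intros)
    have c4: "isCont (\<lambda>s. \<Sum>j\<le>k. of_nat (k choose j) / (of_nat j + 1 - r) * (s - 1) ^ j) 0"
      by (intro continuous_intros)
    show ?thesis
      unfolding h_def[abs_def] tau_ser_nat_finite by (rule isCont_add[OF isCont_mult[OF c3 c1] isCont_mult[OF c2 c4]])
  qed
  have "(\<lambda>n. h (u n)) \<longlonglongrightarrow> h 0" using isCont_tendsto_compose[OF cont lu] .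
  then have "h 0 = c" using c[OF u] by (simp add: LIMSEQ_const_iff)
  moreover have "h 0 = connection_coeff r k"
    using sum_binomial_alternating_inverse[of "1 - r" k] r
    by (simp add: h_def tau_ser_nat_finite connection_coeff_def add_diff_eq)
  moreover have "s \<in> S" using s by (simp add: S_def dist_norm norm_minus_commute)
  ultimately show ?thesis using c[of s] by (simp add: h_def)
qed

lemma connection_coeff_nonzero:
  assumes "\<And>j. of_nat j + 1 - r \<noteq> 0"
  shows "connection_coeff r k \<noteq> 0"
proof -
  have "of_nat j + (1 - r) \<noteq> 0" for j using assms[of j] by (simp add: add_diff_eq)
  then have "pochhammer (1 - r) (Suc k) \<noteq> 0"
    unfolding pochhammer_eq_0_iff by (metis add.commute add.right_inverse)
  then show ?thesis by (simp add: connection_coeff_def)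
qed

text \<open>The ratio of consecutive values of 1/|C_k| is |k+2-r| / (k+1), which tends to 1. Hence
  division by C_k preserves radii of convergence.\<close>

lemma connection_coeff_summable:
  assumes r: "\<And>j. of_nat j + 1 - r \<noteq> 0" and t: "0 < t" "t < (1::real)"
  shows "summable (\<lambda>k. t ^ k / norm (connection_coeff r k))"
proof -
  obtain c where c: "t < c" "c < 1" using t dense by blast
  have rat: "1 / norm (connection_coeff r (Suc k)) = 1 / norm (connection_coeff r k) * (norm (of_nat (Suc k) + 1 - r) / real (Suc k))" for k
  proof -
    have "pochhammer (1 - r) (Suc (Suc k)) = pochhammer (1 - r) (Suc k) * (of_nat (Suc k) + 1 - r)"
      by (simp add: pochhammer_Suc algebra_simps)
    then show ?thesis
      unfolding connection_coeff_def by (simp add: norm_divide norm_mult del: of_nat_Suc add: fact_Suc)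
  qed
  have "(\<lambda>k. t * ((real (Suc k) + (1 + norm r)) / real (Suc k))) \<longlonglongrightarrow> t"
    by real_asymp
  then have "\<forall>\<^sub>F k in sequentially. t * ((real (Suc k) + (1 + norm r)) / real (Suc k)) < c"
    by (rule order_tendstoD) (rule c)
  then obtain N where N: "\<And>k. k \<ge> N \<Longrightarrow> t * ((real (Suc k) + (1 + norm r)) / real (Suc k)) < c"
    by (auto simp: eventually_sequentially)
  show ?thesis
  proof (rule summable_ratio_test[OF c(2)])
    fix k assume k: "N \<le> k"
    have "norm (of_nat (Suc k) + 1 - r) \<le> real (Suc k) + (1 + norm r)"
      using norm_triangle_ineq4[of "of_nat (Suc k) + 1" r] norm_triangle_ineq[of "of_nat (Suc k)" "1 :: complex"]
      by (simp del: of_nat_Suc)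
    then have "norm (of_nat (Suc k) + 1 - r) / real (Suc k) \<le> (real (Suc k) + (1 + norm r)) / real (Suc k)"
      by (rule divide_right_mono) simp
    then have "t * (norm (of_nat (Suc k) + 1 - r) / real (Suc k)) \<le> c"
      using N[OF k] t by (meson less_imp_le mult_left_mono order_trans)
    then have "(t ^ k / norm (connection_coeff r k)) * (t * (norm (of_nat (Suc k) + 1 - r) / real (Suc k))) \<le> (t ^ k / norm (connection_coeff r k)) * c"
      using t by (intro mult_left_mono) auto
    moreover have "t ^ Suc k / norm (connection_coeff r (Suc k)) = (t ^ k / norm (connection_coeff r k)) * (t * (norm (of_nat (Suc k) + 1 - r) / real (Suc k)))"
      using rat[of k] by (simp add: divide_inverse mult_ac del: of_nat_Suc)
    ultimately show "norm (t ^ Suc k / norm (connection_coeff r (Suc k))) \<le> c * norm (t ^ k / norm (connection_coeff r k))"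
      using t by (simp add: mult.commute)
  qed
qed

section \<open>Series of separated solutions\<close>

lemma holomorphic_beta_ser: "beta_ser r k holomorphic_on ball 0 1"
  unfolding holomorphic_on_open[OF open_ball] using beta_ser_ode by (metis mem_ball_0)

lemma holomorphic_tau_ser:
  assumes "\<And>j. of_nat j + 1 - r \<noteq> 0" shows "tau_ser r a holomorphic_on ball 1 1"
  unfolding holomorphic_on_open[OF open_ball]
  using tau_ser_ode[OF assms] by (metis dist_commute dist_norm mem_ball)

definition conv_on :: "real \<Rightarrow> (nat \<Rightarrow> complex) \<Rightarrow> bool" where
  "conv_on R a \<longleftrightarrow> (\<forall>z. norm z < R \<longrightarrow> summable (\<lambda>k. a k * z ^ k))"

lemma conv_onD: "conv_on R a \<Longrightarrow> norm z < R \<Longrightarrow> summable (\<lambda>k. a k * z ^ k)"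
  by (simp add: conv_on_def)

text \<open>The series of e_k P_k; here P_k(w, v) = v^(k+1) \<open>beta_ser r k (w * v)\<close>, the
  form that is visibly regular at w = 0.\<close>

definition interior_series :: "complex \<Rightarrow> (nat \<Rightarrow> complex) \<Rightarrow> complex \<times> complex \<Rightarrow> complex" where
  "interior_series r e p = (\<Sum>k. e k * (snd p ^ Suc k * beta_ser r k (fst p * snd p)))"

lemma prod_norm_lt_1: "norm (w::complex) < 1 \<Longrightarrow> norm (v::complex) < 1 \<Longrightarrow> norm (w * v) < 1"
  by (metis mult_strict_mono' mult_1 norm_ge_zero norm_mult)

text \<open>As \<open>beta_ser\<close> is bounded uniformly in \<open>k\<close>, the coefficients'
  power series dominates on every smaller bidisc.\<close>

lemma interior_series_locally_summable:
  assumes e0: "conv_on 1 e"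
  shows "locally_summable (ball 0 1 \<times> ball 0 1) (\<lambda>k p. e k * (snd p ^ Suc k * beta_ser r k (fst p * snd p)))"
proof (rule loc_summableI)
  note e = conv_onD[OF e0]
  fix p :: "complex \<times> complex" assume "p \<in> ball 0 1 \<times> ball 0 1"
  then have p: "norm (fst p) < 1" "norm (snd p) < 1" by auto
  then obtain R where R: "norm (fst p) < R" "norm (snd p) < R" "R < 1"
    using dense[of "max (norm (fst p)) (norm (snd p))" 1] by auto
  have R0: "R > 0" using R(1) norm_ge_zero[of "fst p"] by linarith
  have RR: "R * R < 1" using R R0 mult_strict_mono'[of R 1 R 1] by simp
  define B where "B = (\<Sum>j. norm ((- r) gchoose j) * (R * R) ^ j)"
  have B: "norm (beta_ser r k s) \<le> B" if "norm s \<le> R * R" for k s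
    unfolding B_def by (rule beta_ser_bound[OF that RR])
  have B0: "B \<ge> 0" using B[of 0 0] R0 by (auto intro: order_trans[OF norm_ge_zero])
  have "summable (\<lambda>k. norm (e k * complex_of_real R ^ k))"
    by (rule powser_norm_summable[of 1, OF e]) (use R R0 in auto)
  then have sm: "summable (\<lambda>k. norm (e k) * R ^ k * (R * B))"
    using R0 by (intro summable_mult2) (simp add: norm_mult norm_power)
  show "\<exists>N M. open N \<and> p \<in> N \<and> summable M \<and>
      (\<forall>k. \<forall>q\<in>N \<inter> (ball 0 1 \<times> ball 0 1). norm (e k * (snd q ^ Suc k * beta_ser r k (fst q * snd q))) \<le> M k)"
  proof (intro exI conjI allI ballI)
    show "open (ball (0::complex) R \<times> ball (0::complex) R)" by (simp add: open_Times)
    show "p \<in> ball 0 R \<times> ball 0 R" using R by (cases p) auto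
    show "summable (\<lambda>k. norm (e k) * R ^ k * (R * B))" by (rule sm)
    fix k and q :: "complex \<times> complex" assume "q \<in> ball 0 R \<times> ball 0 R \<inter> (ball 0 1 \<times> ball 0 1)"
    then have q: "norm (fst q) \<le> R" "norm (snd q) \<le> R" by auto
    then have "norm (beta_ser r k (fst q * snd q)) \<le> B"
      by (intro B) (auto simp: norm_mult intro: mult_mono R0[THEN less_imp_le])
    then have "norm (e k) * (norm (snd q) ^ Suc k * norm (beta_ser r k (fst q * snd q))) \<le> norm (e k) * (R ^ Suc k * B)"
      using q B0 R0 by (intro mult_left_mono mult_mono power_mono) auto
    then show "norm (e k * (snd q ^ Suc k * beta_ser r k (fst q * snd q))) \<le> norm (e k) * R ^ k * (R * B)"
      by (simp add: norm_mult norm_power mult_ac)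
  qed
qed

text \<open>For \<open>d2\<close> the product rule produces v^k times the left-hand side of
  \<open>beta_ser_ode\<close>, so the k-th term has derivative (1-wv)^(-r) e_k v^k.\<close>

lemma
  assumes e0: "conv_on 1 e"
  shows hol2_interior_series: "hol2 (ball 0 1 \<times> ball 0 1) (interior_series r e)"
    and interior_series_sums: "\<And>p. p \<in> ball 0 1 \<times> ball 0 1 \<Longrightarrow>
        (\<lambda>k. e k * (snd p ^ Suc k * beta_ser r k (fst p * snd p))) sums interior_series r e p"
    and interior_series_d2: "\<And>w v. norm w < 1 \<Longrightarrow> norm v < 1 \<Longrightarrow>
        d2 (interior_series r e) (w, v) = (1 - w * v) powr (- r) * (\<Sum>k. e k * v ^ k)"
proof -
  let ?\<Omega> = "ball (0::complex) 1 \<times> ball (0::complex) 1"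
  have op: "open ?\<Omega>" by (simp add: open_Times)
  note e = conv_onD[OF e0] and ls = interior_series_locally_summable[OF e0]
  have h: "hol2 ?\<Omega> (\<lambda>p. e k * (snd p ^ Suc k * beta_ser r k (fst p * snd p)))" for k
    by (intro hol2_mult hol2_const hol2_power hol2_snd hol2_comp1[OF holomorphic_beta_ser open_ball] hol2_fst)
      (auto simp: norm_mult[symmetric] intro: prod_norm_lt_1)
  show "hol2 ?\<Omega> (interior_series r e)"
    unfolding interior_series_def by (rule hol2_series[OF op h ls])
  show "(\<lambda>k. e k * (snd p ^ Suc k * beta_ser r k (fst p * snd p))) sums interior_series r e p" if "p \<in> ?\<Omega>" for p
    unfolding interior_series_def by (rule locally_summable_sums[OF ls that])
  show "d2 (interior_series r e) (w, v) = (1 - w * v) powr (- r) * (\<Sum>k. e k * v ^ k)" if wv: "norm w < 1" "norm v < 1" for w v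
  proof -
    have "(\<lambda>k. d2 (\<lambda>p. e k * (snd p ^ Suc k * beta_ser r k (fst p * snd p))) (w, v)) sums d2 (interior_series r e) (w, v)"
      unfolding interior_series_def[abs_def] by (rule hol2_series_d2[OF op h ls]) (use wv in auto)
    moreover have "d2 (\<lambda>p. e k * (snd p ^ Suc k * beta_ser r k (fst p * snd p))) (w, v)
        = (1 - w * v) powr (- r) * (e k * v ^ k)" for k
    proof -
      obtain D where D: "(beta_ser r k has_field_derivative D) (at (w * v))"
        "of_nat (k + 1) * beta_ser r k (w * v) + (w * v) * D = (1 - w * v) powr (- r)"
        using beta_ser_ode[OF prod_norm_lt_1[OF wv]] by blast
      have c: "((\<lambda>y. beta_ser r k (w * y)) has_field_derivative D * w) (at v)"
        by (rule DERIV_chain'[where g = "beta_ser r k" and f = "\<lambda>y. w * y"])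
          (use D(1) in \<open>auto intro!: derivative_eq_intros\<close>)
      have p: "((\<lambda>y. y ^ Suc k) has_field_derivative of_nat (Suc k) * v ^ k) (at v)"
        using DERIV_power[OF DERIV_ident, of "Suc k" v UNIV] by simp
      have "((\<lambda>y. e k * (y ^ Suc k * beta_ser r k (w * y))) has_field_derivative
          e k * (of_nat (Suc k) * v ^ k * beta_ser r k (w * v) + D * w * v ^ Suc k)) (at v)"
        by (rule DERIV_cmult[OF DERIV_mult[OF p c]])
      also have "e k * (of_nat (Suc k) * v ^ k * beta_ser r k (w * v) + D * w * v ^ Suc k)
          = (of_nat (k + 1) * beta_ser r k (w * v) + (w * v) * D) * (e k * v ^ k)"
        by (simp add: algebra_simps)
      finally show ?thesis unfolding D(2) by (intro d2_eqI) simp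
    qed
    ultimately have "(\<lambda>k. (1 - w * v) powr (- r) * (e k * v ^ k)) sums d2 (interior_series r e) (w, v)" by simp
    moreover have "(\<lambda>k. (1 - w * v) powr (- r) * (e k * v ^ k)) sums ((1 - w * v) powr (- r) * (\<Sum>k. e k * v ^ k))"
      by (intro sums_mult summable_sums e wv)
    ultimately show ?thesis by (rule sums_unique2)
  qed
qed

text \<open>A neighbourhood, in two variables, of the circle v = conj w, |w| = 1. The last condition
  keeps wv in a disc about 1 where \<open>tau_ser\<close> converges; the others keep w away from 0
  and infinity. It shrinks as c increases to 1.\<close>

definition circle_nbhd :: "real \<Rightarrow> (complex \<times> complex) set" where
  "circle_nbhd c = {(w, v). c < norm w \<and> norm w < 1 / c \<and> norm (w * v - 1) < 1 - c}"

lemma open_circle_nbhd: "open (circle_nbhd c)"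
proof -
  have "circle_nbhd c = {p. c < norm (fst p)} \<inter> {p. norm (fst p) < 1 / c} \<inter> {p. norm (fst p * snd p - 1) < 1 - c}"
    by (auto simp: circle_nbhd_def)
  then show ?thesis by (auto intro!: open_Int open_Collect_less continuous_intros)
qed

text \<open>In the two families of terms below, the sequences \<open>b\<close> and \<open>\<alpha>\<close> are the coefficients of the negative
  powers \<open>v ^ (- m - 1)\<close> and of the powers \<open>v ^ k\<close> of the antiholomorphic datum.\<close>
definition neg_term :: "complex \<Rightarrow> (nat \<Rightarrow> complex) \<Rightarrow> nat \<Rightarrow> complex \<times> complex \<Rightarrow> complex" where
  "neg_term r b m p = b m * (fst p ^ Suc m * tau_ser r (- of_nat (Suc m)) (fst p * snd p))"

definition nonneg_term :: "complex \<Rightarrow> (nat \<Rightarrow> complex) \<Rightarrow> nat \<Rightarrow> complex \<times> complex \<Rightarrow> complex" where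
  "nonneg_term r \<alpha> k p = \<alpha> k * (tau_ser r (of_nat k) (fst p * snd p) / fst p ^ k)"

definition boundary_series :: "complex \<Rightarrow> (nat \<Rightarrow> complex) \<Rightarrow> (nat \<Rightarrow> complex) \<Rightarrow> complex \<times> complex \<Rightarrow> complex" where
  "boundary_series r b \<alpha> p = (\<Sum>m. neg_term r b m p) - (\<Sum>k. nonneg_term r \<alpha> k p)"

context
  fixes r :: complex and b \<alpha> :: "nat \<Rightarrow> complex" and c R :: real
  assumes r: "\<And>j. of_nat j + 1 - r \<noteq> 0"
    and c: "0 < c" "c < 1" "1 / c^2 \<le> R"
    and b: "conv_on R b"
    and \<alpha>: "conv_on R \<alpha>"
begin

lemma coeff_norm_summable:
  assumes "conv_on R a" "0 \<le> x" "x < R"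
  shows "summable (\<lambda>k. norm (a k) * x ^ k)"
  using powser_norm_summable[of R a "of_real x", OF conv_onD[OF assms(1)]] assms(2,3) by (simp add: norm_mult norm_power)

lemma circle_nbhd_D: "(w, v) \<in> circle_nbhd c \<Longrightarrow> w \<noteq> 0 \<and> v \<noteq> 0 \<and> norm (w * v - 1) < 1"
  using c by (auto simp: circle_nbhd_def)

text \<open>If q < 1-c bounds |wv - 1|, the terms of negative index grow like (|w| / (1-q))^m and
  the others like ((1+q) / |w|)^k. Both ratios are below 1/c^2, which explains the condition 1/c^2
  <= R on the coefficients.\<close>

lemma terms_locally_summable: "locally_summable (circle_nbhd c) (neg_term r b)" "locally_summable (circle_nbhd c) (nonneg_term r \<alpha>)"
proof -
  obtain C where C: "C > 0" "\<And>j. 1 / norm (of_nat j + 1 - r) \<le> C" using inverse_shift_bounded by blast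
  have loc: "\<exists>q N. open N \<and> p \<in> N \<and> norm (fst p * snd p - 1) < q \<and> q < 1 - c \<and> 0 < q \<and>
      N \<subseteq> {u. c < norm (fst u) \<and> norm (fst u) < 1 / c \<and> norm (fst u * snd u - 1) \<le> q}" if pO: "p \<in> circle_nbhd c" for p
  proof -
    obtain q where q: "norm (fst p * snd p - 1) < q" "q < 1 - c"
      using pO dense[of "norm (fst p * snd p - 1)" "1 - c"] by (auto simp: circle_nbhd_def)
    have q0: "0 < q" using q(1) norm_ge_zero[of "fst p * snd p - 1"] by linarith
    have "open (circle_nbhd c \<inter> {u. norm (fst u * snd u - 1) < q})"
      by (intro open_Int open_circle_nbhd open_Collect_less continuous_intros)
    then show ?thesis
      using q pO q0
      by (intro exI[of _ q] exI[of _ "circle_nbhd c \<inter> {u. norm (fst u * snd u - 1) < q}"]) (auto simp: circle_nbhd_def)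
  qed
  show "locally_summable (circle_nbhd c) (neg_term r b)"
  proof (rule loc_summableI)
    fix p assume "p \<in> circle_nbhd c"
    from loc[OF this] obtain q N where N: "open N" "p \<in> N" "q < 1 - c" "0 < q"
      "\<And>u. u \<in> N \<Longrightarrow> c < norm (fst u) \<and> norm (fst u) < 1 / c \<and> norm (fst u * snd u - 1) \<le> q" by blast
    define x where "x = 1 / c / (1 - q)"
    have x: "0 \<le> x" "x < R"
    proof -
      have "x < 1 / c / c" unfolding x_def using N c by (intro divide_strict_left_mono) auto
      then show "x < R" using c by (simp add: power2_eq_square)
    qed (use N c in \<open>simp add: x_def\<close>)
    have sm: "summable (\<lambda>m. norm (b m) * x ^ m * (x * C))"
      by (intro summable_mult2 coeff_norm_summable b x)
    have "norm (neg_term r b m u) \<le> norm (b m) * x ^ m * (x * C)" if "u \<in> N" for m u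
    proof -
      have "norm (tau_ser r (- of_nat (Suc m)) (fst u * snd u)) \<le> C / (1 - q) ^ Suc m"
        by (rule tau_ser_bound_neg[OF C(2)]) (use N(5)[OF that] N(3) c in auto)
      moreover have "norm (fst u) ^ Suc m \<le> (1 / c) ^ Suc m"
        using N(5)[OF that] by (intro power_mono) auto
      ultimately have "norm (fst u) ^ Suc m * norm (tau_ser r (- of_nat (Suc m)) (fst u * snd u))
          \<le> (1 / c) ^ Suc m * (C / (1 - q) ^ Suc m)"
        using c by (intro mult_mono) auto
      also have "\<dots> = x ^ m * (x * C)" by (simp add: x_def power_divide power_mult_distrib)
      finally have "norm (b m) * (norm (fst u) ^ Suc m * norm (tau_ser r (- of_nat (Suc m)) (fst u * snd u))) \<le> norm (b m) * (x ^ m * (x * C))"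
        by (rule mult_left_mono) auto
      then show ?thesis unfolding neg_term_def norm_mult norm_power by (simp only: mult.assoc)
    qed
    then show "\<exists>N M. open N \<and> p \<in> N \<and> summable M \<and> (\<forall>k. \<forall>q\<in>N \<inter> circle_nbhd c. norm (neg_term r b k q) \<le> M k)"
      using N sm by blast
  qed
  show "locally_summable (circle_nbhd c) (nonneg_term r \<alpha>)"
  proof (rule loc_summableI)
    fix p assume "p \<in> circle_nbhd c"
    from loc[OF this] obtain q N where N: "open N" "p \<in> N" "q < 1 - c" "0 < q"
      "\<And>u. u \<in> N \<Longrightarrow> c < norm (fst u) \<and> norm (fst u) < 1 / c \<and> norm (fst u * snd u - 1) \<le> q" by blast
    define x where "x = (1 + q) / c"
    have x: "0 \<le> x" "x < R"
    proof -
      have "x < (2 - c) / c" unfolding x_def using N c by (intro divide_strict_right_mono) auto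
      also have "\<dots> \<le> 1 / c / c"
      proof -
        \<comment> \<open>Equivalent to (1-c)^2 >= 0.\<close>
        have "(2 - c) * c \<le> 1" using zero_le_power2[of "1 - c"] by (simp add: power2_eq_square algebra_simps)
        then have "2 - c \<le> 1 / c" using c by (simp add: pos_le_divide_eq)
        then show ?thesis using c by (intro divide_right_mono) auto
      qed
      finally show "x < R" using c by (simp add: power2_eq_square)
    qed (use N c in \<open>simp add: x_def\<close>)
    have sm: "summable (\<lambda>m. norm (\<alpha> m) * x ^ m * C)"
      by (intro summable_mult2 coeff_norm_summable \<alpha> x)
    have "norm (nonneg_term r \<alpha> m u) \<le> norm (\<alpha> m) * x ^ m * C" if "u \<in> N" for m u
    proof -
      have u: "c < norm (fst u)" using N(5)[OF that] by auto
      have "norm (tau_ser r (of_nat m) (fst u * snd u)) \<le> C * (1 + q) ^ m"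
        by (rule tau_ser_bound_nat[OF C(2)]) (use N(5)[OF that] N(3) c in auto)
      moreover have "1 / norm (fst u) ^ m \<le> 1 / c ^ m"
        using u c by (intro divide_left_mono power_mono mult_pos_pos zero_less_power) auto
      ultimately have "norm (tau_ser r (of_nat m) (fst u * snd u)) * (1 / norm (fst u) ^ m) \<le> C * (1 + q) ^ m * (1 / c ^ m)"
        using C N by (intro mult_mono) auto
      also have "\<dots> = x ^ m * C" by (simp add: x_def power_divide)
      finally have "norm (\<alpha> m) * (norm (tau_ser r (of_nat m) (fst u * snd u)) * (1 / norm (fst u) ^ m)) \<le> norm (\<alpha> m) * (x ^ m * C)"
        by (rule mult_left_mono) auto
      then show ?thesis by (simp add: nonneg_term_def norm_mult norm_divide norm_power mult.assoc)
    qed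
    then show "\<exists>N M. open N \<and> p \<in> N \<and> summable M \<and> (\<forall>k. \<forall>q\<in>N \<inter> circle_nbhd c. norm (nonneg_term r \<alpha> k q) \<le> M k)"
      using N sm by blast
  qed
qed

lemma hol2_tau_ser_prod: "hol2 (circle_nbhd c) (\<lambda>p. tau_ser r a (fst p * snd p))"
  by (rule hol2_comp1[OF holomorphic_tau_ser[OF r] open_ball], intro hol2_mult hol2_fst hol2_snd)
    (use circle_nbhd_D in \<open>auto simp: dist_norm norm_minus_commute\<close>)

lemma hol2_neg_term: "hol2 (circle_nbhd c) (neg_term r b m)"
  unfolding neg_term_def[abs_def] by (intro hol2_mult hol2_const hol2_power hol2_fst hol2_tau_ser_prod)

lemma hol2_nonneg_term: "hol2 (circle_nbhd c) (nonneg_term r \<alpha> k)"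
  unfolding nonneg_term_def[abs_def] by (intro hol2_mult hol2_divide hol2_const hol2_power hol2_fst hol2_tau_ser_prod)
    (use circle_nbhd_D in auto)

lemma tau_ser_prod_deriv:
  assumes "(w, v) \<in> circle_nbhd c"
  obtains D where "((\<lambda>y. tau_ser r a (w * y)) has_field_derivative w * D) (at v)"
    "(w * v - 1) * D + (1 - r) * tau_ser r a (w * v) = (w * v) powr a"
proof -
  obtain D where D: "(tau_ser r a has_field_derivative D) (at (w * v))"
    "(w * v - 1) * D + (1 - r) * tau_ser r a (w * v) = (w * v) powr a"
    using tau_ser_ode[OF r] circle_nbhd_D[OF assms] by blast
  have "((\<lambda>y. tau_ser r a (w * y)) has_field_derivative D * w) (at v)"
    by (rule DERIV_chain'[where g = "tau_ser r a" and f = "\<lambda>y. w * y"])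
      (use D(1) in \<open>auto intro!: derivative_eq_intros\<close>)
  with D(2) that show ?thesis by (simp add: mult.commute)
qed

text \<open>The polynomial factor wv - 1 takes the place of powers of 1 - wv, because the
  neighbourhood contains points with wv = 1, where such a power may have no holomorphic
  branch.\<close>

lemma neg_term_ode:
  assumes p: "(w, v) \<in> circle_nbhd c"
  shows "(w * v - 1) * d2 (neg_term r b m) (w, v) + (1 - r) * w * neg_term r b m (w, v) = w * (b m * (1 / v) ^ Suc m)"
proof -
  obtain D where D: "((\<lambda>y. tau_ser r (- of_nat (Suc m)) (w * y)) has_field_derivative w * D) (at v)"
    "(w * v - 1) * D + (1 - r) * tau_ser r (- of_nat (Suc m)) (w * v) = (w * v) powr (- of_nat (Suc m))"
    using tau_ser_prod_deriv[OF p] by blast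
  have w0: "w \<noteq> 0" "v \<noteq> 0" using circle_nbhd_D[OF p] by auto
  have "((\<lambda>y. b m * (w ^ Suc m * tau_ser r (- of_nat (Suc m)) (w * y))) has_field_derivative b m * (w ^ Suc m * (w * D))) (at v)"
    by (intro DERIV_cmult D)
  then have "d2 (neg_term r b m) (w, v) = b m * (w ^ Suc m * (w * D))"
    by (intro d2_eqI) (simp add: neg_term_def)
  then have "(w * v - 1) * d2 (neg_term r b m) (w, v) + (1 - r) * w * neg_term r b m (w, v)
     = b m * w ^ Suc m * w * ((w * v - 1) * D + (1 - r) * tau_ser r (- of_nat (Suc m)) (w * v))"
    by (simp add: neg_term_def algebra_simps)
  also have "\<dots> = w * (b m * (1 / v) ^ Suc m)"
  proof -
    have "(w * v) powr (- of_nat (Suc m)) = 1 / (w ^ Suc m * v ^ Suc m)"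
      unfolding powr_minus using w0 by (simp add: powr_nat' power_mult_distrib inverse_eq_divide del: of_nat_Suc power_Suc)
    then show ?thesis unfolding D(2) using w0 by (simp add: power_one_over del: of_nat_Suc power_Suc)
  qed
  finally show ?thesis .
qed

lemma nonneg_term_ode:
  assumes p: "(w, v) \<in> circle_nbhd c"
  shows "(w * v - 1) * d2 (nonneg_term r \<alpha> k) (w, v) + (1 - r) * w * nonneg_term r \<alpha> k (w, v) = w * (\<alpha> k * v ^ k)"
proof -
  obtain D where D: "((\<lambda>y. tau_ser r (of_nat k) (w * y)) has_field_derivative w * D) (at v)"
    "(w * v - 1) * D + (1 - r) * tau_ser r (of_nat k) (w * v) = (w * v) powr (of_nat k)"
    using tau_ser_prod_deriv[OF p] by blast
  have w0: "w \<noteq> 0" "v \<noteq> 0" using circle_nbhd_D[OF p] by auto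
  have "((\<lambda>y. \<alpha> k * (tau_ser r (of_nat k) (w * y) / w ^ k)) has_field_derivative \<alpha> k * (w * D / w ^ k)) (at v)"
    by (intro DERIV_cmult DERIV_cdivide D)
  then have "d2 (nonneg_term r \<alpha> k) (w, v) = \<alpha> k * (w * D / w ^ k)"
    by (intro d2_eqI) (simp add: nonneg_term_def)
  then have "(w * v - 1) * d2 (nonneg_term r \<alpha> k) (w, v) + (1 - r) * w * nonneg_term r \<alpha> k (w, v)
     = \<alpha> k / w ^ k * w * ((w * v - 1) * D + (1 - r) * tau_ser r (of_nat k) (w * v))"
    by (simp add: nonneg_term_def algebra_simps add_divide_distrib diff_divide_distrib)
  also have "\<dots> = w * (\<alpha> k * v ^ k)"
    unfolding D(2) using w0 by (simp add: powr_nat' power_mult_distrib)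
  finally show ?thesis .
qed

lemma hol2_boundary_series: "hol2 (circle_nbhd c) (boundary_series r b \<alpha>)"
  unfolding boundary_series_def[abs_def]
  by (intro hol2_diff hol2_series[OF open_circle_nbhd hol2_neg_term terms_locally_summable(1)]
      hol2_series[OF open_circle_nbhd hol2_nonneg_term terms_locally_summable(2)])

lemma boundary_series_sums:
  assumes "p \<in> circle_nbhd c"
  shows "(\<lambda>m. neg_term r b m p) sums (\<Sum>m. neg_term r b m p)" "(\<lambda>k. nonneg_term r \<alpha> k p) sums (\<Sum>k. nonneg_term r \<alpha> k p)"
  using locally_summable_sums[OF terms_locally_summable(1) assms] locally_summable_sums[OF terms_locally_summable(2) assms] .

text \<open>The two termwise equations summed. This is exactly the condition under which the product
  with -(1-wv)^(1-r) / w has \<open>d2\<close>-derivative (1-wv)^(-r) times the datum.\<close>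

lemma boundary_series_ode:
  assumes p: "(w, v) \<in> circle_nbhd c"
  shows "(w * v - 1) * d2 (boundary_series r b \<alpha>) (w, v) + (1 - r) * w * boundary_series r b \<alpha> (w, v)
    = w * ((\<Sum>m. b m * (1 / v) ^ Suc m) - (\<Sum>k. \<alpha> k * v ^ k))"
proof -
  have w0: "w \<noteq> 0" using circle_nbhd_D[OF p] by auto
  let ?A = "\<lambda>p. \<Sum>m. neg_term r b m p" and ?B = "\<lambda>p. \<Sum>k. nonneg_term r \<alpha> k p"
  have hA: "hol2 (circle_nbhd c) ?A" and hB: "hol2 (circle_nbhd c) ?B"
    by (rule hol2_series[OF open_circle_nbhd hol2_neg_term terms_locally_summable(1)], rule hol2_series[OF open_circle_nbhd hol2_nonneg_term terms_locally_summable(2)])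
  have T: "d2 (boundary_series r b \<alpha>) (w, v) = d2 ?A (w, v) - d2 ?B (w, v)"
    unfolding boundary_series_def[abs_def] by (intro d2_eqI DERIV_diff hol2_d2_has[OF hA p] hol2_d2_has[OF hB p])
  have "(\<lambda>m. (w * v - 1) * d2 (neg_term r b m) (w, v) + (1 - r) * w * neg_term r b m (w, v)) sums
      ((w * v - 1) * d2 ?A (w, v) + (1 - r) * w * ?A (w, v))"
    by (intro sums_add sums_mult boundary_series_sums p hol2_series_d2[OF open_circle_nbhd hol2_neg_term terms_locally_summable(1)])
  then have A: "(\<lambda>m. w * (b m * (1 / v) ^ Suc m)) sums ((w * v - 1) * d2 ?A (w, v) + (1 - r) * w * ?A (w, v))"
    by (simp only: neg_term_ode[OF p])
  have "(\<lambda>k. (w * v - 1) * d2 (nonneg_term r \<alpha> k) (w, v) + (1 - r) * w * nonneg_term r \<alpha> k (w, v)) sums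
      ((w * v - 1) * d2 ?B (w, v) + (1 - r) * w * ?B (w, v))"
    by (intro sums_add sums_mult boundary_series_sums p hol2_series_d2[OF open_circle_nbhd hol2_nonneg_term terms_locally_summable(2)])
  then have B: "(\<lambda>k. w * (\<alpha> k * v ^ k)) sums ((w * v - 1) * d2 ?B (w, v) + (1 - r) * w * ?B (w, v))"
    by (simp only: nonneg_term_ode[OF p])
  have A': "(w * v - 1) * d2 ?A (w, v) + (1 - r) * w * ?A (w, v) = w * (\<Sum>m. b m * (1 / v) ^ Suc m)"
    using sums_divide[OF A, of w] w0 by (simp add: sums_iff)
  have B': "(w * v - 1) * d2 ?B (w, v) + (1 - r) * w * ?B (w, v) = w * (\<Sum>k. \<alpha> k * v ^ k)"
    using sums_divide[OF B, of w] w0 by (simp add: sums_iff)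
  show ?thesis
    unfolding T right_diff_distrib A'[symmetric] B'[symmetric] by (simp add: boundary_series_def algebra_simps)
qed

end

section \<open>Laurent decomposition on an annulus\<close>

text \<open>The straight-line homotopy between concentric circles moves each point radially, so it
  stays in the annulus.\<close>

lemma contour_integral_circles_eq:
  assumes g: "g holomorphic_on {w. \<rho> < norm w \<and> norm w < R}"
    and st: "\<rho> < s" "s < R" "\<rho> < t" "t < R" "0 \<le> \<rho>"
  shows "contour_integral (circlepath 0 s) g = contour_integral (circlepath 0 t) g"
proof (rule Cauchy_theorem_homotopic_loops[OF _ _ g])
  let ?S = "{w::complex. \<rho> < norm w \<and> norm w < R}"
  have "?S = {w. \<rho> < norm w} \<inter> {w. norm w < R}" by auto
  then show "open ?S" by (auto intro!: open_Int open_Collect_less continuous_intros)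
  show "homotopic_loops ?S (circlepath 0 s) (circlepath 0 t)"
  proof (rule homotopic_loops_linear)
    fix u :: real assume "u \<in> {0..1}"
    show "closed_segment (circlepath 0 s u) (circlepath 0 t u) \<subseteq> ?S"
    proof
      fix w assume "w \<in> closed_segment (circlepath 0 s u) (circlepath 0 t u)"
      then obtain x where x: "0 \<le> x" "x \<le> 1" "w = (1 - x) *\<^sub>R circlepath 0 s u + x *\<^sub>R circlepath 0 t u"
        by (auto simp: in_segment)
      define y where "y = (1 - x) * s + x * t"
      have "w = of_real y * exp (2 * of_real pi * \<i> * of_real u)"
        by (simp add: x circlepath y_def scaleR_conv_of_real algebra_simps)
      moreover have "norm (exp (2 * of_real pi * \<i> * of_real u)) = 1"
        using norm_exp_i_times[of "2 * pi * u"] by (simp add: mult_ac)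
      ultimately have w: "norm w = \<bar>y\<bar>" by (simp only: norm_mult norm_of_real mult_1_right)
      have "(1 - x) * s + x * t \<ge> (1 - x) * min s t + x * min s t"
        using x by (intro add_mono mult_left_mono) auto
      moreover have "(1 - x) * s + x * t \<le> (1 - x) * max s t + x * max s t"
        using x by (intro add_mono mult_left_mono) auto
      ultimately have "min s t \<le> y" "y \<le> max s t" by (auto simp: y_def algebra_simps)
      then show "w \<in> ?S" using w st by auto
    qed
  qed auto
qed auto

text \<open>Geometric expansion under the integral, uniform on the circle. It serves both halves of
  the Laurent expansion, with \<psi>(w) = z/w and \<psi>(w) = u w.\<close>

lemma contour_integral_geometric_sums:
  assumes S: "open S" and \<phi>: "\<phi> holomorphic_on S" and \<psi>: "\<psi> holomorphic_on S"
    and t: "0 < t" "sphere 0 t \<subseteq> S" and q: "\<And>w. norm w = t \<Longrightarrow> norm (\<psi> w) \<le> q" "q < 1"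
  shows "(\<lambda>k. contour_integral (circlepath 0 t) (\<lambda>w. \<phi> w * \<psi> w ^ k)) sums
    contour_integral (circlepath 0 t) (\<lambda>w. \<phi> w / (1 - \<psi> w))"
proof -
  have "compact (\<phi> ` sphere 0 t)"
    by (rule compact_continuous_image[OF holomorphic_on_imp_continuous_on[OF holomorphic_on_subset[OF \<phi> t(2)]]]) auto
  from compact_imp_bounded[OF this] obtain M where "\<forall>u\<in>\<phi> ` sphere 0 t. norm u \<le> M"
    unfolding bounded_iff by blast
  then have M: "norm (\<phi> w) \<le> M" if "norm w = t" for w using that by auto
  have q0: "0 \<le> q" using q(1)[of "of_real t"] t(1) by (auto intro: order_trans[OF norm_ge_zero])
  have ul: "uniform_limit (sphere 0 t) (\<lambda>n w. \<Sum>k<n. \<phi> w * \<psi> w ^ k) (\<lambda>w. \<Sum>k. \<phi> w * \<psi> w ^ k) sequentially"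
  proof (rule Weierstrass_m_test)
    show "norm (\<phi> w * \<psi> w ^ k) \<le> M * q ^ k" if "w \<in> sphere 0 t" for k w
      unfolding norm_mult norm_power
      by (intro mult_mono power_mono) (use that q M[of w] order_trans[OF norm_ge_zero M[of w]] in auto)
    show "summable (\<lambda>k. M * q ^ k)" using q q0 by (intro summable_mult summable_geometric) auto
  qed
  have eq: "(\<Sum>k. \<phi> w * \<psi> w ^ k) = \<phi> w / (1 - \<psi> w)" if "norm w = t" for w
  proof -
    have "norm (\<psi> w) < 1" by (rule le_less_trans[OF q(1)[OF that] q(2)])
    from sums_mult[OF geometric_sums[OF this], of "\<phi> w"] show ?thesis by (simp add: sums_iff)
  qed
  have int: "(\<lambda>w. \<phi> w * \<psi> w ^ k) contour_integrable_on circlepath 0 t" for k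
    by (rule contour_integrable_holomorphic_simple[OF _ S valid_path_circlepath])
      (use t in \<open>auto intro!: holomorphic_intros \<phi> \<psi>\<close>)
  have "(\<lambda>n. contour_integral (circlepath 0 t) (\<lambda>w. \<Sum>k<n. \<phi> w * \<psi> w ^ k)) \<longlonglongrightarrow>
      contour_integral (circlepath 0 t) (\<lambda>w. \<Sum>k. \<phi> w * \<psi> w ^ k)"
    by (rule contour_integral_uniform_limit_circlepath(2)[OF _ ul])
      (use t int in \<open>auto intro!: contour_integrable_sum always_eventually\<close>)
  also have "contour_integral (circlepath 0 t) (\<lambda>w. \<Sum>k. \<phi> w * \<psi> w ^ k)
      = contour_integral (circlepath 0 t) (\<lambda>w. \<phi> w / (1 - \<psi> w))"
    by (rule contour_integral_eq) (use eq t in auto)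
  finally show ?thesis
    by (simp only: sums_def contour_integral_sum[OF finite_lessThan int])
qed

text \<open>The coefficients are integrals independent of the radius of the circle, so the same
  numbers work for all points. Moving the circle towards the outer or the inner edge gives each half
  its full domain of convergence.\<close>

lemma Laurent_annulus:
  assumes f: "f holomorphic_on {w. \<rho> < norm w \<and> norm w < 1}" and \<rho>: "0 < \<rho>" "\<rho> < 1"
  obtains a b where "conv_on 1 a" "conv_on (1 / \<rho>) b"
    "\<And>z. \<rho> < norm z \<Longrightarrow> norm z < 1 \<Longrightarrow> f z = (\<Sum>k. a k * z ^ k) + (\<Sum>k. b k * (1 / z) ^ Suc k)"
proof -
  let ?S = "{w::complex. \<rho> < norm w \<and> norm w < 1}"
  have "?S = {w. \<rho> < norm w} \<inter> {w. norm w < 1}" by auto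
  then have opS: "open ?S" by (auto intro!: open_Int open_Collect_less continuous_intros)
  define I where "I t g = contour_integral (circlepath 0 t) g / (2 * pi * \<i>)" for t :: real and g
  define t0 where "t0 = (1 + \<rho>) / 2"
  have t0: "\<rho> < t0" "t0 < 1" using \<rho> by (auto simp: t0_def)
  define a where "a k = I t0 (\<lambda>w. f w / w ^ Suc k)" for k
  define b where "b k = I t0 (\<lambda>w. f w * w ^ k)" for k
  have ha: "(\<lambda>w. f w / w ^ Suc k) holomorphic_on ?S" for k
    using \<rho> by (intro holomorphic_intros f) auto
  have hb: "(\<lambda>w. f w * w ^ k) holomorphic_on ?S" for k
    by (intro holomorphic_intros f)
  have a_eq: "a k = I t (\<lambda>w. f w / w ^ Suc k)" if "\<rho> < t" "t < 1" for t k
    unfolding a_def I_def using contour_integral_circles_eq[OF ha t0 that less_imp_le[OF \<rho>(1)]] by simp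
  have b_eq: "b k = I t (\<lambda>w. f w * w ^ k)" if "\<rho> < t" "t < 1" for t k
    unfolding b_def I_def using contour_integral_circles_eq[OF hb t0 that less_imp_le[OF \<rho>(1)]] by simp
  have integ: "g contour_integrable_on circlepath 0 t" if "g holomorphic_on ?S" "\<rho> < t" "t < 1" for g t
    by (rule contour_integrable_holomorphic_simple[OF that(1) opS valid_path_circlepath]) (use that \<rho> in auto)
  have outer: "(\<lambda>k. a k * z ^ k) sums I t (\<lambda>w. f w / (w - z))" if t: "\<rho> < t" "t < 1" "norm z < t" for t z
  proof -
    have t0: "0 < t" using t \<rho> by simp
    have "(\<lambda>k. contour_integral (circlepath 0 t) (\<lambda>w. f w / w * (z / w) ^ k)) sums
        contour_integral (circlepath 0 t) (\<lambda>w. f w / w / (1 - z / w))"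
    proof (rule contour_integral_geometric_sums[OF opS _ _ t0])
      show "(\<lambda>w. f w / w) holomorphic_on ?S" "(\<lambda>w. z / w) holomorphic_on ?S"
        using \<rho> by (auto intro!: holomorphic_intros f)
      show "norm (z / w) \<le> norm z / t" if "norm w = t" for w using that by (simp add: norm_divide)
      show "norm z / t < 1" using t t0 by simp
    qed (use t in auto)
    also have "contour_integral (circlepath 0 t) (\<lambda>w. f w / w / (1 - z / w)) = contour_integral (circlepath 0 t) (\<lambda>w. f w / (w - z))"
      by (rule contour_integral_eq) (use t t0 in \<open>auto simp: field_simps\<close>)
    also have "(\<lambda>k. contour_integral (circlepath 0 t) (\<lambda>w. f w / w * (z / w) ^ k))
        = (\<lambda>k. contour_integral (circlepath 0 t) (\<lambda>w. f w / w ^ Suc k) * z ^ k)"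
      using contour_integral_rmul[OF integ[OF ha t(1,2)]] by (simp add: power_divide)
    finally show ?thesis
      using sums_divide[of _ _ "2 * pi * \<i>"] by (force simp: a_eq[OF t(1,2)] I_def)
  qed
  have inner: "(\<lambda>k. b k * u ^ Suc k) sums I t (\<lambda>w. f w * u / (1 - u * w))"
    if t: "\<rho> < t" "t < 1" "norm u < 1 / t" for t u
  proof -
    have t0: "0 < t" using t \<rho> by simp
    have "(\<lambda>k. contour_integral (circlepath 0 t) (\<lambda>w. f w * u * (u * w) ^ k)) sums
        contour_integral (circlepath 0 t) (\<lambda>w. f w * u / (1 - u * w))"
    proof (rule contour_integral_geometric_sums[OF opS _ _ t0])
      show "(\<lambda>w. f w * u) holomorphic_on ?S" "(\<lambda>w. u * w) holomorphic_on ?S"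
        by (intro holomorphic_intros f)+
      show "norm (u * w) \<le> norm u * t" if "norm w = t" for w using that by (simp add: norm_mult)
      show "norm u * t < 1" using t t0 by (simp add: field_simps)
    qed (use t in auto)
    also have "(\<lambda>k. contour_integral (circlepath 0 t) (\<lambda>w. f w * u * (u * w) ^ k))
        = (\<lambda>k. contour_integral (circlepath 0 t) (\<lambda>w. f w * w ^ k) * u ^ Suc k)"
      using contour_integral_rmul[OF integ[OF hb t(1,2)], symmetric] by (simp add: power_mult_distrib mult_ac)
    finally show ?thesis
      using sums_divide[of _ _ "2 * pi * \<i>"] by (force simp: b_eq[OF t(1,2)] I_def)
  qed
  show ?thesis
  proof (rule that; (unfold conv_on_def, intro allI impI)?)
    fix z :: complex assume z: "norm z < 1"
    obtain t where "max \<rho> (norm z) < t" "t < 1" using dense[of "max \<rho> (norm z)" 1] z \<rho> by auto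
    then show "summable (\<lambda>k. a k * z ^ k)" using outer[of t z] by (auto simp: sums_iff)
  next
    fix u :: complex assume u: "norm u < 1 / \<rho>"
    show "summable (\<lambda>k. b k * u ^ k)"
    \<comment> \<open>The integral formula yields the series multiplied by u, which is uninformative
      at u = 0.\<close>
    proof (cases "u = 0")
      case True
      then show ?thesis by (simp add: summable_0_powser)
    next
      case False
      have "\<rho> < 1 / norm u" using u False \<rho> by (simp add: field_simps)
      then obtain t where t: "\<rho> < t" "t < min 1 (1 / norm u)"
        using dense[of \<rho> "min 1 (1 / norm u)"] \<rho> by auto
      then have "norm u < 1 / t" using \<rho> False by (simp add: field_simps)
      then have "summable (\<lambda>k. b k * u ^ Suc k)" using inner[of t u] t by (auto simp: sums_iff)
      from summable_divide[OF this, of u] show ?thesis using False by simp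
    qed
  next
    fix z :: complex assume z: "\<rho> < norm z" "norm z < 1"
    obtain s where s: "\<rho> < s" "s < norm z" using dense[OF z(1)] by blast
    obtain t where t: "norm z < t" "t < 1" using dense[OF z(2)] by blast
    have s0: "0 < s" "0 < t" using s t \<rho> by auto
    have z0: "z \<noteq> 0" using z \<rho> by auto
    \<comment> \<open>The divided difference has a removable singularity at z, so its integrals over
      circles inside and outside z agree. Splitting off f(z) / (w-z), whose integrals are 0 and 2 pi
      i f(z), gives Cauchy's formula for the annulus.\<close>
    define h where "h w = (if w = z then deriv f z else (f w - f z) / (w - z))" for w
    have hh: "h holomorphic_on ?S"
      unfolding h_def by (rule pole_lemma_open[OF f opS])
    have ff: "(\<lambda>w. f w / (w - z)) contour_integrable_on circlepath 0 x"
      and f1: "(\<lambda>w. f z / (w - z)) contour_integrable_on circlepath 0 x"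
      if "\<rho> < x" "x < 1" "x \<noteq> norm z" for x
    proof -
      have o: "open (?S - {z})" using opS by (rule open_delete)
      have p: "path_image (circlepath 0 x) \<subseteq> ?S - {z}" using that \<rho> by auto
      show "(\<lambda>w. f w / (w - z)) contour_integrable_on circlepath 0 x"
        by (rule contour_integrable_holomorphic_simple[OF _ o valid_path_circlepath p])
          (auto intro!: holomorphic_intros holomorphic_on_subset[OF f])
      show "(\<lambda>w. f z / (w - z)) contour_integrable_on circlepath 0 x"
        by (rule contour_integrable_holomorphic_simple[OF _ o valid_path_circlepath p])
          (auto intro!: holomorphic_intros)
    qed
    have split: "contour_integral (circlepath 0 x) h = contour_integral (circlepath 0 x) (\<lambda>w. f w / (w - z))
        - contour_integral (circlepath 0 x) (\<lambda>w. f z / (w - z))"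
      if "\<rho> < x" "x < 1" "x \<noteq> norm z" for x
    proof -
      have "contour_integral (circlepath 0 x) h = contour_integral (circlepath 0 x) (\<lambda>w. f w / (w - z) - f z / (w - z))"
        by (rule contour_integral_eq) (use that \<rho> in \<open>auto simp: h_def diff_divide_distrib\<close>)
      then show ?thesis using contour_integral_diff[OF ff[OF that] f1[OF that]] by simp
    qed
    have "contour_integral (circlepath 0 t) h = contour_integral (circlepath 0 s) h"
      by (rule contour_integral_circles_eq[OF hh]) (use s t z \<rho> in auto)
    moreover have "contour_integral (circlepath 0 t) (\<lambda>w. f z / (w - z)) = 2 * pi * \<i> * f z"
      using contour_integral_unique[OF Cauchy_integral_circlepath_simple[of "\<lambda>_. f z" 0 t z]] t by simp
    moreover have "contour_integral (circlepath 0 s) (\<lambda>w. f z / (w - z)) = 0"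
    proof (rule contour_integral_unique, rule Cauchy_theorem_convex_simple[OF _ convex_ball[of 0 "norm z"]])
      show "(\<lambda>w. f z / (w - z)) holomorphic_on ball 0 (norm z)"
        by (intro holomorphic_intros) auto
    qed (use s s0 in auto)
    ultimately have "contour_integral (circlepath 0 t) (\<lambda>w. f w / (w - z)) - 2 * pi * \<i> * f z
        = contour_integral (circlepath 0 s) (\<lambda>w. f w / (w - z))"
      using split[of t] split[of s] s t z by simp
    then have "f z = I t (\<lambda>w. f w / (w - z)) - I s (\<lambda>w. f w / (w - z))"
      by (simp add: I_def field_simps)
    moreover have "I t (\<lambda>w. f w / (w - z)) = (\<Sum>k. a k * z ^ k)"
      using outer[of t z] t z by (simp add: sums_iff)
    moreover have "(\<Sum>k. b k * (1 / z) ^ Suc k) = I s (\<lambda>w. f w * (1 / z) / (1 - (1 / z) * w))"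
    proof -
      have "norm (1 / z) < 1 / s"
        unfolding norm_divide norm_one by (rule divide_strict_left_mono) (use s s0 z0 in auto)
      then show ?thesis using inner[of s "1 / z"] s z by (simp add: sums_iff del: power_Suc)
    qed
    moreover have "I s (\<lambda>w. f w * (1 / z) / (1 - (1 / z) * w)) = I s (\<lambda>w. - (f w / (w - z)))"
    proof -
      have "f w * (1 / z) / (1 - (1 / z) * w) = - (f w / (w - z))" if "norm w = s" for w
      proof -
        have "w \<noteq> z" using that s by auto
        then show ?thesis using z0 by (simp add: field_simps)
      qed
      then show ?thesis unfolding I_def
        by (intro arg_cong2[of _ _ _ _ "(/)"] contour_integral_eq refl) (use s0 in auto)
    qed
    moreover have "I s (\<lambda>w. - (f w / (w - z))) = - I s (\<lambda>w. f w / (w - z))"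
      using contour_integral_neg[of "circlepath 0 s" "\<lambda>w. f w / (w - z)"] by (simp add: I_def)
    ultimately show "f z = (\<Sum>k. a k * z ^ k) + (\<Sum>k. b k * (1 / z) ^ Suc k)" by simp
  qed
qed

section \<open>The disc model\<close>

definition cayley :: "complex \<Rightarrow> complex" where "cayley z = (z - \<i>) / (z + \<i>)"
text \<open>The Cayley transform as it acts on conj z, made holomorphic in an independent second
  variable.\<close>

definition cayley_conj :: "complex \<Rightarrow> complex" where "cayley_conj z = (z + \<i>) / (z - \<i>)"
definition cayley_inv :: "complex \<Rightarrow> complex" where "cayley_inv w = \<i> * (1 + w) / (1 - w)"
definition cayley_conj_inv :: "complex \<Rightarrow> complex" where "cayley_conj_inv v = - \<i> * (1 + v) / (1 - v)"

lemma cnj_cayley: "cnj (cayley z) = cayley_conj (cnj z)"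
  by (simp add: cayley_def cayley_conj_def)

lemma cnj_cayley_inv: "cnj (cayley_inv w) = cayley_conj_inv (cnj w)"
  by (simp add: cayley_inv_def cayley_conj_inv_def)

lemma UHP_neq: "z \<in> UHP \<Longrightarrow> z + \<i> \<noteq> 0" "z \<in> UHP \<Longrightarrow> cnj z - \<i> \<noteq> 0"
  by (auto simp: UHP_def complex_eq_iff)

lemma open_UHP: "open UHP"
  unfolding UHP_def by (intro open_Collect_less continuous_intros)

lemma one_minus_cayley: "z + \<i> \<noteq> 0 \<Longrightarrow> 1 - cayley z = 2 * \<i> / (z + \<i>)"
  by (simp add: cayley_def field_simps)

lemma one_minus_cayley_conj: "z - \<i> \<noteq> 0 \<Longrightarrow> 1 - cayley_conj z = - 2 * \<i> / (z - \<i>)"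
  by (simp add: cayley_conj_def field_simps)

lemma of_real_Im: "complex_of_real (Im z) = (z - cnj z) / (2 * \<i>)"
  by (simp add: complex_eq_iff Re_divide Im_divide)

text \<open>Source of the factor (1-w)^r: the weights 1 - |w|^2 and y differ by (1-w)(1 - conj w),
  one factor for each of the two variables.\<close>

lemma one_minus_cayley_cnj:
  assumes "z \<in> UHP"
  shows "1 - cayley z * cnj (cayley z) = (1 - cayley z) * cnj (1 - cayley z) * of_real (Im z)"
proof -
  have n: "z + \<i> \<noteq> 0" "cnj z - \<i> \<noteq> 0" using UHP_neq[OF assms] .
  have gen: "1 - a / b * (c / d) = (b * d - a * c) / (b * d)" if "b \<noteq> 0" "d \<noteq> 0" for a b c d :: complex
    using that by (simp add: diff_divide_distrib)
  have "1 - cayley z * cnj (cayley z) = ((z + \<i>) * (cnj z - \<i>) - (z - \<i>) * (cnj z + \<i>)) / ((z + \<i>) * (cnj z - \<i>))"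
    using gen[OF n] by (simp add: cayley_def)
  also have "(z + \<i>) * (cnj z - \<i>) - (z - \<i>) * (cnj z + \<i>) = - 2 * \<i> * (z - cnj z)"
    by (simp add: algebra_simps)
  also have "- 2 * \<i> * d / (p * q) = 2 * \<i> / p * (- 2 * \<i> / q) * (d / (2 * \<i>))" for d p q :: complex
    by simp
  also have "2 * \<i> / (z + \<i>) = 1 - cayley z" by (rule one_minus_cayley[OF n(1), symmetric])
  also have "- 2 * \<i> / (cnj z - \<i>) = cnj (1 - cayley z)" unfolding one_minus_cayley[OF n(1)] by simp
  finally show ?thesis unfolding of_real_Im .
qed

lemma one_minus_norm_cayley:
  assumes "z \<in> UHP"
  shows "1 - (norm (cayley z))^2 = (norm (1 - cayley z))^2 * Im z"
proof -
  have "complex_of_real (1 - (norm (cayley z))^2) = of_real ((norm (1 - cayley z))^2 * Im z)"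
    using one_minus_cayley_cnj[OF assms] by (simp only: of_real_diff of_real_1 of_real_mult complex_norm_square)
  then show ?thesis by (simp only: of_real_eq_iff)
qed

lemma cayley_in_disc: "z \<in> UHP \<Longrightarrow> norm (cayley z) < 1"
proof -
  assume z: "z \<in> UHP"
  have "1 - cayley z \<noteq> 0" using one_minus_cayley UHP_neq(1)[OF z] by simp
  then have "(norm (1 - cayley z))^2 * Im z > 0" using z by (auto simp: UHP_def)
  then have "(norm (cayley z))^2 < 1" using one_minus_norm_cayley[OF z] by linarith
  then show ?thesis by (simp add: power_less_one_iff abs_square_less_1)
qed

lemma cayley_cayley_inv: "w \<noteq> 1 \<Longrightarrow> cayley (cayley_inv w) = w"
proof -
  assume w: "w \<noteq> 1"
  have "cayley_inv w - \<i> = 2 * \<i> * w / (1 - w)" "cayley_inv w + \<i> = 2 * \<i> / (1 - w)"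
    using w by (simp_all add: cayley_inv_def field_simps)
  then show ?thesis using w by (simp add: cayley_def)
qed

lemma cayley_inv_cayley: "z + \<i> \<noteq> 0 \<Longrightarrow> cayley_inv (cayley z) = z"
proof -
  assume z: "z + \<i> \<noteq> 0"
  have "1 + cayley z = 2 * z / (z + \<i>)" using z by (simp add: cayley_def field_simps)
  then show ?thesis unfolding cayley_inv_def one_minus_cayley[OF z] using z by simp
qed

lemma cayley_inv_in_UHP: "norm w < 1 \<Longrightarrow> cayley_inv w \<in> UHP"
proof -
  assume w: "norm w < 1"
  then have w1: "1 - w \<noteq> 0" by auto
  have "1 - cnj w \<noteq> 0" using w1 by (metis complex_cnj_cnj complex_cnj_diff complex_cnj_one complex_cnj_zero)
  then have "cayley_inv w = \<i> * (1 + w) * cnj (1 - w) / of_real ((norm (1 - w))^2)"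
    unfolding cayley_inv_def complex_norm_square using w1 by simp
  moreover have "Im (\<i> * (1 + w) * cnj (1 - w)) = 1 - (norm w)^2"
    unfolding cmod_power2 by (simp add: power2_eq_square algebra_simps)
  ultimately have "Im (cayley_inv w) = (1 - (norm w)^2) / (norm (1 - w))^2"
    by (simp only: Im_divide_of_real)
  moreover have "(norm w)^2 < 1" using w by (simp add: power_less_one_iff abs_square_less_1)
  ultimately show ?thesis using w1 by (simp add: UHP_def)
qed

lemma Re_one_minus_pos: "norm w < 1 \<Longrightarrow> Re (1 - w) > 0"
  using complex_Re_le_cmod[of w] by simp

lemma one_minus_not_nonpos: "norm (w::complex) < 1 \<Longrightarrow> 1 - w \<notin> \<real>\<^sub>\<le>\<^sub>0"
  using Re_one_minus_pos[of w] by (auto simp: complex_nonpos_Reals_iff)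

text \<open>Off the negative axis the principal logarithms of X and conj X are conjugate, so they
  add up to the real number ln |X|^2 without a branch correction.\<close>

lemma powr_cnj_mult:
  assumes "X \<notin> \<real>\<^sub>\<le>\<^sub>0"
  shows "X powr r * cnj X powr r = of_real ((norm X)^2) powr r"
proof -
  have X: "X \<noteq> 0" using assms by auto
  have "Ln X + Ln (cnj X) = of_real (2 * ln (norm X))"
    using assms X by (simp add: cnj_Ln[symmetric] complex_add_cnj Re_Ln)
  also have "2 * ln (norm X) = ln ((norm X)^2)" using X by (simp add: ln_realpow)
  also have "of_real (ln ((norm X)^2)) = Ln (of_real ((norm X)^2))" using X by (intro Ln_of_real[symmetric]) simp
  finally have "Ln X + Ln (cnj X) = Ln (of_real ((norm X)^2))" .
  then have "r * Ln X + r * Ln (cnj X) = r * Ln (of_real ((norm X)^2))" by (simp flip: distrib_left)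
  then show ?thesis using X by (simp add: powr_def exp_add[symmetric] del: of_real_power)
qed

text \<open>This splits y^(-r) into a factor holomorphic in w, the disc weight, and an
  antiholomorphic factor; the first is pulled out of the solutions, the last is absorbed in the
  datum.\<close>

lemma weight_identity:
  assumes z: "z \<in> UHP"
  shows "(1 - cayley z) powr r * (1 - cayley z * cnj (cayley z)) powr (- r) * (1 - cnj (cayley z)) powr r
    = of_real (Im z) powr (- r)"
proof -
  define X where "X = 1 - cayley z"
  have X: "X \<notin> \<real>\<^sub>\<le>\<^sub>0" "X \<noteq> 0"
    using one_minus_not_nonpos[OF cayley_in_disc[OF z]] by (auto simp: X_def)
  have "1 - cayley z * cnj (cayley z) = of_real ((norm X)^2) * of_real (Im z)"
    using one_minus_cayley_cnj[OF z] unfolding X_def[symmetric] complex_norm_square[symmetric] .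
  then have "(1 - cayley z * cnj (cayley z)) powr (- r) = of_real ((norm X)^2) powr (- r) * of_real (Im z) powr (- r)"
    using z by (simp only:) (intro powr_times_real, auto simp: UHP_def)
  moreover have "X powr r * (1 - cnj (cayley z)) powr r = of_real ((norm X)^2) powr r"
    using powr_cnj_mult[OF X(1), of r] by (simp add: X_def)
  moreover have "of_real ((norm X)^2) powr r * of_real ((norm X)^2) powr (- r) = (1::complex)"
    using X(2) by (simp add: powr_minus)
  ultimately show ?thesis unfolding X_def[symmetric]
    by (metis (no_types, lifting) mult.assoc mult.commute mult.right_neutral)
qed

text \<open>The base of the power in f_r is (1-w) / s with s = 1 - |w|^2 positive, so its logarithm
  separates without a branch jump. Thus f_r carries exactly the power (1 - |w|^2)^(1-r) found in the
  boundary solutions.\<close>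

lemma fr_disc:
  assumes z: "z \<in> UHP" "z \<noteq> \<i>"
  shows "fr r z = (1 - cayley z) powr r / cayley z * (1 - cayley z * cnj (cayley z)) powr (1 - r)"
proof -
  define X where "X = 1 - cayley z"
  define s where "s = (norm X)^2 * Im z"
  have n: "z + \<i> \<noteq> 0" "cnj z - \<i> \<noteq> 0" using UHP_neq[OF z(1)] .
  have X: "X \<notin> \<real>\<^sub>\<le>\<^sub>0" "X \<noteq> 0"
    using one_minus_not_nonpos[OF cayley_in_disc[OF z(1)]] by (auto simp: X_def)
  have y: "Im z > 0" using z by (simp add: UHP_def)
  have s: "s > 0" using X y by (simp add: s_def)
  have se: "1 - cayley z * cnj (cayley z) = of_real s"
    using one_minus_cayley_cnj[OF z(1)] unfolding X_def[symmetric] complex_norm_square[symmetric]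
    by (simp add: s_def)
  have "of_real s = X * cnj X * of_real (Im z)"
    using one_minus_cayley_cnj[OF z(1)] se by (simp add: X_def)
  then have "X / of_real s = 1 / (cnj X * of_real (Im z))" using X by simp
  also have "cnj X = - 2 * \<i> / (cnj z - \<i>)" unfolding X_def one_minus_cayley[OF n(1)] by simp
  also have "of_real (Im z) = (z - cnj z) / (2 * \<i>)" by (rule of_real_Im)
  also have "1 / (- 2 * \<i> / (cnj z - \<i>) * ((z - cnj z) / (2 * \<i>))) = (cnj z - \<i>) / (cnj z - z)"
  proof -
    have "cnj z - z \<noteq> 0" using y by (auto simp: complex_eq_iff)
    moreover have "1 / (- 2 * \<i> / c * (- d / (2 * \<i>))) = c / d" if "c \<noteq> 0" "d \<noteq> 0" for c d :: complex
      using that by (simp add: field_simps)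
    ultimately have "1 / (- 2 * \<i> / (cnj z - \<i>) * (- (cnj z - z) / (2 * \<i>))) = (cnj z - \<i>) / (cnj z - z)"
      using n(2) by blast
    then show ?thesis by (simp only: minus_diff_eq)
  qed
  finally have base: "(cnj z - \<i>) / (cnj z - z) = X / of_real s" by simp
  have "Ln (X / of_real s) = Ln X - of_real (ln s)" using X s by (simp add: Ln_divide_of_real)
  then have "(X / of_real s) powr (r - 1) = exp ((r - 1) * (Ln X - of_real (ln s)))"
    using X s by (simp add: powr_def)
  also have "(r - 1) * (Ln X - of_real (ln s)) = (r - 1) * Ln X + (1 - r) * Ln (of_real s)"
    using s by (simp add: Ln_of_real algebra_simps)
  finally have "(X / of_real s) powr (r - 1) = exp ((r - 1) * Ln X + (1 - r) * Ln (of_real s))" .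
  also have "\<dots> = X powr (r - 1) * of_real s powr (1 - r)"
    using X s by (simp add: powr_def exp_add)
  finally have p: "(X / of_real s) powr (r - 1) = X powr (r - 1) * of_real s powr (1 - r)" .
  have w0: "cayley z \<noteq> 0" using z n by (simp add: cayley_def)
  have "2 * \<i> / (z - \<i>) = X / cayley z"
    unfolding X_def one_minus_cayley[OF n(1)] using n z by (simp add: cayley_def)
  then have "fr r z = X / cayley z * (X powr (r - 1) * of_real s powr (1 - r))"
    unfolding fr_def base p by simp
  also have "\<dots> = (X * X powr (r - 1)) / cayley z * of_real s powr (1 - r)" by simp
  also have "X * X powr (r - 1) = X powr r" using X by (simp add: powr_diff)
  finally show ?thesis unfolding se X_def .
qed

text \<open>Conversion factor between data on the disc and on the half-plane: (1-v)^(-r) is left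
  over from \<open>weight_identity\<close>, and (i/2)(1-v)^2 is the derivative of
  \<open>cayley_conj\<close>.\<close>

definition cayley_weight :: "complex \<Rightarrow> complex \<Rightarrow> complex" where
  "cayley_weight r v = (1 - v) powr (- r) * (\<i> / 2) * (1 - v)^2"

lemma cayley_hol: "cayley holomorphic_on - {- \<i>}"
  unfolding cayley_def by (intro holomorphic_intros) (auto simp: add_eq_0_iff2)

lemma cayley_conj_hol: "cayley_conj holomorphic_on - {\<i>}"
  unfolding cayley_conj_def by (intro holomorphic_intros) auto

lemma cayley_inv_hol: "cayley_inv holomorphic_on - {1}"
  unfolding cayley_inv_def by (intro holomorphic_intros) auto

lemma cayley_conj_inv_hol: "cayley_conj_inv holomorphic_on - {1}"
  unfolding cayley_conj_inv_def by (intro holomorphic_intros) auto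

lemma cayley_conj_deriv:
  assumes "\<zeta> - \<i> \<noteq> 0"
  shows "(cayley_conj has_field_derivative (\<i> / 2) * (1 - cayley_conj \<zeta>)^2) (at \<zeta>)"
proof -
  have "(cayley_conj has_field_derivative ((\<zeta> - \<i>) - (\<zeta> + \<i>)) / (\<zeta> - \<i>)^2) (at \<zeta>)"
    unfolding cayley_conj_def using assms
    by (auto intro!: derivative_eq_intros simp: power2_eq_square)
  also have "((\<zeta> - \<i>) - (\<zeta> + \<i>)) / (\<zeta> - \<i>)^2 = (\<i> / 2) * (1 - cayley_conj \<zeta>)^2"
    unfolding one_minus_cayley_conj[OF assms] using assms by (simp add: power_divide power2_eq_square)
  finally show ?thesis .
qed

text \<open>A disc solution is pulled back in each variable by its own Cayley transform; the chain
  rule in the second variable and \<open>weight_identity\<close> produce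
  \<open>cayley_weight\<close>.\<close>

lemma Hr_disc_I:
  assumes op: "open V" "open \<Omega>" and VU: "V \<subseteq> UHP" and H: "hol2 \<Omega> \<Psi>"
    and V: "\<And>z. z \<in> V \<Longrightarrow> (cayley z, cnj (cayley z)) \<in> \<Omega>"
    and eq: "\<And>z. z \<in> V \<Longrightarrow> F z = (1 - cayley z) powr r * \<Psi> (cayley z, cnj (cayley z))"
    and A: "A holomorphic_on cnj ` cayley ` V"
    and pde: "\<And>z. z \<in> V \<Longrightarrow> d2 \<Psi> (cayley z, cnj (cayley z)) =
                (1 - cayley z * cnj (cayley z)) powr (- r) * A (cnj (cayley z))"
  shows "F \<in> Hr r V"
    "\<And>z. z \<in> V \<Longrightarrow> dzbar F z = of_real (Im z) powr (- r) * (cayley_weight r (cnj (cayley z)) * A (cnj (cayley z)))"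
proof -
  define B where "B \<zeta> = cayley_weight r (cayley_conj \<zeta>) * A (cayley_conj \<zeta>)" for \<zeta>
  define \<Phi> where "\<Phi> p = (1 - cayley (fst p)) powr r * \<Psi> (cayley (fst p), cayley_conj (snd p))" for p
  \<comment> \<open>On this set both transforms are away from their poles and |w| < 1, so the
    principal power of 1-w is holomorphic.\<close>
  define D where "D = UHP \<times> cnj ` UHP"
  have opD: "open D" unfolding D_def by (intro open_Times open_UHP open_image_cnj)
  have Dn: "fst p + \<i> \<noteq> 0" "snd p - \<i> \<noteq> 0" "fst p \<in> UHP" if "p \<in> D" for p
    using that UHP_neq by (auto simp: D_def)
  have hc: "hol2 D (\<lambda>p. cayley (fst p))"
    by (rule hol2_comp1[OF cayley_hol _ hol2_fst]) (use Dn in \<open>auto simp: add_eq_0_iff2\<close>)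
  have hcb: "hol2 D (\<lambda>p. cayley_conj (snd p))"
    by (rule hol2_comp1[OF cayley_conj_hol _ hol2_snd]) (use Dn in auto)
  define \<Omega>' where "\<Omega>' = D \<inter> (\<lambda>p. (cayley (fst p), cayley_conj (snd p))) -` \<Omega>"
  have op': "open \<Omega>'"
    unfolding \<Omega>'_def
    by (intro continuous_open_preimage opD op(2) continuous_on_Pair hol2_cont hc hcb)
  have sub: "\<Omega>' \<subseteq> D" by (auto simp: \<Omega>'_def)
  have h1: "hol2 \<Omega>' (\<lambda>p. (1 - cayley (fst p)) powr r)"
    by (intro hol2_powr hol2_diff hol2_const hol2_subset[OF hc sub] one_minus_not_nonpos cayley_in_disc)
      (use Dn sub in auto)
  have h2: "hol2 \<Omega>' (\<lambda>p. \<Psi> (cayley (fst p), cayley_conj (snd p)))"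
    by (rule hol2_compose2[OF op(2) H hol2_subset[OF hc sub] hol2_subset[OF hcb sub]]) (auto simp: \<Omega>'_def)
  have h\<Phi>: "hol2 \<Omega>' \<Phi>" unfolding \<Phi>_def[abs_def] by (rule hol2_mult[OF h1 h2])
  have V': "(z, cnj z) \<in> \<Omega>'" if "z \<in> V" for z
    using V[OF that] that VU by (auto simp: \<Omega>'_def D_def cnj_cayley)
  have eq': "F z = \<Phi> (z, cnj z)" if "z \<in> V" for z
    using eq[OF that] by (simp add: \<Phi>_def cnj_cayley)
  have im: "cayley_conj ` cnj ` V = cnj ` cayley ` V" by (auto simp: image_image cnj_cayley)
  have vb: "norm (cayley_conj \<zeta>) < 1" if "\<zeta> \<in> cnj ` V" for \<zeta>
    using that VU cayley_in_disc by (auto simp flip: cnj_cayley)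
  have cvb: "cayley_conj holomorphic_on cnj ` V"
    by (rule holomorphic_on_subset[OF cayley_conj_hol]) (use VU UHP_neq(2) in \<open>auto simp: eq_commute[of "\<i>"]\<close>)
  have hB: "B holomorphic_on cnj ` V"
  proof -
    have "(A \<circ> cayley_conj) holomorphic_on cnj ` V"
      by (rule holomorphic_on_compose[OF cvb]) (use A im in simp)
    then have A': "(\<lambda>\<zeta>. A (cayley_conj \<zeta>)) holomorphic_on cnj ` V" by (simp add: o_def)
    show ?thesis unfolding B_def cayley_weight_def
      by (intro holomorphic_intros A' cvb one_minus_not_nonpos vb)
  qed
  have pde': "d2 \<Phi> (z, cnj z) = of_real (Im z) powr (- r) * B (cnj z)" if z: "z \<in> V" for z
  proof -
    have zU: "z \<in> UHP" using z VU by auto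
    define w v where "w = cayley z" and "v = cnj (cayley z)"
    have v: "cayley_conj (cnj z) = v" by (simp add: v_def cnj_cayley)
    have "((\<lambda>y. \<Psi> (w, y)) has_field_derivative d2 \<Psi> (w, v)) (at (cayley_conj (cnj z)))"
      unfolding v by (rule hol2_d2_has[OF H]) (use V[OF z] in \<open>simp add: w_def v_def\<close>)
    from DERIV_chain'[OF cayley_conj_deriv[OF UHP_neq(2)[OF zU]] this]
    have "((\<lambda>y. \<Psi> (w, cayley_conj y)) has_field_derivative d2 \<Psi> (w, v) * ((\<i> / 2) * (1 - v)^2)) (at (cnj z))"
      by (simp add: v)
    then have "((\<lambda>y. (1 - w) powr r * \<Psi> (w, cayley_conj y)) has_field_derivative
        (1 - w) powr r * (d2 \<Psi> (w, v) * ((\<i> / 2) * (1 - v)^2))) (at (cnj z))"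
      by (rule DERIV_cmult)
    then have "d2 \<Phi> (z, cnj z) = (1 - w) powr r * (d2 \<Psi> (w, v) * ((\<i> / 2) * (1 - v)^2))"
      by (intro d2_eqI) (simp add: \<Phi>_def w_def)
    also have "\<dots> = ((1 - w) powr r * (1 - w * v) powr (- r)) * ((\<i> / 2) * (1 - v)^2 * A v)"
      using pde[OF z] by (simp add: w_def v_def mult_ac)
    also have "(1 - w) powr r * (1 - w * v) powr (- r) = of_real (Im z) powr (- r) * (1 - v) powr (- r)"
    proof -
      have v1: "1 - v \<noteq> 0" using cayley_in_disc[OF zU] by (auto simp: v_def)
      have "(1 - v) powr r * (1 - v) powr (- r) = 1" using v1 by (simp add: powr_minus)
      then show ?thesis
        unfolding weight_identity[OF zU, of r, symmetric] w_def v_def by (simp add: mult.assoc)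
    qed
    finally show ?thesis unfolding B_def v cayley_weight_def by (simp add: mult_ac)
  qed
  have hyps: "open V" "open \<Omega>'" "V \<subseteq> UHP" by (rule op(1), rule op', rule VU)
  show "F \<in> Hr r V"
    by (rule Hr_hol2I(1)[OF hyps(1,2,3) h\<Phi> V' eq' hB pde'])
  show "dzbar F z = of_real (Im z) powr (- r) * (cayley_weight r (cnj (cayley z)) * A (cnj (cayley z)))" if "z \<in> V" for z
    using Hr_hol2I(2)[OF hyps(1,2,3) h\<Phi> V' eq' hB pde' that] by (simp add: B_def cnj_cayley)
qed

lemma cayley_weight_nonzero: "norm v < 1 \<Longrightarrow> cayley_weight r v \<noteq> 0"
  by (auto simp: cayley_weight_def powr_nonneg_iff)

text \<open>The datum on the half-plane becomes one on the disc after division by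
  \<open>cayley_weight\<close>, which has no zero there.\<close>

lemma Hr_disc_A:
  assumes op: "open V" and VU: "V \<subseteq> UHP" and F: "F \<in> Hr r V"
  obtains A where "A holomorphic_on cnj ` cayley ` V"
    "\<And>z. z \<in> V \<Longrightarrow> dzbar F z = of_real (Im z) powr (- r) * (cayley_weight r (cnj (cayley z)) * A (cnj (cayley z)))"
proof -
  obtain B where B: "B holomorphic_on cnj ` V" "\<And>z. z \<in> V \<Longrightarrow> dzbar F z = of_real (Im z) powr (- r) * B (cnj z)"
    using Hr_dzbar_antihol[OF op VU F] by blast
  define A where "A v = B (cayley_conj_inv v) / cayley_weight r v" for v
  have vb: "norm v < 1" if "v \<in> cnj ` cayley ` V" for v
    using that VU cayley_in_disc by auto
  have ic: "cayley_conj_inv (cnj (cayley z)) = cnj z" if "z \<in> V" for z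
    using cayley_inv_cayley[of z] UHP_neq(1)[of z] that VU by (simp flip: cnj_cayley_inv add: subset_iff)
  have h: "cayley_conj_inv holomorphic_on cnj ` cayley ` V"
    by (rule holomorphic_on_subset[OF cayley_conj_inv_hol]) (use vb in force)
  have "(B \<circ> cayley_conj_inv) holomorphic_on cnj ` cayley ` V"
    by (rule holomorphic_on_compose[OF h]) (use B ic in \<open>simp add: image_image\<close>)
  then have "A holomorphic_on cnj ` cayley ` V"
    unfolding A_def o_def
    by (rule holomorphic_on_divide)
      (use cayley_weight_nonzero vb in \<open>auto simp: cayley_weight_def intro!: holomorphic_intros one_minus_not_nonpos\<close>)
  moreover have "dzbar F z = of_real (Im z) powr (- r) * (cayley_weight r (cnj (cayley z)) * A (cnj (cayley z)))" if z: "z \<in> V" for z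
    using B(2)[OF z] ic[OF z] cayley_weight_nonzero[of "cnj (cayley z)" r] vb[of "cnj (cayley z)"] z by (simp add: A_def)
  ultimately show ?thesis using that by blast
qed

lemma C2_on_C1: "C2_on V F \<Longrightarrow> C1_on V F" by (simp add: C2_on_def)

text \<open>Equal derivatives in conj z leave a holomorphic difference; dividing it by (1-w)^r puts
  it in disc form.\<close>

lemma Hr_disc_diff:
  assumes op: "open V" and VU: "V \<subseteq> UHP" and F: "C1_on V F" and G: "C1_on V G"
    and eq: "\<And>z. z \<in> V \<Longrightarrow> dzbar F z = dzbar G z"
  obtains X where "X holomorphic_on cayley ` V" "\<And>z. z \<in> V \<Longrightarrow> F z = G z + (1 - cayley z) powr r * X (cayley z)"
proof -
  have d: "(\<lambda>z. F z - G z) holomorphic_on V"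
    by (rule C1_on_same_dzbar_holomorphic[OF op F G eq])
  define X where "X w = (F (cayley_inv w) - G (cayley_inv w)) * (1 - w) powr (- r)" for w
  have wb: "norm w < 1" if "w \<in> cayley ` V" for w using that VU cayley_in_disc by auto
  have ic: "cayley_inv (cayley z) = z" if "z \<in> V" for z
    using cayley_inv_cayley[of z] UHP_neq(1)[of z] that VU by auto
  have h: "cayley_inv holomorphic_on cayley ` V"
    by (rule holomorphic_on_subset[OF cayley_inv_hol]) (use wb in force)
  have "((\<lambda>z. F z - G z) \<circ> cayley_inv) holomorphic_on cayley ` V"
    by (rule holomorphic_on_compose[OF h]) (use d ic in \<open>simp add: image_image\<close>)
  then have "X holomorphic_on cayley ` V"
    unfolding X_def o_def
    by (rule holomorphic_on_mult) (use wb in \<open>auto intro!: holomorphic_intros one_minus_not_nonpos\<close>)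
  moreover have "F z = G z + (1 - cayley z) powr r * X (cayley z)" if z: "z \<in> V" for z
  proof -
    have "1 - cayley z \<noteq> 0" using wb[of "cayley z"] z by auto
    then have "(1 - cayley z) powr r * (1 - cayley z) powr (- r) = 1" by (simp add: powr_minus)
    moreover have "(1 - cayley z) powr r * X (cayley z) = (F z - G z) * ((1 - cayley z) powr r * (1 - cayley z) powr (- r))"
      using ic[OF z] by (simp add: X_def mult_ac)
    ultimately show ?thesis by simp
  qed
  ultimately show ?thesis using that by blast
qed

lemma Hr_mono: "F \<in> Hr r U \<Longrightarrow> V \<subseteq> U \<Longrightarrow> F \<in> Hr r V"
  unfolding Hr_def C2_on_def C1_on_def has_pdx_on_def has_pdy_on_def
  using continuous_on_subset by blast

section \<open>Annuli of the disc, seen in the half-plane\<close>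

definition UHP_annulus :: "real \<Rightarrow> complex set" where
  "UHP_annulus \<rho> = {z \<in> UHP. \<rho> < norm (cayley z)}"

lemma UHP_annulus_UHP: "UHP_annulus \<rho> \<subseteq> UHP" by (auto simp: UHP_annulus_def)

text \<open>The radius -1 makes the full disc a special case of the statements on annuli.\<close>

lemma UHP_annulus_neg: "UHP_annulus (-1) = UHP" by (auto simp: UHP_annulus_def intro: less_le_trans[of _ 0])

lemma cayley_UHP_annulus: "cayley ` UHP_annulus \<rho> = {w. \<rho> < norm w \<and> norm w < 1}"
proof safe
  fix w :: complex assume w: "\<rho> < norm w" "norm w < 1"
  then have "w \<noteq> 1" by auto
  then have "w = cayley (cayley_inv w)" by (simp add: cayley_cayley_inv)
  then show "w \<in> cayley ` UHP_annulus \<rho>" using w cayley_inv_in_UHP[OF w(2)] by (auto simp: UHP_annulus_def intro!: image_eqI[of _ _ "cayley_inv w"])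
qed (use cayley_in_disc in \<open>auto simp: UHP_annulus_def\<close>)

lemma cnj_cayley_UHP_annulus: "cnj ` cayley ` UHP_annulus \<rho> = {w. \<rho> < norm w \<and> norm w < 1}"
  unfolding cayley_UHP_annulus by (force simp: image_iff intro: exI[of _ "cnj _"])

lemma open_UHP_annulus: "open (UHP_annulus \<rho>)"
proof -
  have "continuous_on UHP (\<lambda>z. norm (cayley z))"
    by (intro continuous_intros holomorphic_on_imp_continuous_on holomorphic_on_subset[OF cayley_hol])
      (use UHP_neq(1) in \<open>auto simp: UHP_def\<close>)
  from continuous_open_preimage[OF this open_UHP, of "{\<rho><..}"]
  show ?thesis by (simp add: UHP_annulus_def Int_def vimage_def)
qed

section \<open>Existence of the decomposition\<close>

lemma conv_on_mono: "conv_on R a \<Longrightarrow> R' \<le> R \<Longrightarrow> conv_on R' a"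
  by (auto simp: conv_on_def)

lemma conv_on_0: "conv_on R (\<lambda>_. 0)"
  by (simp add: conv_on_def)

lemma powser_holomorphic:
  fixes a :: "nat \<Rightarrow> complex"
  assumes "conv_on R a"
  shows "(\<lambda>z. \<Sum>n. a n * z ^ n) holomorphic_on ball 0 R"
  unfolding holomorphic_on_open[OF open_ball]
proof
  fix z :: complex assume "z \<in> ball 0 R"
  then have z: "norm z < R" by simp
  obtain D where "((\<lambda>z. \<Sum>n. a n * z ^ n) has_field_derivative D) (at z)"
    by (rule powser_has_derivative[OF conv_onD[OF assms] z])
  then show "\<exists>D. ((\<lambda>z. \<Sum>n. a n * z ^ n) has_field_derivative D) (at z)" by blast
qed

text \<open>The part of the closed upper half-plane outside U is compact and, as U contains the real
  line, lies in the open half-plane; hence |w| has a maximum below 1 on it.\<close>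

lemma bnbhd_contains_UHP_annulus:
  assumes U: "bnbhd U"
  obtains \<rho> where "0 < \<rho>" "\<rho> < 1" "UHP_annulus \<rho> \<subseteq> U"
proof -
  obtain R where R: "\<And>z. norm z > R \<Longrightarrow> z \<in> U" and opU: "open U" and re: "\<And>x::real. of_real x \<in> U"
    using U unfolding bnbhd_def by blast
  define K where "K = {z. Im z \<ge> 0} - U"
  have "closed K" unfolding K_def
    by (intro closed_Diff opU closed_Collect_le continuous_intros)
  moreover have "bounded K" unfolding bounded_iff K_def using R by (meson DiffD2 not_le)
  ultimately have "compact K" by (simp add: compact_eq_bounded_closed)
  have KU: "z \<in> UHP" if "z \<in> K" for z
  proof -
    have "Im z \<noteq> 0"
    proof
      assume "Im z = 0"
      then have "z = of_real (Re z)" by (simp add: complex_eq_iff)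
      then show False using re[of "Re z"] that by (simp add: K_def)
    qed
    then show ?thesis using that by (simp add: K_def UHP_def)
  qed
  show ?thesis
  proof (cases "K = {}")
    case True
    then have "UHP_annulus (1/2) \<subseteq> U" by (auto simp: K_def UHP_annulus_def UHP_def)
    then show ?thesis using that[of "1/2"] by simp
  next
    case False
    have "- \<i> \<notin> UHP" by (simp add: UHP_def)
    then have "K \<subseteq> - {- \<i>}" using KU by blast
    then have "continuous_on K (\<lambda>z. norm (cayley z))"
      by (intro continuous_intros holomorphic_on_imp_continuous_on holomorphic_on_subset[OF cayley_hol])
    from continuous_attains_sup[OF \<open>compact K\<close> False this]
    obtain z0 where z0: "z0 \<in> K" "\<And>z. z \<in> K \<Longrightarrow> norm (cayley z) \<le> norm (cayley z0)" by blast
    \<comment> \<open>The maximum with 1/2 keeps the radius positive when \<open>K\<close> consists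
      of i alone.\<close>
    define \<rho> where "\<rho> = max (1/2) (norm (cayley z0))"
    have "0 < \<rho>" "\<rho> < 1" using cayley_in_disc[OF KU[OF z0(1)]] by (auto simp: \<rho>_def)
    moreover have "UHP_annulus \<rho> \<subseteq> U"
    proof
      fix z assume z: "z \<in> UHP_annulus \<rho>"
      show "z \<in> U"
      proof (rule ccontr)
        assume "z \<notin> U"
        then have "z \<in> K" using z by (auto simp: K_def UHP_annulus_def UHP_def)
        then show False using z0(2)[of z] z by (auto simp: \<rho>_def UHP_annulus_def)
      qed
    qed
    ultimately show ?thesis using that by blast
  qed
qed

text \<open>Pullback of \<open>circle_nbhd c\<close> along v = conj w. It reaches across the real
  line, as the continuation of boundary germs demands; the pole -i of the transform is left
  out.\<close>

definition boundary_nbhd :: "real \<Rightarrow> complex set" where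
  "boundary_nbhd c = {z. z \<noteq> - \<i> \<and> (cayley z, cnj (cayley z)) \<in> circle_nbhd c}"

lemma tendsto_cayley_at_infinity: "(cayley \<longlongrightarrow> 1) at_infinity"
proof -
  have "filterlim (\<lambda>z. z + \<i>) at_infinity at_infinity"
    by (rule tendsto_add_filterlim_at_infinity'[OF filterlim_ident tendsto_const])
  then have "((\<lambda>z. 2 * \<i> / (z + \<i>)) \<longlongrightarrow> 0) at_infinity"
    by (rule tendsto_divide_0[OF tendsto_const])
  then have "((\<lambda>z. 1 - 2 * \<i> / (z + \<i>)) \<longlongrightarrow> 1 - 0) at_infinity"
    by (intro tendsto_intros)
  then have "((\<lambda>z. 1 - 2 * \<i> / (z + \<i>)) \<longlongrightarrow> 1) at_infinity" by simp
  moreover have "\<forall>\<^sub>F z in at_infinity. 1 - 2 * \<i> / (z + \<i>) = cayley z"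
    unfolding eventually_at_infinity
  proof (intro exI allI impI)
    fix z :: complex assume "2 \<le> norm z"
    then have "z + \<i> \<noteq> 0" by (auto simp: add_eq_0_iff2)
    from one_minus_cayley[OF this, symmetric] show "1 - 2 * \<i> / (z + \<i>) = cayley z" by simp
  qed
  ultimately show ?thesis by (rule Lim_transform_eventually)
qed

text \<open>Real points have |w| = 1, and w tends to 1 as z tends to infinity; the circle, including
  (1, 1), lies in the open set \<open>circle_nbhd c\<close>.\<close>

lemma bnbhd_boundary_nbhd:
  assumes c: "0 < c" "c < 1"
  shows "bnbhd (boundary_nbhd c)"
  unfolding bnbhd_def
proof (intro conjI allI)
  have "continuous_on (- {- \<i>}) (\<lambda>z. (cayley z, cnj (cayley z)))"
    by (intro continuous_intros holomorphic_on_imp_continuous_on[OF cayley_hol])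
  from continuous_open_preimage[OF this open_Compl[OF closed_singleton] open_circle_nbhd]
  have "open (- {- \<i>} \<inter> (\<lambda>z. (cayley z, cnj (cayley z))) -` circle_nbhd c)" by simp
  then show "open (boundary_nbhd c)" by (simp add: boundary_nbhd_def vimage_def Int_def)
  show "complex_of_real x \<in> boundary_nbhd c" for x
  proof -
    have n: "of_real x - \<i> \<noteq> 0" "of_real x + \<i> \<noteq> 0" by (auto simp: complex_eq_iff)
    then have "cayley (of_real x) * cnj (cayley (of_real x)) = 1"
      by (simp add: cayley_def)
    moreover from this have "norm (cayley (of_real x)) = 1"
      by (metis complex_mod_mult_cnj norm_ge_zero norm_one power2_eq_1_iff le_minus_one_simps(3))
    ultimately show ?thesis using c n by (auto simp: boundary_nbhd_def circle_nbhd_def add_eq_0_iff2)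
  qed
  have "(1, 1) \<in> circle_nbhd c" using c by (simp add: circle_nbhd_def)
  moreover have "((\<lambda>z. (cayley z, cnj (cayley z))) \<longlongrightarrow> (1, cnj 1)) at_infinity"
    by (intro tendsto_Pair tendsto_cayley_at_infinity tendsto_cnj)
  ultimately have "\<forall>\<^sub>F z in at_infinity. (cayley z, cnj (cayley z)) \<in> circle_nbhd c"
    using topological_tendstoD[OF _ open_circle_nbhd] by fastforce
  then obtain R where R: "\<And>z. norm z \<ge> R \<Longrightarrow> (cayley z, cnj (cayley z)) \<in> circle_nbhd c"
    unfolding eventually_at_infinity by blast
  show "\<exists>R. \<forall>z. norm z > R \<longrightarrow> z \<in> boundary_nbhd c"
    \<comment> \<open>The bound 1 excludes z = -i.\<close>
    by (rule exI[of _ "max R 1"]) (use R in \<open>auto simp: boundary_nbhd_def\<close>)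
qed

text \<open>For v = conj w inside the disc, the distance of wv from 1 is 1 - |w|^2; the last
  condition then reads |w|^2 > c and implies the others.\<close>

lemma diag_circle_nbhd_iff:
  assumes c: "0 < c" "c < 1" and w: "norm w < 1"
  shows "(w, cnj w) \<in> circle_nbhd c \<longleftrightarrow> sqrt c < norm w"
proof -
  have "w * cnj w - 1 = of_real ((norm w)^2 - 1)" by (simp add: complex_norm_square[symmetric])
  then have n: "norm (w * cnj w - 1) = \<bar>(norm w)^2 - 1\<bar>" by (simp only: norm_of_real)
  have "(norm w)^2 < 1" using w by (simp add: power_less_one_iff abs_square_less_1)
  then have n': "norm (w * cnj w - 1) = 1 - (norm w)^2" using n by simp
  have "sqrt c < norm w \<longleftrightarrow> c < (norm w)^2"
    using c by (metis norm_ge_zero real_sqrt_abs abs_of_nonneg real_sqrt_less_iff)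
  moreover have "c < norm w" if "c < (norm w)^2"
    using that w by (smt (verit) mult_left_le norm_ge_zero power2_eq_square)
  moreover have "norm w < 1 / c" using w c by (smt (verit) less_divide_eq_1_pos)
  ultimately show ?thesis unfolding circle_nbhd_def using n' by auto
qed

lemma boundary_nbhd_UHP: "0 < c \<Longrightarrow> c < 1 \<Longrightarrow> boundary_nbhd c \<inter> UHP = UHP_annulus (sqrt c)"
  using diag_circle_nbhd_iff cayley_in_disc UHP_neq(1) by (auto simp: boundary_nbhd_def UHP_annulus_def add_eq_0_iff2)

text \<open>In terms of the Q_n this is the sum of b_m Q_(-m-1) minus the sum of \<alpha>_k Q_k. The
  factor (1-wv)^(1-r) / w is f_r without (1-w)^r.\<close>

definition boundary_part :: "complex \<Rightarrow> (nat \<Rightarrow> complex) \<Rightarrow> (nat \<Rightarrow> complex) \<Rightarrow> complex \<times> complex \<Rightarrow> complex" where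
  "boundary_part r b \<alpha> p = - ((1 - fst p * snd p) powr (1 - r) / fst p) * boundary_series r b \<alpha> p"

text \<open>The restriction makes the principal branch of (1-wv)^(1-r) holomorphic. For v = conj w
  it selects the points inside the unit circle.\<close>

definition circle_nbhd_inner :: "real \<Rightarrow> (complex \<times> complex) set" where
  "circle_nbhd_inner c = circle_nbhd c \<inter> {p. Re (1 - fst p * snd p) > 0}"

lemma open_circle_nbhd_inner: "open (circle_nbhd_inner c)"
  unfolding circle_nbhd_inner_def by (intro open_Int open_circle_nbhd open_Collect_less continuous_intros)

lemma diag_circle_nbhd_inner:
  assumes "0 < c" "c < 1" "sqrt c < norm w" "norm w < 1"
  shows "(w, cnj w) \<in> circle_nbhd_inner c"
proof -
  have "norm (w * cnj w) < 1" using prod_norm_lt_1[of w "cnj w"] assms by simp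
  then have "Re (1 - w * cnj w) > 0" by (rule Re_one_minus_pos)
  then show ?thesis using diag_circle_nbhd_iff[of c w] assms by (simp add: circle_nbhd_inner_def)
qed

text \<open>The product rule meets \<open>boundary_series_ode\<close>: the derivative of the power
  supplies the term with (1-r) w, that of the series the term with wv - 1.\<close>

lemma
  assumes r: "\<And>j. of_nat j + 1 - r \<noteq> 0"
    and c: "0 < c" "c < 1" "1 / c^2 \<le> R"
    and b: "conv_on R b"
    and \<alpha>: "conv_on R \<alpha>"
  shows hol2_boundary_part: "hol2 (circle_nbhd_inner c) (boundary_part r b \<alpha>)"
    and boundary_part_d2: "\<And>w v. (w, v) \<in> circle_nbhd_inner c \<Longrightarrow> d2 (boundary_part r b \<alpha>) (w, v) =
       (1 - w * v) powr (- r) * ((\<Sum>m. b m * (1 / v) ^ Suc m) - (\<Sum>k. \<alpha> k * v ^ k))"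
proof -
  note D = circle_nbhd_D[OF r c b \<alpha>]
  note hT = hol2_boundary_series[OF r c b \<alpha>]
  have np: "1 - fst p * snd p \<notin> \<real>\<^sub>\<le>\<^sub>0" if "p \<in> circle_nbhd_inner c" for p
    using that by (auto simp: circle_nbhd_inner_def complex_nonpos_Reals_iff)
  have sub: "circle_nbhd_inner c \<subseteq> circle_nbhd c" by (auto simp: circle_nbhd_inner_def)
  show "hol2 (circle_nbhd_inner c) (boundary_part r b \<alpha>)"
    unfolding boundary_part_def[abs_def]
    by (intro hol2_mult hol2_uminus hol2_divide hol2_powr hol2_diff hol2_const hol2_fst hol2_snd hol2_subset[OF hT sub] np)
      (use D sub in auto)
  show "d2 (boundary_part r b \<alpha>) (w, v) = (1 - w * v) powr (- r) * ((\<Sum>m. b m * (1 / v) ^ Suc m) - (\<Sum>k. \<alpha> k * v ^ k))"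
    if wv: "(w, v) \<in> circle_nbhd_inner c" for w v
  proof -
    have T: "(w, v) \<in> circle_nbhd c" using wv sub by auto
    have w0: "w \<noteq> 0" using D[OF T] by simp
    have s: "1 - w * v \<notin> \<real>\<^sub>\<le>\<^sub>0" "1 - w * v \<noteq> 0" using np[OF wv] by auto
    define D2 where "D2 = d2 (boundary_series r b \<alpha>) (w, v)"
    have p: "((\<lambda>y. (1 - w * y) powr (1 - r)) has_field_derivative - w * (1 - r) * (1 - w * v) powr (- r)) (at v)"
      using s by (auto intro!: derivative_eq_intros simp: algebra_simps)
    have pp: "((\<lambda>y. - ((1 - w * y) powr (1 - r) / w)) has_field_derivative - (- w * (1 - r) * (1 - w * v) powr (- r) / w)) (at v)"
      by (intro DERIV_minus DERIV_cdivide p)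
    have "((\<lambda>y. - ((1 - w * y) powr (1 - r) / w) * boundary_series r b \<alpha> (w, y)) has_field_derivative
        - (- w * (1 - r) * (1 - w * v) powr (- r) / w) * boundary_series r b \<alpha> (w, v) + D2 * - ((1 - w * v) powr (1 - r) / w)) (at v)"
      unfolding D2_def by (rule DERIV_mult[OF pp hol2_d2_has[OF hT T]])
    then have "d2 (boundary_part r b \<alpha>) (w, v) =
        - (- w * (1 - r) * (1 - w * v) powr (- r) / w) * boundary_series r b \<alpha> (w, v) + D2 * - ((1 - w * v) powr (1 - r) / w)"
      by (intro d2_eqI) (simp add: boundary_part_def)
    also have "(1 - w * v) powr (1 - r) = (1 - w * v) * (1 - w * v) powr (- r)"
      using s by (simp add: powr_diff powr_minus field_simps)
    also have "- (- w * (1 - r) * (1 - w * v) powr (- r) / w) * boundary_series r b \<alpha> (w, v)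
        + D2 * - ((1 - w * v) * (1 - w * v) powr (- r) / w)
       = (1 - w * v) powr (- r) / w * ((w * v - 1) * D2 + (1 - r) * w * boundary_series r b \<alpha> (w, v))"
      by (simp add: algebra_simps add_divide_distrib diff_divide_distrib)
    also have "(w * v - 1) * D2 + (1 - r) * w * boundary_series r b \<alpha> (w, v)
        = w * ((\<Sum>m. b m * (1 / v) ^ Suc m) - (\<Sum>k. \<alpha> k * v ^ k))"
      unfolding D2_def by (rule boundary_series_ode[OF r c b \<alpha> T])
    finally show ?thesis using w0 by simp
  qed
qed

lemma Laurent_part_holomorphic:
  assumes R: "1 < R" and b: "conv_on R b"
  shows "(\<lambda>v. \<Sum>m. b m * (1 / v) ^ Suc m) holomorphic_on {v. 1 / R < norm v}"
proof -
  have i: "norm (1 / v) < R" "v \<noteq> 0" if "v \<in> {v. 1 / R < norm v}" for v :: complex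
  proof -
    have "v \<noteq> 0" using that R by (auto simp: not_less)
    then show "v \<noteq> 0" "norm (1 / v) < R" using that R by (auto simp: norm_divide field_simps)
  qed
  have "((\<lambda>z. \<Sum>n. b n * z ^ n) \<circ> (\<lambda>v. 1 / v)) holomorphic_on {v. 1 / R < norm v}"
    by (rule holomorphic_on_compose_gen[OF _ powser_holomorphic[OF b]])
      (use i in \<open>auto intro!: holomorphic_intros simp: norm_divide\<close>)
  then have "(\<lambda>v. (1 / v) * (\<Sum>n. b n * (1 / v) ^ n)) holomorphic_on {v. 1 / R < norm v}"
    unfolding o_def using i by (intro holomorphic_intros) auto
  then show ?thesis
  proof (rule holomorphic_transform)
    fix v :: complex assume "v \<in> {v. 1 / R < norm v}"
    from suminf_mult[OF conv_onD[OF b i(1)[OF this]], of "1 / v"]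
    show "(1 / v) * (\<Sum>n. b n * (1 / v) ^ n) = (\<Sum>m. b m * (1 / v) ^ Suc m)"
      by (simp add: mult_ac)
  qed
qed

text \<open>Stripped of the power, the series is holomorphic on a full neighbourhood of the circle,
  so composing with the Cayley transforms is analytic on both sides of the real line. Infinity is
  treated in the chart 1/z.\<close>

lemma real_analytic_boundary_series:
  assumes r: "\<And>j. of_nat j + 1 - r \<noteq> 0"
    and c: "0 < c" "c < 1" "1 / c^2 \<le> R"
    and b: "conv_on R b"
    and \<alpha>: "conv_on R \<alpha>"
  shows "real_analytic_P1 (boundary_nbhd c) (\<lambda>z. - boundary_series r b \<alpha> (cayley z, cnj (cayley z)))"
proof -
  note hT = hol2_uminus[OF hol2_boundary_series[OF r c b \<alpha>]]
  have gen: "real_analytic_at (\<lambda>z. - boundary_series r b \<alpha> (f z, g (cnj z))) z0"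
    if f: "f holomorphic_on S" "open S" and g: "g holomorphic_on S'" "open S'"
      and z0: "z0 \<in> S" "cnj z0 \<in> S'" "(f z0, g (cnj z0)) \<in> circle_nbhd c" for f g S S' z0
  proof -
    have hf: "hol2 (S \<times> S') (\<lambda>p. f (fst p))" and hg: "hol2 (S \<times> S') (\<lambda>p. g (snd p))"
      by (rule hol2_comp1[OF f hol2_fst], force, rule hol2_comp1[OF g hol2_snd], force)
    define \<Omega> where "\<Omega> = (S \<times> S') \<inter> (\<lambda>p. (f (fst p), g (snd p))) -` circle_nbhd c"
    have op: "open \<Omega>" unfolding \<Omega>_def
      by (intro continuous_open_preimage continuous_on_Pair hol2_cont hf hg open_Times f g open_circle_nbhd)
    have "hol2 \<Omega> (\<lambda>p. - boundary_series r b \<alpha> (f (fst p), g (snd p)))"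
      by (rule hol2_compose2[OF open_circle_nbhd hT hol2_subset[OF hf] hol2_subset[OF hg]]) (auto simp: \<Omega>_def)
    from real_analytic_hol2[OF op this, of z0] show ?thesis using z0 by (simp add: \<Omega>_def)
  qed
  have "real_analytic_at (\<lambda>z. - boundary_series r b \<alpha> (cayley z, cnj (cayley z))) z" if z: "z \<in> boundary_nbhd c" for z
    unfolding cnj_cayley
    by (rule gen[OF cayley_hol _ cayley_conj_hol])
      (use z in \<open>auto simp: boundary_nbhd_def cnj_cayley[symmetric] complex_eq_iff\<close>)
  moreover have "real_analytic_at (\<lambda>w. if w = 0 then - boundary_series r b \<alpha> (1, 1)
      else - boundary_series r b \<alpha> (cayley (1 / w), cnj (cayley (1 / w)))) 0"
  proof -
    \<comment> \<open>The two transforms in the chart at infinity, simplified so that they are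
      defined at w = 0, with value 1.\<close>
    define f where "f w = (1 - \<i> * w) / (1 + \<i> * w)" for w
    define g where "g w = (1 + \<i> * w) / (1 - \<i> * w)" for w
    have fh: "f holomorphic_on - {\<i>}" unfolding f_def
      by (intro holomorphic_intros) (auto simp: complex_eq_iff)
    have gh: "g holomorphic_on - {- \<i>}" unfolding g_def
      by (intro holomorphic_intros) (auto simp: complex_eq_iff)
    have "real_analytic_at (\<lambda>z. - boundary_series r b \<alpha> (f z, g (cnj z))) 0"
      by (rule gen[OF fh _ gh]) (use c in \<open>auto simp: f_def g_def circle_nbhd_def\<close>)
    moreover have "(if w = 0 then - boundary_series r b \<alpha> (1, 1) else - boundary_series r b \<alpha> (cayley (1 / w), cnj (cayley (1 / w))))
      = - boundary_series r b \<alpha> (f w, g (cnj w))" for w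
    proof (cases "w = 0")
      case True
      then show ?thesis by (simp add: f_def g_def)
    next
      case False
      have "cayley (1 / w) = f w"
      proof -
        have "1 / w - \<i> = (1 - \<i> * w) / w" "1 / w + \<i> = (1 + \<i> * w) / w" using False by (simp_all add: field_simps)
        then show ?thesis using False by (simp add: cayley_def f_def)
      qed
      moreover have "cnj (f w) = g (cnj w)" by (simp add: f_def g_def)
      ultimately show ?thesis using False by simp
    qed
    ultimately show ?thesis by simp
  qed
  ultimately show ?thesis unfolding real_analytic_P1_def by blast
qed

text \<open>The left-hand side is the sum of \<alpha>_k (P_k - Q_k); dividing the connection formula
  by w^(k+1) evaluates each term. In this way negative powers of w, singular at the centre of the
  disc, are distributed over the two summands.\<close>

lemma interior_series_boundary_series_connection:
  assumes r: "\<And>j. of_nat j + 1 - r \<noteq> 0"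
    and c: "0 < c" "c < 1" "1 / c^2 \<le> R" "1 < R"
    and b: "conv_on R b"
    and \<alpha>: "conv_on R \<alpha>"
    and w: "sqrt c < norm w" "norm w < 1"
  shows "interior_series r \<alpha> (w, cnj w) + (1 - w * cnj w) powr (1 - r) / w * (\<Sum>k. nonneg_term r \<alpha> k (w, cnj w))
    = (\<Sum>k. \<alpha> k * connection_coeff r k * (1 / w) ^ Suc k)"
proof -
  have T: "(w, cnj w) \<in> circle_nbhd c" using diag_circle_nbhd_iff[OF c(1,2) w(2)] w(1) by simp
  note D = circle_nbhd_D[OF r c(1-3) b \<alpha> T]
  define s where "s = w * cnj w"
  have s: "norm s < 1" "norm (s - 1) < 1"
    using prod_norm_lt_1[of w "cnj w"] w D by (auto simp: s_def)
  have "(\<lambda>k. \<alpha> k * (cnj w ^ Suc k * beta_ser r k s) + (1 - s) powr (1 - r) / w * nonneg_term r \<alpha> k (w, cnj w)) sums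
     (interior_series r \<alpha> (w, cnj w) + (1 - s) powr (1 - r) / w * (\<Sum>k. nonneg_term r \<alpha> k (w, cnj w)))"
    using interior_series_sums[OF conv_on_mono[OF \<alpha> less_imp_le[OF c(4)]], of "(w, cnj w)" r] w boundary_series_sums(2)[OF r c(1-3) b \<alpha> T]
    by (intro sums_add sums_mult) (auto simp: s_def)
  also have "(\<lambda>k. \<alpha> k * (cnj w ^ Suc k * beta_ser r k s) + (1 - s) powr (1 - r) / w * nonneg_term r \<alpha> k (w, cnj w))
    = (\<lambda>k. \<alpha> k * connection_coeff r k * (1 / w) ^ Suc k)"
  proof
    fix k
    have w0: "w \<noteq> 0" using D by simp
    have "cnj w ^ Suc k = s ^ Suc k * (1 / w) ^ Suc k" using w0 by (simp add: s_def flip: power_mult_distrib)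
    moreover have "nonneg_term r \<alpha> k (w, cnj w) / w = \<alpha> k * tau_ser r (of_nat k) s * (1 / w) ^ Suc k"
      by (simp add: nonneg_term_def s_def power_one_over divide_inverse power_inverse mult_ac)
    moreover have "(1 - s) powr (1 - r) / w * nonneg_term r \<alpha> k (w, cnj w) = (1 - s) powr (1 - r) * (nonneg_term r \<alpha> k (w, cnj w) / w)"
      by simp
    ultimately have "\<alpha> k * (cnj w ^ Suc k * beta_ser r k s) + (1 - s) powr (1 - r) / w * nonneg_term r \<alpha> k (w, cnj w)
      = \<alpha> k * (s ^ Suc k * beta_ser r k s + (1 - s) powr (1 - r) * tau_ser r (of_nat k) s) * (1 / w) ^ Suc k"
      by (simp add: algebra_simps del: power_Suc)
    then show "\<alpha> k * (cnj w ^ Suc k * beta_ser r k s) + (1 - s) powr (1 - r) / w * nonneg_term r \<alpha> k (w, cnj w)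
      = \<alpha> k * connection_coeff r k * (1 / w) ^ Suc k"
      by (simp only: beta_ser_tau_ser_connection[OF r s])
  qed
  finally show ?thesis by (simp add: sums_iff s_def del: power_Suc)
qed


text \<open>A geometric margin between |z| and R absorbs the subexponential growth of 1/C_k.\<close>

lemma conv_on_divide_connection_coeff:
  assumes r: "\<And>j. of_nat j + 1 - r \<noteq> 0" and d: "conv_on R d"
  shows "conv_on R (\<lambda>k. d k / connection_coeff r k)"
  unfolding conv_on_def
proof (intro allI impI)
  fix z :: complex assume z: "norm z < R"
  then obtain x where x: "norm z < x" "x < R" using dense by blast
  have x0: "x > 0" using x(1) norm_ge_zero[of z] by linarith
  obtain t where t: "norm z / x < t" "t < 1" using dense[of "norm z / x" 1] x x0 by auto
  have t0: "t > 0" using t(1) x0 norm_ge_zero[of z] by (meson divide_nonneg_pos le_less_trans)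
  have "summable (\<lambda>k. d k * of_real x ^ k)" by (rule conv_onD[OF d]) (use x x0 in auto)
  then have "Bseq (\<lambda>k. d k * of_real x ^ k)"
    using summable_LIMSEQ_zero convergent_def Bseq_eq_bounded convergent_imp_Bseq by blast
  then obtain M where M: "M > 0" "\<And>k. norm (d k * of_real x ^ k) \<le> M" by (auto elim: BseqE)
  show "summable (\<lambda>k. d k / connection_coeff r k * z ^ k)"
  proof (rule summable_comparison_test[OF _ summable_mult[OF connection_coeff_summable[OF r t0 t(2)], of M]])
    have "norm (d k / connection_coeff r k * z ^ k) \<le> M * (t ^ k / norm (connection_coeff r k))" for k
    proof -
      have "norm z ^ k \<le> (x * t) ^ k" using t x0 by (intro power_mono) (auto simp: field_simps)
      then have "norm (d k) * norm z ^ k \<le> norm (d k) * (x * t) ^ k" by (rule mult_left_mono) simp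
      also have "\<dots> = norm (d k * of_real x ^ k) * t ^ k" using x0 by (simp add: norm_mult norm_power power_mult_distrib)
      also have "\<dots> \<le> M * t ^ k" using M t0 by (intro mult_right_mono) auto
      finally have "norm (d k) * norm z ^ k / norm (connection_coeff r k) \<le> M * t ^ k / norm (connection_coeff r k)"
        by (rule divide_right_mono) simp
      then show ?thesis by (simp add: norm_mult norm_divide norm_power)
    qed
    then show "\<exists>N. \<forall>k\<ge>N. norm (d k / connection_coeff r k * z ^ k) \<le> M * (t ^ k / norm (connection_coeff r k))" by blast
  qed
qed

lemma interior_series_add:
  assumes "conv_on 1 a" "conv_on 1 b" "norm w < 1" "norm v < 1"
  shows "interior_series r (\<lambda>k. a k + b k) (w, v) = interior_series r a (w, v) + interior_series r b (w, v)"
proof -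
  have m: "(w, v) \<in> ball 0 1 \<times> ball 0 1" using assms by auto
  from sums_add[OF interior_series_sums[OF assms(1) m] interior_series_sums[OF assms(2) m], of r r]
  show ?thesis by (simp add: interior_series_def sums_iff distrib_right)
qed

lemma conv_on_add: "conv_on R a \<Longrightarrow> conv_on R b \<Longrightarrow> conv_on R (\<lambda>k. a k + b k)"
  unfolding conv_on_def by (auto simp: distrib_right intro: summable_add)

text \<open>The general r-harmonic function on the half-plane: \<open>e\<close> holds the
  coefficients of the P_k, \<open>x\<close> those of the holomorphic powers.\<close>

definition interior_solution :: "complex \<Rightarrow> (nat \<Rightarrow> complex) \<Rightarrow> (nat \<Rightarrow> complex) \<Rightarrow> complex \<Rightarrow> complex" where
  "interior_solution r e x z = (1 - cayley z) powr r * (interior_series r e (cayley z, cnj (cayley z)) + (\<Sum>k. x k * cayley z ^ k))"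

lemma
  assumes e: "conv_on 1 e" and x: "conv_on 1 x"
  shows interior_solution_Hr: "interior_solution r e x \<in> Hr r UHP"
    and interior_solution_dzbar: "\<And>z. z \<in> UHP \<Longrightarrow> dzbar (interior_solution r e x) z =
      of_real (Im z) powr (- r) * (cayley_weight r (cnj (cayley z)) * (\<Sum>k. e k * cnj (cayley z) ^ k))"
proof -
  define \<Psi> where "\<Psi> p = interior_series r e p + (\<Sum>k. x k * fst p ^ k)" for p
  let ?\<Omega> = "ball (0::complex) 1 \<times> ball (0::complex) 1"
  have op: "open ?\<Omega>" by (simp add: open_Times)
  have hx: "hol2 ?\<Omega> (\<lambda>p. \<Sum>k. x k * fst p ^ k)"
    by (rule hol2_comp1[OF powser_holomorphic[OF x] open_ball hol2_fst]) auto
  have h: "hol2 ?\<Omega> \<Psi>"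
    unfolding \<Psi>_def[abs_def] by (intro hol2_add hol2_interior_series[OF e] hx)
  have d: "d2 \<Psi> (w, v) = (1 - w * v) powr (- r) * (\<Sum>k. e k * v ^ k)" if "norm w < 1" "norm v < 1" for w v
  proof -
    have "((\<lambda>y. interior_series r e (w, y) + (\<Sum>k. x k * w ^ k)) has_field_derivative d2 (interior_series r e) (w, v) + 0) (at v)"
      by (intro DERIV_add DERIV_const hol2_d2_has[OF hol2_interior_series[OF e]]) (use that in auto)
    then show ?thesis using interior_series_d2[OF e that] by (intro d2_eqI) (simp add: \<Psi>_def)
  qed
  have A: "(\<lambda>v. \<Sum>k. e k * v ^ k) holomorphic_on cnj ` cayley ` UHP"
    by (rule holomorphic_on_subset[OF powser_holomorphic[OF e]]) (use cayley_in_disc in auto)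
  note D = Hr_disc_I[OF open_UHP op subset_refl h _ _ A, of "interior_solution r e x" r]
  have 1: "(cayley z, cnj (cayley z)) \<in> ?\<Omega>" if "z \<in> UHP" for z using cayley_in_disc[OF that] by simp
  have 2: "interior_solution r e x z = (1 - cayley z) powr r * \<Psi> (cayley z, cnj (cayley z))" for z
    by (simp add: interior_solution_def \<Psi>_def)
  have 3: "d2 \<Psi> (cayley z, cnj (cayley z)) = (1 - cayley z * cnj (cayley z)) powr (- r) * (\<Sum>k. e k * cnj (cayley z) ^ k)"
    if "z \<in> UHP" for z
    by (rule d) (use cayley_in_disc[OF that] in auto)
  show "interior_solution r e x \<in> Hr r UHP" by (rule D(1)) (use 1 2 3 in auto)
  show "dzbar (interior_solution r e x) z = of_real (Im z) powr (- r) * (cayley_weight r (cnj (cayley z)) * (\<Sum>k. e k * cnj (cayley z) ^ k))"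
    if "z \<in> UHP" for z
    by (rule D(2)) (use 1 2 3 that in auto)
qed

definition boundary_solution :: "complex \<Rightarrow> (nat \<Rightarrow> complex) \<Rightarrow> (nat \<Rightarrow> complex) \<Rightarrow> complex \<Rightarrow> complex" where
  "boundary_solution r b \<alpha> z = (1 - cayley z) powr r * boundary_part r b \<alpha> (cayley z, cnj (cayley z))"

lemma
  assumes r: "\<And>j. of_nat j + 1 - r \<noteq> 0"
    and c: "0 < c" "c < 1" "1 / c^2 \<le> R" "1 < R"
    and b: "conv_on R b" and \<alpha>: "conv_on R \<alpha>"
  shows boundary_solution_Hr: "boundary_solution r b \<alpha> \<in> Hr r (UHP_annulus (sqrt c))"
    and boundary_solution_dzbar: "\<And>z. z \<in> UHP_annulus (sqrt c) \<Longrightarrow> dzbar (boundary_solution r b \<alpha>) z = of_real (Im z) powr (- r) *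
       (cayley_weight r (cnj (cayley z)) * ((\<Sum>m. b m * (1 / cnj (cayley z)) ^ Suc m) - (\<Sum>k. \<alpha> k * cnj (cayley z) ^ k)))"
proof -
  have in1: "(cayley z, cnj (cayley z)) \<in> circle_nbhd_inner c" if "z \<in> UHP_annulus (sqrt c)" for z
    by (rule diag_circle_nbhd_inner[OF c(1,2)]) (use that cayley_in_disc in \<open>auto simp: UHP_annulus_def\<close>)
  have A: "(\<lambda>v. (\<Sum>m. b m * (1 / v) ^ Suc m) - (\<Sum>k. \<alpha> k * v ^ k)) holomorphic_on cnj ` cayley ` UHP_annulus (sqrt c)"
    unfolding cnj_cayley_UHP_annulus
  proof (intro holomorphic_on_diff)
    \<comment> \<open>The negative powers of the datum converge for |v| > 1/R, while the solution
      lives on |v| > sqrt c; this chain compares the radii.\<close>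
    have "1 / R \<le> c^2" using c by (simp add: field_simps)
    also have "c^2 \<le> sqrt c"
    proof (rule real_le_rsqrt)
      have "c ^ 4 \<le> c ^ 1" by (rule power_decreasing) (use c in auto)
      then show "(c^2)^2 \<le> c" by simp
    qed
    finally show "(\<lambda>v. \<Sum>m. b m * (1 / v) ^ Suc m) holomorphic_on {w. sqrt c < norm w \<and> norm w < 1}"
      by (intro holomorphic_on_subset[OF Laurent_part_holomorphic[OF c(4) b]]) auto
    show "(\<lambda>v. \<Sum>k. \<alpha> k * v ^ k) holomorphic_on {w. sqrt c < norm w \<and> norm w < 1}"
      by (rule holomorphic_on_subset[OF powser_holomorphic[OF \<alpha>]]) (use c in auto)
  qed
  note D = Hr_disc_I[OF open_UHP_annulus open_circle_nbhd_inner UHP_annulus_UHP hol2_boundary_part[OF r c(1-3) b \<alpha>] in1 _ A, of "boundary_solution r b \<alpha>"]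
  show "boundary_solution r b \<alpha> \<in> Hr r (UHP_annulus (sqrt c))"
    by (rule D(1)) (auto simp: boundary_solution_def boundary_part_d2[OF r c(1-3) b \<alpha> in1])
  show "dzbar (boundary_solution r b \<alpha>) z = of_real (Im z) powr (- r) *
       (cayley_weight r (cnj (cayley z)) * ((\<Sum>m. b m * (1 / cnj (cayley z)) ^ Suc m) - (\<Sum>k. \<alpha> k * cnj (cayley z) ^ k)))"
    if "z \<in> UHP_annulus (sqrt c)" for z
    by (rule D(2)) (use that in \<open>auto simp: boundary_solution_def boundary_part_d2[OF r c(1-3) b \<alpha> in1]\<close>)
qed

text \<open>Division by f_r cancels (1-w)^r, the power of 1 - |w|^2 and 1/w at once, leaving minus
  the boundary series.\<close>

lemma boundary_solution_Wgerm:
  assumes r: "\<And>j. of_nat j + 1 - r \<noteq> 0"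
    and c: "0 < c" "c < 1" "1 / c^2 \<le> R" "1 < R"
    and b: "conv_on R b" and \<alpha>: "conv_on R \<alpha>"
  shows "Wgerm r (boundary_solution r b \<alpha>)"
proof -
  have bn: "bnbhd (boundary_nbhd c)" by (rule bnbhd_boundary_nbhd[OF c(1,2)])
  have H: "boundary_solution r b \<alpha> \<in> Hr r (boundary_nbhd c \<inter> UHP)"
    unfolding boundary_nbhd_UHP[OF c(1,2)] by (rule boundary_solution_Hr[OF r c b \<alpha>])
  have q: "boundary_solution r b \<alpha> z / fr r z = - boundary_series r b \<alpha> (cayley z, cnj (cayley z))" if z: "z \<in> (boundary_nbhd c \<inter> UHP) - {\<i>}" for z
  proof -
    have zU: "z \<in> UHP" "z \<noteq> \<i>" using z by auto
    have n: "cayley z \<noteq> 0" using zU UHP_neq(1)[OF zU(1)] by (simp add: cayley_def)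
    have n1: "1 - cayley z \<noteq> 0" using cayley_in_disc[OF zU(1)] by auto
    have n2: "1 - cayley z * cnj (cayley z) \<noteq> 0"
      using prod_norm_lt_1[of "cayley z" "cnj (cayley z)"] cayley_in_disc[OF zU(1)] by auto
    show ?thesis
      unfolding fr_disc[OF zU] boundary_solution_def boundary_part_def using n n1 n2 by simp
  qed
  have "Bgerm r (boundary_solution r b \<alpha>)" unfolding Bgerm_def using bn H by blast
  moreover have "germ_eq (boundary_solution r b \<alpha>) (boundary_solution r b \<alpha>)" unfolding germ_eq_def using bn by blast
  ultimately show ?thesis
    unfolding Wgerm_def using bn H q real_analytic_boundary_series[OF r c(1-3) b \<alpha>] by blast
qed

lemma
  assumes op: "open V" and F: "C1_on V F" and G: "C1_on V G"
  shows C1_on_add: "C1_on V (\<lambda>z. F z + G z)"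
    and dzbar_add: "\<And>z. z \<in> V \<Longrightarrow> dzbar (\<lambda>z. F z + G z) z = dzbar F z + dzbar G z"
proof -
  have d: "((\<lambda>z. F z + G z) has_derivative (\<lambda>h. (dz F z + dz G z) * h + (dzbar F z + dzbar G z) * cnj h)) (at z)"
    if "z \<in> V" for z
    using has_derivative_add[OF C1_on_derivative[OF op F that] C1_on_derivative[OF op G that]]
    by (simp add: algebra_simps)
  show "C1_on V (\<lambda>z. F z + G z)"
    by (rule C1_onI[OF d]) (use F G in \<open>auto simp: C1_on_def dz_def dzbar_def intro!: continuous_intros\<close>)
  show "dzbar (\<lambda>z. F z + G z) z = dzbar F z + dzbar G z" if "z \<in> V" for z
    by (subst dzbar_eqI[OF d[OF that]]) (simp add: algebra_simps)
qed

text \<open>Each use of boundary solutions shrinks the annulus from radius \<rho> to its fourth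
  root: coefficients converging up to 1/\<rho> admit c = sqrt \<rho>, and the solution then lives on
  |w| > sqrt c. This happens twice, for the datum and for the holomorphic remainder.\<close>

lemma sum_decomposition_exists:
  assumes r: "\<And>j. of_nat j + 1 - r \<noteq> 0" and F: "Bgerm r F"
  shows "\<exists>G W. G \<in> Hr r UHP \<and> Wgerm r W \<and> germ_eq F (\<lambda>z. G z + W z)"
proof -
  have sq: "0 < sqrt t \<and> sqrt t < 1 \<and> t < sqrt t \<and> 1 / (sqrt t)^2 \<le> 1 / t \<and> 1 < 1 / t"
    if "0 < t" "t < 1" for t :: real
  proof -
    have "t^2 < t" using that by (simp add: power2_eq_square)
    then have "t < sqrt t" by (rule real_less_rsqrt)
    then show ?thesis using that by simp
  qed
  obtain U where U: "bnbhd U" "F \<in> Hr r (U \<inter> UHP)" using F unfolding Bgerm_def by blast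
  obtain \<rho> where \<rho>: "0 < \<rho>" "\<rho> < 1" "UHP_annulus \<rho> \<subseteq> U" using bnbhd_contains_UHP_annulus[OF U(1)] .
  have F0: "F \<in> Hr r (UHP_annulus \<rho>)" by (rule Hr_mono[OF U(2)]) (use \<rho>(3) UHP_annulus_UHP in auto)
  obtain A where A: "A holomorphic_on {w. \<rho> < norm w \<and> norm w < 1}"
    "\<And>z. z \<in> UHP_annulus \<rho> \<Longrightarrow> dzbar F z = of_real (Im z) powr (- r) * (cayley_weight r (cnj (cayley z)) * A (cnj (cayley z)))"
    using Hr_disc_A[OF open_UHP_annulus UHP_annulus_UHP F0] unfolding cnj_cayley_UHP_annulus by blast
  obtain a b where ab: "conv_on 1 a" "conv_on (1 / \<rho>) b"
    "\<And>v. \<rho> < norm v \<Longrightarrow> norm v < 1 \<Longrightarrow> A v = (\<Sum>k. a k * v ^ k) + (\<Sum>k. b k * (1 / v) ^ Suc k)"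
    using Laurent_annulus[OF A(1) \<rho>(1,2)] by blast
  \<comment> \<open>1/c1^2 is exactly the radius 1/\<rho> of \<open>b\<close>, and \<rho>1 is the
    inner radius of the annulus on which the boundary solution lives.\<close>
  define c1 where "c1 = sqrt \<rho>"
  define \<rho>1 where "\<rho>1 = sqrt c1"
  have c1: "0 < c1" "c1 < 1" "1 / c1^2 \<le> 1 / \<rho>" "1 < 1 / \<rho>" "\<rho> < c1"
    using sq[OF \<rho>(1,2)] by (auto simp: c1_def)
  have \<rho>1: "0 < \<rho>1" "\<rho>1 < 1" "c1 < \<rho>1" using sq[OF c1(1,2)] by (auto simp: \<rho>1_def)
  have V1: "UHP_annulus \<rho>1 \<subseteq> UHP_annulus \<rho>" using \<rho>1 c1 by (auto simp: UHP_annulus_def)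
  have F1: "F \<in> Hr r (UHP_annulus \<rho>1)" by (rule Hr_mono[OF F0 V1])
  \<comment> \<open>Nonnegative powers of A are matched by P_k and negative ones by Q_n, so F and F'
    have the same derivative in conj z.\<close>
  define F' where "F' z = interior_solution r a (\<lambda>_. 0) z + boundary_solution r b (\<lambda>_. 0) z" for z
  note hG = Hr_mono[OF interior_solution_Hr[OF ab(1) conv_on_0, of r] UHP_annulus_UHP[of \<rho>1]]
  note hW = boundary_solution_Hr[OF r c1(1-4) ab(2) conv_on_0, folded \<rho>1_def]
  have C1: "C1_on (UHP_annulus \<rho>1) F" "C1_on (UHP_annulus \<rho>1) (interior_solution r a (\<lambda>_. 0))" "C1_on (UHP_annulus \<rho>1) (boundary_solution r b (\<lambda>_. 0))"
    using F1 hG hW by (auto simp: Hr_def C2_on_C1)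
  obtain X where X: "X holomorphic_on {w. \<rho>1 < norm w \<and> norm w < 1}"
    "\<And>z. z \<in> UHP_annulus \<rho>1 \<Longrightarrow> F z = F' z + (1 - cayley z) powr r * X (cayley z)"
  proof -
    have "dzbar F z = dzbar F' z" if z: "z \<in> UHP_annulus \<rho>1" for z
    proof -
      have v: "\<rho> < norm (cnj (cayley z))" "norm (cnj (cayley z)) < 1" and zU: "z \<in> UHP"
        using z V1 cayley_in_disc by (auto simp: UHP_annulus_def)
      have "dzbar F' z = dzbar (interior_solution r a (\<lambda>_. 0)) z + dzbar (boundary_solution r b (\<lambda>_. 0)) z"
        unfolding F'_def[abs_def] by (rule dzbar_add[OF open_UHP_annulus C1(2,3) z])
      also have "\<dots> = dzbar F z"
        unfolding interior_solution_dzbar[OF ab(1) conv_on_0 zU]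
          boundary_solution_dzbar[OF r c1(1-4) ab(2) conv_on_0 z[unfolded \<rho>1_def]] A(2)[OF subsetD[OF V1 z]] ab(3)[OF v]
        by (simp add: algebra_simps del: power_Suc)
      finally show ?thesis by simp
    qed
    then show ?thesis
      using Hr_disc_diff[OF open_UHP_annulus UHP_annulus_UHP C1(1) C1_on_add[OF open_UHP_annulus C1(2,3)], of r] that
      unfolding cayley_UHP_annulus F'_def[abs_def] by blast
  qed
  obtain x d where xd: "conv_on 1 x" "conv_on (1 / \<rho>1) d"
    "\<And>w. \<rho>1 < norm w \<Longrightarrow> norm w < 1 \<Longrightarrow> X w = (\<Sum>k. x k * w ^ k) + (\<Sum>k. d k * (1 / w) ^ Suc k)"
    using Laurent_annulus[OF X(1) \<rho>1(1,2)] by blast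
  \<comment> \<open>With \<alpha>_k C_k = d_k, the negative part of X is the series of \<alpha>_k
    (P_k - Q_k); G absorbs the P-part and W the Q-part.\<close>
  define \<alpha> where "\<alpha> k = d k / connection_coeff r k" for k
  define c where "c = sqrt \<rho>1"
  have c: "0 < c" "c < 1" "1 / c^2 \<le> 1 / \<rho>1" "1 < 1 / \<rho>1" "\<rho>1 < c"
    using sq[OF \<rho>1(1,2)] by (auto simp: c_def)
  have cs: "c < sqrt c" using sq[OF c(1,2)] by auto
  have \<alpha>: "conv_on (1 / \<rho>1) \<alpha>" unfolding \<alpha>_def by (rule conv_on_divide_connection_coeff[OF r xd(2)])
  have b': "conv_on (1 / \<rho>1) b"
    by (rule conv_on_mono[OF ab(2)]) (use \<rho>(1) \<rho>1 c1 in \<open>auto intro!: divide_left_mono\<close>)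
  have \<alpha>1: "conv_on 1 \<alpha>" by (rule conv_on_mono[OF \<alpha>]) (use c in auto)
  define G where "G = interior_solution r (\<lambda>k. a k + \<alpha> k) x"
  define W where "W = boundary_solution r b \<alpha>"
  have "G \<in> Hr r UHP" unfolding G_def by (rule interior_solution_Hr[OF conv_on_add[OF ab(1) \<alpha>1] xd(1)])
  moreover have "Wgerm r W" unfolding W_def by (rule boundary_solution_Wgerm[OF r c(1-4) b' \<alpha>])
  moreover have "germ_eq F (\<lambda>z. G z + W z)"
    unfolding germ_eq_def
  proof (intro exI conjI ballI)
    show "bnbhd (boundary_nbhd c)" by (rule bnbhd_boundary_nbhd[OF c(1,2)])
    fix z assume "z \<in> boundary_nbhd c \<inter> UHP"
    then have z: "z \<in> UHP" "sqrt c < norm (cayley z)" unfolding boundary_nbhd_UHP[OF c(1,2)] by (auto simp: UHP_annulus_def)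
    define w where "w = cayley z"
    have w: "norm w < 1" "sqrt c < norm w" "\<rho>1 < norm w"
      using z cayley_in_disc[OF z(1)] cs c(5) by (auto simp: w_def)
    have w0: "w \<noteq> 0" using w \<rho>1 by auto
    have V: "z \<in> UHP_annulus \<rho>1" using z w by (auto simp: UHP_annulus_def w_def)
    define P where "P = (1 - w) powr r"
    define q where "q = (1 - w * cnj w) powr (1 - r) / w"
    have T1: "(w, cnj w) \<in> circle_nbhd c" using diag_circle_nbhd_iff[OF c(1,2) w(1)] w(2) by simp
    have F'z: "F' z = P * (interior_series r a (w, cnj w) - q * (\<Sum>m. neg_term r b m (w, cnj w)))"
      by (simp add: F'_def interior_solution_def boundary_solution_def boundary_part_def boundary_series_def nonneg_term_def P_def q_def w_def[symmetric] algebra_simps)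
    have Gz: "G z = P * (interior_series r a (w, cnj w) + interior_series r \<alpha> (w, cnj w) + (\<Sum>k. x k * w ^ k))"
      using interior_series_add[OF ab(1) \<alpha>1, of w "cnj w" r] w(1)
      by (simp add: G_def interior_solution_def P_def w_def[symmetric])
    have Wz: "W z = P * (q * (\<Sum>k. nonneg_term r \<alpha> k (w, cnj w)) - q * (\<Sum>m. neg_term r b m (w, cnj w)))"
      by (simp add: W_def boundary_solution_def boundary_part_def boundary_series_def P_def q_def w_def[symmetric] algebra_simps)
    have "(\<lambda>k. \<alpha> k * connection_coeff r k * (1 / w) ^ Suc k) = (\<lambda>k. d k * (1 / w) ^ Suc k)"
      using connection_coeff_nonzero[OF r] by (simp add: \<alpha>_def fun_eq_iff)
    then have con: "interior_series r \<alpha> (w, cnj w) + q * (\<Sum>k. nonneg_term r \<alpha> k (w, cnj w)) = (\<Sum>k. d k * (1 / w) ^ Suc k)"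
      using interior_series_boundary_series_connection[OF r c(1-4) b' \<alpha> w(2,1)] by (simp only: q_def)
    have "F z = P * (interior_series r a (w, cnj w) - q * (\<Sum>m. neg_term r b m (w, cnj w))) + P * X w"
      using X(2)[OF V] F'z by (simp add: P_def w_def)
    also have "X w = (\<Sum>k. x k * w ^ k) + (interior_series r \<alpha> (w, cnj w) + q * (\<Sum>k. nonneg_term r \<alpha> k (w, cnj w)))"
      unfolding con by (rule xd(3)[OF w(3,1)])
    finally show "F z = G z + W z" unfolding Gz Wz by (simp add: algebra_simps)
  qed
  ultimately show ?thesis by blast
qed

section \<open>Fourier modes on the boundary circle\<close>

definition unit_root :: "nat \<Rightarrow> nat \<Rightarrow> complex" where
  "unit_root K j = exp (2 * of_real pi * \<i> * of_nat j / of_nat K)"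

text \<open>A discrete Fourier coefficient; a finite sum inherits holomorphy in a parameter directly
  from its summands.\<close>

definition root_mean :: "nat \<Rightarrow> (complex \<Rightarrow> complex) \<Rightarrow> complex" where
  "root_mean K g = (\<Sum>j<K. g (unit_root K j)) / of_nat K"

lemma norm_unit_root: "norm (unit_root K j) = 1"
proof -
  have "2 * of_real pi * \<i> * of_nat j / of_nat K = \<i> * of_real (2 * pi * real j / real K)" by simp
  then show ?thesis unfolding unit_root_def by (simp only: norm_exp_i_times)
qed

lemma norm_root_mean_le:
  assumes "\<And>\<omega>. norm \<omega> = 1 \<Longrightarrow> norm (g \<omega>) \<le> M" "0 < K"
  shows "norm (root_mean K g) \<le> M"
proof -
  have "norm (\<Sum>j<K. g (unit_root K j)) \<le> of_nat (card {..<K}) * M"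
    by (rule sum_norm_bound) (use assms norm_unit_root in auto)
  then show ?thesis using assms(2) by (simp add: root_mean_def norm_divide field_simps)
qed

lemma root_mean_power:
  assumes "0 < K" shows "root_mean K (\<lambda>\<omega>. \<omega> ^ q) = (if K dvd q then 1 else 0)"
proof -
  have e: "unit_root K j ^ q = unit_root K q ^ j" for j
    unfolding unit_root_def by (simp add: exp_of_nat_mult[symmetric] mult_ac)
  have K1: "unit_root K q ^ K = 1"
    unfolding unit_root_def using complex_root_unity[of K q] assms by simp
  show ?thesis
  proof (cases "K dvd q")
    case True
    then have "unit_root K q = 1" using complex_root_unity_eq_1[of K q] assms by (simp add: unit_root_def)
    then show ?thesis using True assms by (simp add: root_mean_def e)
  next
    case False
    then have "unit_root K q \<noteq> 1" using complex_root_unity_eq_1[of K q] assms by (simp add: unit_root_def)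
    then show ?thesis using False K1 by (simp add: root_mean_def e geometric_sum)
  qed
qed

text \<open>Negative exponents reduce to positive ones by conjugation on the unit circle.\<close>

lemma root_mean_powi:
  assumes "0 < K" shows "root_mean K (\<lambda>\<omega>. \<omega> powi q) = (if int K dvd q then 1 else 0)"
proof (cases "q \<ge> 0")
  case True
  then obtain n where n: "q = int n" using nonneg_int_cases by blast
  show ?thesis using root_mean_power[OF assms, of n] unfolding n by simp
next
  case False
  then obtain n where n: "q = - int n" by (metis int_cases2 of_nat_0_le_iff)
  have "root_mean K (\<lambda>\<omega>. \<omega> powi q) = cnj (root_mean K (\<lambda>\<omega>. \<omega> ^ n))"
  proof -
    have "unit_root K j powi q = cnj (unit_root K j ^ n)" for j
    proof -
      have "inverse (unit_root K j) = cnj (unit_root K j)"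
        using norm_unit_root[of K j] by (metis complex_norm_square inverse_unique mult.commute of_real_1 one_power2)
      then show ?thesis unfolding n by (simp add: power_int_minus power_inverse[symmetric])
    qed
    then show ?thesis by (simp add: root_mean_def)
  qed
  then show ?thesis unfolding root_mean_power[OF assms] n by simp
qed

text \<open>Only exponents divisible by the number of roots survive the mean, and as that number
  grows only exponent 0 remains. Tannery's theorem with majorant |c_k| takes the limit inside the
  sum.\<close>

lemma root_mean_series_tendsto:
  assumes c: "summable (\<lambda>k. norm (c k :: complex))"
  shows "(\<lambda>K. root_mean (Suc K) (\<lambda>\<omega>. \<Sum>k. c k * \<omega> powi q k)) \<longlonglongrightarrow> (\<Sum>k. if q k = 0 then c k else 0)"
proof -
  have "root_mean (Suc K) (\<lambda>\<omega>. \<Sum>k. c k * \<omega> powi q k) = (\<Sum>k. c k * (if int (Suc K) dvd q k then 1 else 0))" for K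
  proof -
    have sm: "summable (\<lambda>k. c k * unit_root (Suc K) j powi q k)" for j
      by (rule summable_norm_cancel) (use c norm_unit_root in \<open>simp add: norm_mult norm_power_int\<close>)
    have "root_mean (Suc K) (\<lambda>\<omega>. \<Sum>k. c k * \<omega> powi q k)
       = (\<Sum>k. \<Sum>j<Suc K. c k * unit_root (Suc K) j powi q k) / of_nat (Suc K)"
      unfolding root_mean_def by (subst suminf_sum[OF sm]) simp
    also have "\<dots> = (\<Sum>k. (\<Sum>j<Suc K. c k * unit_root (Suc K) j powi q k) / of_nat (Suc K))"
      by (rule suminf_divide[symmetric]) (intro summable_sum sm)
    also have "(\<lambda>k. (\<Sum>j<Suc K. c k * unit_root (Suc K) j powi q k) / of_nat (Suc K))
       = (\<lambda>k. c k * root_mean (Suc K) (\<lambda>\<omega>. \<omega> powi q k))"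
      unfolding root_mean_def sum_distrib_left[symmetric] by simp
    finally show ?thesis by (simp only: root_mean_powi[OF zero_less_Suc])
  qed
  moreover have "(\<lambda>K. \<Sum>k. c k * (if int (Suc K) dvd q k then 1 else 0)) \<longlonglongrightarrow> (\<Sum>k. if q k = 0 then c k else 0)"
  proof -
    have "(\<lambda>K. c k * (if int (Suc K) dvd q k then 1 else 0)) \<longlonglongrightarrow> (if q k = 0 then c k else 0)" for k
    proof (rule tendsto_eventually, unfold eventually_sequentially, intro exI allI impI)
      fix K assume "K \<ge> nat \<bar>q k\<bar>"
      then have "\<bar>q k\<bar> \<le> int K" by linarith
      then have "int (Suc K) dvd q k \<longleftrightarrow> q k = 0"
        using zdvd_imp_le[of "int (Suc K)" "\<bar>q k\<bar>"] by auto
      then show "c k * (if int (Suc K) dvd q k then 1 else 0) = (if q k = 0 then c k else 0)" by simp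
    qed
    then have "eventually (\<lambda>K. summable (\<lambda>k. norm (c k * (if int (Suc K) dvd q k then 1 else 0)))) sequentially \<and>
        summable (\<lambda>k. norm (if q k = 0 then c k else 0)) \<and>
        (\<lambda>K. \<Sum>k. c k * (if int (Suc K) dvd q k then 1 else 0)) \<longlonglongrightarrow> (\<Sum>k. if q k = 0 then c k else 0)"
      by (rule tannerys_theorem[where M = "\<lambda>k. norm (c k)"]) (use c in \<open>auto intro!: always_eventually\<close>)
    then show ?thesis by blast
  qed
  ultimately show ?thesis by simp
qed

lemma root_mean_cmult: "root_mean K (\<lambda>\<omega>. c * g \<omega>) = c * root_mean K g"
  by (simp add: root_mean_def sum_distrib_left)

lemma root_mean_add: "root_mean K (\<lambda>\<omega>. f \<omega> + g \<omega>) = root_mean K f + root_mean K g"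
  by (simp add: root_mean_def sum.distrib add_divide_distrib)

lemma root_mean_cong: "(\<And>\<omega>. norm \<omega> = 1 \<Longrightarrow> f \<omega> = g \<omega>) \<Longrightarrow> root_mean K f = root_mean K g"
  by (simp add: root_mean_def norm_unit_root)

text \<open>The hypothesis gives \<open>t g'(t) = (r - 1) g(t)\<close>, which forces the Taylor coefficients of \<open>g\<close> at \<open>0\<close> to vanish.\<close>
lemma complex_power_not_holomorphic:
  fixes g :: "complex \<Rightarrow> complex"
  assumes g: "g holomorphic_on ball 0 \<delta>" and \<delta>: "\<delta> > 0"
    and r: "\<And>j::nat. of_nat j + 1 - r \<noteq> 0"
    and eq: "\<And>t::real. 0 < t \<Longrightarrow> t < \<delta> \<Longrightarrow> g (of_real t) = c * of_real t powr (r - 1)"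
  shows "c = 0"
proof -
  have ode: "of_real t * deriv g (of_real t) = (r - 1) * g (of_real t)" if t: "0 < t" "t < \<delta>" for t :: real
  proof -
    have inb: "of_real t \<in> ball (0::complex) \<delta>" using t by simp
    have "(g has_field_derivative deriv g (of_real t)) (at (of_real t))"
      by (rule holomorphic_derivI[OF g open_ball inb])
    moreover have "((\<lambda>x. of_real x :: complex) has_vector_derivative 1) (at t)"
      by (auto simp: has_vector_derivative_def of_real_def intro!: derivative_eq_intros)
    ultimately have 1: "((\<lambda>x. g (of_real x)) has_vector_derivative deriv g (of_real t)) (at t)"
      using field_vector_diff_chain_at[of of_real 1 t g "deriv g (of_real t)"] by (simp add: o_def)
    have "((\<lambda>w. c * w powr (r - 1)) has_field_derivative c * ((r - 1) * of_real t powr (r - 1 - 1))) (at (of_real t))"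
      by (intro DERIV_cmult has_field_derivative_powr) (use t in \<open>simp add: complex_nonpos_Reals_iff\<close>)
    moreover have "((\<lambda>x. of_real x :: complex) has_vector_derivative 1) (at t)"
      by (auto simp: has_vector_derivative_def of_real_def intro!: derivative_eq_intros)
    ultimately have "((\<lambda>x. c * of_real x powr (r - 1)) has_vector_derivative c * ((r - 1) * of_real t powr (r - 1 - 1))) (at t)"
      using field_vector_diff_chain_at[of of_real 1 t "\<lambda>w. c * w powr (r - 1)"] by (simp add: o_def)
    then have 2: "((\<lambda>x. g (of_real x)) has_vector_derivative c * ((r - 1) * of_real t powr (r - 1 - 1))) (at t)"
      by (rule has_vector_derivative_transform_within_open[of _ _ _ "{0<..<\<delta>}"]) (use t eq in auto)
    have "deriv g (of_real t) = c * ((r - 1) * of_real t powr (r - 1 - 1))"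
      by (rule vector_derivative_unique_at[OF 1 2])
    moreover have "of_real t * (of_real t powr (r - 1 - 1)) = complex_of_real t powr (r - 1)"
      using t by (simp add: powr_diff power2_eq_square)
    ultimately have "of_real t * deriv g (of_real t) = c * (r - 1) * of_real t powr (r - 1)"
      by (simp add: mult_ac)
    then show ?thesis using eq[OF t] by simp
  qed
  have dg: "deriv g holomorphic_on ball 0 \<delta>" using g by (simp add: holomorphic_deriv)
  \<comment> \<open>The equation holds on a real interval accumulating at 0, so the identity theorem
    spreads it over the disc.\<close>
  have z: "z * deriv g z - (r - 1) * g z = 0" if zb: "z \<in> ball 0 \<delta>" for z
  proof (rule analytic_continuation[where f = "\<lambda>z. z * deriv g z - (r - 1) * g z" and S = "ball 0 \<delta>"
        and U = "of_real ` {0<..<\<delta>}" and \<xi> = 0])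
    show "(\<lambda>z. z * deriv g z - (r - 1) * g z) holomorphic_on ball 0 \<delta>"
      by (intro holomorphic_intros g dg)
    show "(0::complex) islimpt of_real ` {0<..<\<delta>}"
      unfolding islimpt_approachable
    proof (intro allI impI)
      fix e :: real assume e: "e > 0"
      define t where "t = min e \<delta> / 2"
      have "0 < t" "t < e" "t < \<delta>" using e \<delta> by (auto simp: t_def)
      then show "\<exists>x'\<in>of_real ` {0<..<\<delta>}. x' \<noteq> (0::complex) \<and> dist x' 0 < e"
        by (intro bexI[of _ "of_real t"]) auto
    qed
  qed (use \<delta> ode zb in auto)
  define G where "G = fps_expansion g 0"
  have G: "g has_fps_expansion G"
    unfolding G_def by (rule has_fps_expansion_fps_expansion[OF open_ball _ g]) (use \<delta> in auto)
  have h1: "(\<lambda>z. z * deriv g z - (r - 1) * g z) has_fps_expansion (fps_X * fps_deriv G - fps_const (r - 1) * G)"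
    by (intro fps_expansion_intros G)
  have "\<forall>\<^sub>F x in nhds 0. x \<in> ball (0::complex) \<delta>"
    using \<delta> by (intro eventually_nhds_in_open) auto
  then have "\<forall>\<^sub>F z in nhds 0. z * deriv g z - (r - 1) * g z = 0"
    by (rule eventually_mono) (rule z)
  from iffD1[OF has_fps_expansion_cong[OF this refl] h1]
  have "(\<lambda>_. 0) has_fps_expansion (fps_X * fps_deriv G - fps_const (r - 1) * G)" .
  then have "fps_X * fps_deriv G - fps_const (r - 1) * G = 0"
    by (intro eval_fps_eqD) (auto simp: has_fps_expansion_def)
  then have nth0: "fps_nth (fps_X * fps_deriv G - fps_const (r - 1) * G) n = 0" for n by simp
  \<comment> \<open>Comparing coefficients makes n + 1 - r times the n-th one vanish.\<close>
  have "of_nat n * fps_nth G n = (r - 1) * fps_nth G n" for n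
  proof (cases n)
    case 0
    then show ?thesis using nth0[of 0] by (simp add: algebra_simps)
  next
    case (Suc m)
    have "fps_nth (fps_deriv G) m - (r - 1) * fps_nth G (Suc m) = 0" using nth0[of "Suc m"] by simp
    then show ?thesis unfolding Suc by simp
  qed
  moreover have "of_nat n - (r - 1) \<noteq> 0" for n using r[of n] by (simp add: algebra_simps)
  ultimately have "fps_nth G n = 0" for n by (metis eq_iff_diff_eq_0 mult_cancel_right)
  then have "G = 0" by (simp add: fps_eq_iff)
  then have "\<forall>\<^sub>F z in nhds 0. g z = 0" using G by (auto simp: has_fps_expansion_def elim: eventually_mono)
  then obtain e where e: "e > 0" "\<And>z. dist z 0 < e \<Longrightarrow> g z = 0"
    unfolding eventually_nhds_metric by blast
  define t where "t = min e \<delta> / 2"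
  have t: "0 < t" "t < e" "t < \<delta>" using e \<delta> by (auto simp: t_def)
  then have "c * of_real t powr (r - 1) = 0" using eq[of t] e(2)[of "of_real t"] by simp
  then show "c = 0" using t by simp
qed

text \<open>Means over roots of unity isolate a single Fourier mode, and Montel's theorem passes holomorphy in the
  radius to the limit; no regularity of \<open>E\<close> in \<open>\<omega>\<close> is needed.\<close>
lemma boundary_modes_vanish:
  fixes E :: "complex \<Rightarrow> complex \<Rightarrow> complex"
  assumes r: "\<And>j. of_nat j + 1 - r \<noteq> 0"
    and a: "conv_on 1 a" and x: "conv_on 1 x" and \<delta>: "0 < \<delta>" "\<delta> < 1"
    and Eh: "\<And>\<omega>. norm \<omega> = 1 \<Longrightarrow> E \<omega> holomorphic_on ball 0 \<delta>"
    and EM: "\<And>\<omega> s. norm \<omega> = 1 \<Longrightarrow> s \<in> ball 0 \<delta> \<Longrightarrow> norm (E \<omega> s) \<le> M"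
    and Ev: "\<And>\<omega> t w. norm \<omega> = 1 \<Longrightarrow> 0 < t \<Longrightarrow> t < \<delta> \<Longrightarrow> w = of_real (1 - t) * \<omega> \<Longrightarrow>
      E \<omega> (of_real t) = w * (1 - w * cnj w) powr (r - 1) * (interior_series r a (w, cnj w) + (\<Sum>k. x k * w ^ k))"
  shows "x N = 0" "a N = 0"
proof -
  \<comment> \<open>The factor w (1 - |w|^2)^(r-1) at w = (1-t) \<omega>, with \<omega> taken
    out.\<close>
  define \<kappa> where "\<kappa> t = of_real (1 - t) * of_real (1 - (1 - t)^2) powr (r - 1)" for t :: real
  define Ak where "Ak t k = a k * (of_real (1 - t) ^ Suc k * beta_ser r k (of_real ((1 - t)^2)))" for t :: real and k
  define Xk where "Xk t k = x k * of_real (1 - t) ^ k" for t :: real and k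
  define S where "S n K s = root_mean (Suc K) (\<lambda>\<omega>. E \<omega> s * \<omega> powi (- n))" for n :: int and K s
  have sA: "summable (\<lambda>k. norm (Ak t k))" and sX: "summable (\<lambda>k. norm (Xk t k))" if t: "0 < t" "t < \<delta>" for t
  proof -
    have u: "norm (complex_of_real (1 - t)) < 1" unfolding norm_of_real using t \<delta> by simp
    show "summable (\<lambda>k. norm (Ak t k))"
      using locally_summable_norm[OF interior_series_locally_summable[OF a, of r], of "(of_real (1 - t), of_real (1 - t))"] u
      by (simp add: Ak_def power2_eq_square)
    show "summable (\<lambda>k. norm (Xk t k))"
      unfolding Xk_def by (rule powser_norm_summable[OF conv_onD[OF x] u])
  qed
  \<comment> \<open>As conj \<omega> = 1/\<omega> and w brings one more \<omega>, P_k contributes to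
    mode -k and w^k to mode k+1: the two families never share a mode.\<close>
  have expand: "E \<omega> (of_real t) * \<omega> powi (- n) = \<kappa> t * ((\<Sum>k. Ak t k * \<omega> powi (- int k - n)) + (\<Sum>k. Xk t k * \<omega> powi (int k + 1 - n)))"
    if \<omega>: "norm \<omega> = 1" and t: "0 < t" "t < \<delta>" for \<omega> t n
  proof -
    define w where "w = of_real (1 - t) * \<omega>"
    have \<omega>0: "\<omega> \<noteq> 0" using \<omega> by auto
    have cw: "cnj \<omega> = inverse \<omega>"
      using \<omega> by (metis complex_norm_square inverse_unique mult.commute of_real_1 one_power2)
    have nw: "norm w < 1" using t \<delta> \<omega> unfolding w_def norm_mult norm_of_real by simp
    have ww: "w * cnj w = of_real ((1 - t)^2)"
      using \<omega> by (simp add: w_def cw power2_eq_square \<omega>0)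
    have "(\<lambda>k. a k * (cnj w ^ Suc k * beta_ser r k (w * cnj w))) sums interior_series r a (w, cnj w)"
      using interior_series_sums[OF a, of "(w, cnj w)" r] nw by simp
    then have "(\<lambda>k. (\<omega> * \<omega> powi (- n)) * (a k * (cnj w ^ Suc k * beta_ser r k (w * cnj w)))) sums ((\<omega> * \<omega> powi (- n)) * interior_series r a (w, cnj w))"
      by (rule sums_mult)
    also have "(\<lambda>k. (\<omega> * \<omega> powi (- n)) * (a k * (cnj w ^ Suc k * beta_ser r k (w * cnj w)))) = (\<lambda>k. Ak t k * \<omega> powi (- int k - n))"
    proof
      fix k
      have "\<omega> powi (- int k - n) = \<omega> powi (1 + (- n) + (- int (Suc k)))"
        by (rule arg_cong[where f = "\<lambda>m. \<omega> powi m"]) simp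
      also have "\<dots> = \<omega> * \<omega> powi (- n) * \<omega> powi (- int (Suc k))"
        using \<omega>0 by (simp only: power_int_add simp_thms power_int_1_right)
      also have "\<omega> powi (- int (Suc k)) = cnj \<omega> ^ Suc k"
        unfolding cw power_int_minus power_int_of_nat by (simp only: power_inverse)
      finally have p: "\<omega> powi (- int k - n) = \<omega> * \<omega> powi (- n) * cnj \<omega> ^ Suc k" .
      have "cnj w ^ Suc k = of_real (1 - t) ^ Suc k * cnj \<omega> ^ Suc k"
        by (simp only: w_def complex_cnj_mult complex_cnj_complex_of_real power_mult_distrib)
      then show "(\<omega> * \<omega> powi (- n)) * (a k * (cnj w ^ Suc k * beta_ser r k (w * cnj w))) = Ak t k * \<omega> powi (- int k - n)"
        unfolding p Ak_def ww by (simp only: mult_ac)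
    qed
    finally have 1: "(\<Sum>k. Ak t k * \<omega> powi (- int k - n)) = (\<omega> * \<omega> powi (- n)) * interior_series r a (w, cnj w)"
      by (simp add: sums_iff)
    have "(\<lambda>k. (\<omega> * \<omega> powi (- n)) * (x k * w ^ k)) sums ((\<omega> * \<omega> powi (- n)) * (\<Sum>k. x k * w ^ k))"
      by (intro sums_mult summable_sums conv_onD[OF x] nw)
    also have "(\<lambda>k. (\<omega> * \<omega> powi (- n)) * (x k * w ^ k)) = (\<lambda>k. Xk t k * \<omega> powi (int k + 1 - n))"
    proof
      fix k
      have "\<omega> powi (int k + 1 - n) = \<omega> powi (1 + (- n) + int k)"
        by (rule arg_cong[where f = "\<lambda>m. \<omega> powi m"]) simp
      also have "\<dots> = \<omega> * \<omega> powi (- n) * \<omega> ^ k"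
        using \<omega>0 by (simp only: power_int_add simp_thms power_int_1_right power_int_of_nat)
      finally show "(\<omega> * \<omega> powi (- n)) * (x k * w ^ k) = Xk t k * \<omega> powi (int k + 1 - n)"
        by (simp add: Xk_def w_def power_mult_distrib mult_ac)
    qed
    finally have 2: "(\<Sum>k. Xk t k * \<omega> powi (int k + 1 - n)) = (\<omega> * \<omega> powi (- n)) * (\<Sum>k. x k * w ^ k)"
      by (simp add: sums_iff)
    have e: "1 - w * cnj w = of_real (1 - (1 - t)^2)" unfolding ww by simp
    have alg: "w' = c * v \<Longrightarrow> w' * q * (p + y) * z = c * q * (v * z * p + v * z * y)" for w' c v q p y z :: complex
      by (simp add: algebra_simps)
    show ?thesis
      unfolding Ev[OF \<omega> t w_def] e 1 2 \<kappa>_def by (rule alg[OF w_def])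
  qed
  have lim: "(\<lambda>K. S n K (of_real t)) \<longlonglongrightarrow>
      \<kappa> t * ((\<Sum>k. if - int k - n = 0 then Ak t k else 0) + (\<Sum>k. if int k + 1 - n = 0 then Xk t k else 0))"
    if t: "0 < t" "t < \<delta>" for t n
  proof -
    have "S n K (of_real t) = \<kappa> t * (root_mean (Suc K) (\<lambda>\<omega>. \<Sum>k. Ak t k * \<omega> powi (- int k - n))
        + root_mean (Suc K) (\<lambda>\<omega>. \<Sum>k. Xk t k * \<omega> powi (int k + 1 - n)))" for K
      unfolding S_def root_mean_add[symmetric] root_mean_cmult[symmetric] by (rule root_mean_cong) (rule expand[OF _ t])
    then show ?thesis
      by (simp only:) (intro tendsto_mult tendsto_add tendsto_const root_mean_series_tendsto sA sX t)
  qed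
  have ex: "\<exists>g. g holomorphic_on ball 0 \<delta> \<and> (\<forall>t. 0 < t \<longrightarrow> t < \<delta> \<longrightarrow> g (of_real t) =
      \<kappa> t * ((\<Sum>k. if - int k - n = 0 then Ak t k else 0) + (\<Sum>k. if int k + 1 - n = 0 then Xk t k else 0)))" for n
  proof -
    have nE: "norm (E \<omega> s * \<omega> powi (- n)) \<le> M" if "norm \<omega> = 1" "s \<in> ball 0 \<delta>" for \<omega> s
      using EM[OF that] that(1) by (simp add: norm_mult norm_power_int)
    have hS: "S n K holomorphic_on ball 0 \<delta>" for K
      unfolding S_def root_mean_def by (intro holomorphic_intros Eh norm_unit_root) auto
    have bS: "norm (S n K s) \<le> M" if "s \<in> ball 0 \<delta>" for K s
      unfolding S_def by (rule norm_root_mean_le[OF nE]) (use that in auto)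
    obtain g q where g: "g holomorphic_on ball 0 \<delta>" "strict_mono (q :: nat \<Rightarrow> nat)"
      "\<And>s. s \<in> ball 0 \<delta> \<Longrightarrow> (\<lambda>K. S n (q K) s) \<longlonglongrightarrow> g s"
    proof (rule Montel[of "ball 0 \<delta>" "range (S n)" "S n"])
      show "\<exists>B. \<forall>h\<in>range (S n). \<forall>z\<in>K. norm (h z) \<le> B" if "compact K" "K \<subseteq> ball 0 \<delta>" for K
        using bS that by blast
    qed (use hS in auto)
    show ?thesis
    proof (intro exI conjI allI impI)
      show "g holomorphic_on ball 0 \<delta>" by fact
      fix t assume t: "0 < t" "t < \<delta>"
      have "(\<lambda>K. S n (q K) (of_real t)) \<longlonglongrightarrow> \<kappa> t * ((\<Sum>k. if - int k - n = 0 then Ak t k else 0)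
          + (\<Sum>k. if int k + 1 - n = 0 then Xk t k else 0))"
        using LIMSEQ_subseq_LIMSEQ[OF lim[OF t] g(2)] by (simp add: o_def)
      moreover have "(\<lambda>K. S n (q K) (of_real t)) \<longlonglongrightarrow> g (of_real t)" by (rule g(3)) (use t in simp)
      ultimately show "g (of_real t) = \<kappa> t * ((\<Sum>k. if - int k - n = 0 then Ak t k else 0)
          + (\<Sum>k. if int k + 1 - n = 0 then Xk t k else 0))"
        using LIMSEQ_unique by blast
    qed
  qed
  have single: "(\<Sum>k. if P k then f k else 0) = f N" if "\<And>k. P k \<longleftrightarrow> k = N" for P and f :: "nat \<Rightarrow> complex"
    using sums_unique[OF sums_single[of N f]] that by simp
  \<comment> \<open>1 - (1-t)^2 = t (2-t), and 2-t has holomorphic powers near 0, so only t^(r-1) is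
    singular.\<close>
  have pw: "of_real (1 - (1 - t)^2) powr (r - 1) * (2 - of_real t) powr (1 - r) = complex_of_real t powr (r - 1)"
    if t: "0 < t" "t < \<delta>" for t
  proof -
    have "complex_of_real (1 - (1 - t)^2) = of_real t * of_real (2 - t)"
      unfolding of_real_mult[symmetric] by (simp add: power2_eq_square algebra_simps)
    then have "of_real (1 - (1 - t)^2) powr (r - 1) = complex_of_real t powr (r - 1) * of_real (2 - t) powr (r - 1)"
      using t \<delta> by (simp only:) (intro powr_times_real, auto)
    moreover have "of_real (2 - t) powr (r - 1) * (2 - of_real t) powr (1 - r) = (1 :: complex)"
    proof -
      have "2 - complex_of_real t \<noteq> 0" using t \<delta> by (metis eq_iff_diff_eq_0 less_trans not_less_iff_gr_or_eq of_real_eq_iff of_real_numeral one_less_numeral_iff semiring_norm(76))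
      then show ?thesis by (simp add: powr_add[symmetric])
    qed
    ultimately show ?thesis by (simp add: mult.assoc)
  qed
  have n2: "2 - s \<notin> \<real>\<^sub>\<le>\<^sub>0" "1 - s \<noteq> 0" if "s \<in> ball 0 \<delta>" for s :: complex
    using that \<delta> complex_Re_le_cmod[of s] by (auto simp: complex_nonpos_Reals_iff)
  show "x N = 0"
  proof -
    obtain g where g: "g holomorphic_on ball 0 \<delta>" "\<And>t. 0 < t \<Longrightarrow> t < \<delta> \<Longrightarrow> g (of_real t) =
      \<kappa> t * ((\<Sum>k. if - int k - int (Suc N) = 0 then Ak t k else 0) + (\<Sum>k. if int k + 1 - int (Suc N) = 0 then Xk t k else 0))"
      using ex[of "int (Suc N)"] by blast
    \<comment> \<open>Mode N+1 contains x_N alone; removing the powers of 1-t and 2-t leaves x_N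
      t^(r-1).\<close>
    have "(\<lambda>s. g s * (2 - s) powr (1 - r) / (1 - s) ^ Suc N) holomorphic_on ball 0 \<delta>"
      by (intro holomorphic_intros g n2) (use n2 in auto)
    then show ?thesis
    proof (rule complex_power_not_holomorphic[OF _ \<delta>(1) r])
      fix t assume t: "0 < t" "t < \<delta>"
      have "g (of_real t) = \<kappa> t * Xk t N"
      proof -
        have "(\<Sum>k. if - int k - int (Suc N) = 0 then Ak t k else 0) = 0" by (simp add: algebra_simps)
        moreover have "(\<Sum>k. if int k + 1 - int (Suc N) = 0 then Xk t k else 0) = Xk t N" by (rule single) auto
        ultimately show ?thesis unfolding g(2)[OF t] by simp
      qed
      moreover have "of_real (1 - t) = 1 - complex_of_real t" by simp
      moreover have "1 - complex_of_real t \<noteq> 0" using n2(2)[of "of_real t"] t by simp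
      ultimately have "g (of_real t) / (1 - of_real t) ^ Suc N = x N * of_real (1 - (1 - t)^2) powr (r - 1)"
        by (simp add: \<kappa>_def Xk_def)
      then show "g (of_real t) * (2 - of_real t) powr (1 - r) / (1 - of_real t) ^ Suc N = x N * of_real t powr (r - 1)"
        unfolding pw[OF t, symmetric] by (simp only: times_divide_eq_left[symmetric] mult.assoc[symmetric])
    qed
  qed
  show "a N = 0"
  proof -
    obtain g where g: "g holomorphic_on ball 0 \<delta>" "\<And>t. 0 < t \<Longrightarrow> t < \<delta> \<Longrightarrow> g (of_real t) =
      \<kappa> t * ((\<Sum>k. if - int k - (- int N) = 0 then Ak t k else 0) + (\<Sum>k. if int k + 1 - (- int N) = 0 then Xk t k else 0))"
      using ex[of "- int N"] by blast
    \<comment> \<open>Mode -N contains a_N \<open>beta_ser\<close>. The factor (1-s)^N completes the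
      powers of 1-t to ((1-t)^2)^(N+1), as the connection formula requires; adding the polynomial
      \<open>tau_ser\<close> cancels its regular contribution, and a_N C_N t^(r-1) remains.\<close>
    define g2 where "g2 s = (g s * (1 - s) ^ N + a N * tau_ser r (of_nat N) ((1 - s)^2)) * (2 - s) powr (1 - r)" for s
    have "g2 holomorphic_on ball 0 \<delta>"
      unfolding g2_def tau_ser_nat_finite by (intro holomorphic_intros g n2)
    then have "a N * connection_coeff r N = 0"
    proof (rule complex_power_not_holomorphic[OF _ \<delta>(1) r])
      fix t assume t: "0 < t" "t < \<delta>"
      define u where "u = complex_of_real (1 - t)"
      define s where "s = u^2"
      have u0: "u \<noteq> 0" using t \<delta> by (auto simp: u_def)
      have s1: "1 - s \<noteq> 0" and ns: "norm s < 1" "norm (s - 1) < 1"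
      proof -
        have e: "0 < (1 - t)^2" "(1 - t)^2 < 1" using t \<delta> by (auto simp: power_less_one_iff abs_square_less_1)
        have sr: "s = of_real ((1 - t)^2)" by (simp add: s_def u_def)
        show "norm s < 1" unfolding sr norm_of_real using e by simp
        have "s - 1 = of_real ((1 - t)^2 - 1)" by (simp add: sr)
        then show "norm (s - 1) < 1" using e by (simp only: norm_of_real)
        show "1 - s \<noteq> 0" using \<open>norm s < 1\<close> by auto
      qed
      have "g (of_real t) = \<kappa> t * Ak t N"
      proof -
        have "(\<Sum>k. if int k + 1 - (- int N) = 0 then Xk t k else 0) = 0" by simp
        moreover have "(\<Sum>k. if - int k - (- int N) = 0 then Ak t k else 0) = Ak t N" by (rule single) auto
        ultimately show ?thesis unfolding g(2)[OF t] by simp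
      qed
      then have "g (of_real t) = (1 - s) powr (r - 1) * (a N * (u ^ Suc (Suc N) * beta_ser r N s))"
        by (simp add: \<kappa>_def Ak_def u_def s_def)
      then have "g (of_real t) * u ^ N = (1 - s) powr (r - 1) * (a N * (s ^ Suc N * beta_ser r N s))"
        by (simp add: s_def power2_eq_square power_mult_distrib mult_ac)
      also have "s ^ Suc N * beta_ser r N s = connection_coeff r N - (1 - s) powr (1 - r) * tau_ser r (of_nat N) s"
        using beta_ser_tau_ser_connection[OF r ns, of N] by (simp add: algebra_simps)
      also have "(1 - s) powr (r - 1) * (a N * (connection_coeff r N - (1 - s) powr (1 - r) * tau_ser r (of_nat N) s))
        = a N * connection_coeff r N * (1 - s) powr (r - 1) - a N * tau_ser r (of_nat N) s * ((1 - s) powr (r - 1) * (1 - s) powr (1 - r))"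
        by (simp add: algebra_simps)
      also have "(1 - s) powr (r - 1) * (1 - s) powr (1 - r) = 1"
        using s1 by (simp add: powr_add[symmetric])
      finally have "g2 (of_real t) = a N * connection_coeff r N * ((1 - s) powr (r - 1) * (2 - of_real t) powr (1 - r))"
        by (simp add: g2_def u_def s_def)
      moreover have "1 - s = of_real (1 - (1 - t)^2)" by (simp add: s_def u_def)
      ultimately show "g2 (of_real t) = a N * connection_coeff r N * of_real t powr (r - 1)"
        using pw[OF t] by simp
    qed
    then show ?thesis using connection_coeff_nonzero[OF r] by simp
  qed
qed

section \<open>Uniqueness of the decomposition\<close>

lemma holomorphic_conv_on:
  assumes "f holomorphic_on ball 0 1"
  obtains a where "conv_on 1 a" "\<And>z. norm z < 1 \<Longrightarrow> f z = (\<Sum>k. a k * z ^ k)"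
proof -
  have s: "(\<lambda>n. (deriv ^^ n) f 0 / fact n * z ^ n) sums f z" if "norm z < 1" for z
    using holomorphic_power_series[OF assms, of z] that by simp
  show ?thesis
    by (rule that[of "\<lambda>n. (deriv ^^ n) f 0 / fact n"]) (use s in \<open>auto simp: conv_on_def sums_iff\<close>)
qed

text \<open>On the full disc Taylor series replace Laurent series, so datum and holomorphic
  remainder contribute nonnegative powers only.\<close>

lemma Hr_UHP_representation:
  assumes F: "F \<in> Hr r UHP"
  obtains a x where "conv_on 1 a" "conv_on 1 x" "\<And>z. z \<in> UHP \<Longrightarrow> F z = interior_solution r a x z"
proof -
  have "{w::complex. -1 < norm w \<and> norm w < 1} = ball 0 1" by (auto intro: less_le_trans[of _ 0])
  then have im: "cayley ` UHP = ball 0 1" "cnj ` ball 0 1 = ball 0 1"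
    using cayley_UHP_annulus[of "-1"] cnj_cayley_UHP_annulus[of "-1"] by (simp_all add: UHP_annulus_neg)
  obtain A where A: "A holomorphic_on ball 0 1"
    "\<And>z. z \<in> UHP \<Longrightarrow> dzbar F z = of_real (Im z) powr (- r) * (cayley_weight r (cnj (cayley z)) * A (cnj (cayley z)))"
    by (rule Hr_disc_A[OF open_UHP subset_refl F, unfolded im]) (rule that, assumption, simp)
  obtain a where a: "conv_on 1 a" "\<And>z. norm z < 1 \<Longrightarrow> A z = (\<Sum>k. a k * z ^ k)"
    using holomorphic_conv_on[OF A(1)] by blast
  have C: "C1_on UHP F" "C1_on UHP (interior_solution r a (\<lambda>_. 0))"
    using F interior_solution_Hr[OF a(1) conv_on_0, of r] by (auto simp: Hr_def C2_on_C1)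
  have dz: "dzbar F z = dzbar (interior_solution r a (\<lambda>_. 0)) z" if "z \<in> UHP" for z
    using A(2)[OF that] interior_solution_dzbar[OF a(1) conv_on_0 that, of r] a(2)[of "cnj (cayley z)"] cayley_in_disc[OF that] by simp
  obtain X where X: "X holomorphic_on ball 0 1"
    "\<And>z. z \<in> UHP \<Longrightarrow> F z = interior_solution r a (\<lambda>_. 0) z + (1 - cayley z) powr r * X (cayley z)"
    by (rule Hr_disc_diff[OF open_UHP subset_refl C dz, of r, unfolded im]) (assumption, rule that, assumption, simp)
  obtain x where x: "conv_on 1 x" "\<And>z. norm z < 1 \<Longrightarrow> X z = (\<Sum>k. x k * z ^ k)"
    using holomorphic_conv_on[OF X(1)] by blast
  have "F z = interior_solution r a x z" if "z \<in> UHP" for z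
    using X(2)[OF that] x(2)[OF cayley_in_disc[OF that]] by (simp add: interior_solution_def algebra_simps)
  then show ?thesis using that a(1) x(1) by blast
qed

text \<open>A change of chart: f acts on z and its conjugate g on conj z. A compact polydisc
  provides the bound M.\<close>

lemma real_analytic_local_extension:
  assumes H: "real_analytic_at H (f p)"
    and f: "f holomorphic_on S" "open S" "p \<in> S" and g: "g holomorphic_on S'" "open S'" "cnj p \<in> S'"
    and fg: "\<And>w. w \<in> S \<Longrightarrow> g (cnj w) = cnj (f w)"
  obtains \<eta> M \<Phi> where "\<eta> > 0" "hol2 (ball p \<eta> \<times> ball (cnj p) \<eta>) \<Phi>"
    "\<And>q. q \<in> ball p \<eta> \<times> ball (cnj p) \<eta> \<Longrightarrow> norm (\<Phi> q) \<le> M"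
    "\<And>w. w \<in> ball p \<eta> \<Longrightarrow> H (f w) = \<Phi> (w, cnj w)"
proof -
  obtain \<Phi>0 \<eta>0 where 0: "\<eta>0 > 0" "hol2 (ball (f p) \<eta>0 \<times> ball (cnj (f p)) \<eta>0) \<Phi>0"
    "\<And>z. z \<in> ball (f p) \<eta>0 \<Longrightarrow> H z = \<Phi>0 (z, cnj z)"
    using real_analytic_imp_hol2[OF H] by blast
  have hf: "hol2 (S \<times> S') (\<lambda>q. f (fst q))" and hg: "hol2 (S \<times> S') (\<lambda>q. g (snd q))"
    by (rule hol2_comp1[OF f(1,2) hol2_fst], force, rule hol2_comp1[OF g(1,2) hol2_snd], force)
  have op0: "open (ball (f p) \<eta>0 \<times> ball (cnj (f p)) \<eta>0)" by (simp add: open_Times)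
  define \<Omega> where "\<Omega> = (S \<times> S') \<inter> (\<lambda>q. (f (fst q), g (snd q))) -` (ball (f p) \<eta>0 \<times> ball (cnj (f p)) \<eta>0)"
  have op: "open \<Omega>" unfolding \<Omega>_def
    by (intro continuous_open_preimage continuous_on_Pair hol2_cont hf hg open_Times f g open_ball)
  define \<Phi> where "\<Phi> q = \<Phi>0 (f (fst q), g (snd q))" for q
  have h: "hol2 \<Omega> \<Phi>"
    unfolding \<Phi>_def
    by (rule hol2_compose2[OF op0 0(2) hol2_subset[OF hf] hol2_subset[OF hg]]) (auto simp: \<Omega>_def)
  have "(p, cnj p) \<in> \<Omega>" using f g fg[OF f(3)] 0(1) by (simp add: \<Omega>_def)
  from open_contains_cpolydisc[OF op this]
  obtain \<eta> where \<eta>: "\<eta> > 0" "cball p \<eta> \<times> cball (cnj p) \<eta> \<subseteq> \<Omega>" .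
  have "compact (\<Phi> ` (cball p \<eta> \<times> cball (cnj p) \<eta>))"
    by (intro compact_continuous_image compact_Times continuous_on_subset[OF hol2_cont[OF h] \<eta>(2)]) auto
  from compact_imp_bounded[OF this] obtain M where M: "\<forall>u\<in>\<Phi> ` (cball p \<eta> \<times> cball (cnj p) \<eta>). norm u \<le> M"
    unfolding bounded_iff by blast
  have sub: "ball p \<eta> \<times> ball (cnj p) \<eta> \<subseteq> cball p \<eta> \<times> cball (cnj p) \<eta>" by auto
  show ?thesis
  proof (rule that[OF \<eta>(1), of \<Phi> M])
    show "hol2 (ball p \<eta> \<times> ball (cnj p) \<eta>) \<Phi>" by (rule hol2_subset[OF h]) (use sub \<eta>(2) in blast)
    show "norm (\<Phi> q) \<le> M" if "q \<in> ball p \<eta> \<times> ball (cnj p) \<eta>" for q using M that sub by blast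
    fix w assume w: "w \<in> ball p \<eta>"
    have "cnj w \<in> ball (cnj p) \<eta>" using w by (simp add: dist_norm flip: complex_cnj_diff)
    then have "(w, cnj w) \<in> \<Omega>" using w \<eta>(2) sub by blast
    then have "w \<in> S" "f w \<in> ball (f p) \<eta>0" by (auto simp: \<Omega>_def)
    then show "H (f w) = \<Phi> (w, cnj w)" using 0(3) fg by (simp add: \<Phi>_def)
  qed
qed

text \<open>A boundary point other than 1 comes from a real z, where h itself is analytic; 1 comes
  from infinity and uses the chart 1/z. Asserting the identity for |w| < 1 leaves out w = 1
  itself.\<close>

lemma boundary_local_extension:
  assumes U: "bnbhd U" and h: "real_analytic_P1 U h" and p: "norm p = 1"
  shows "\<exists>\<eta> M \<Phi>. \<eta> > 0 \<and> hol2 (ball p \<eta> \<times> ball (cnj p) \<eta>) \<Phi> \<and>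
    (\<forall>q\<in>ball p \<eta> \<times> ball (cnj p) \<eta>. norm (\<Phi> q) \<le> M) \<and>
    (\<forall>w\<in>ball p \<eta>. norm w < 1 \<longrightarrow> h (cayley_inv w) = \<Phi> (w, cnj w))"
proof (cases "p = 1")
  case False
  have "cnj (cayley_inv p) = cayley_inv p"
  proof -
    have p0: "p \<noteq> 0" "1 - p \<noteq> 0" using p False by auto
    have cp: "cnj p = 1 / p"
      using p p0 by (metis complex_norm_square nonzero_divide_eq_eq mult.commute of_real_1 one_power2)
    have e: "1 + 1 / p = (1 + p) / p" "1 - 1 / p = - ((1 - p) / p)" using p0 by (simp_all add: field_simps)
    have "cnj (cayley_inv p) = cayley_conj_inv (1 / p)" by (simp only: cnj_cayley_inv cp)
    also have "\<dots> = cayley_inv p" unfolding cayley_conj_inv_def cayley_inv_def e using p0 by simp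
    finally show ?thesis .
  qed
  then have "cayley_inv p = of_real (Re (cayley_inv p))" by (simp add: complex_eq_iff)
  then have "cayley_inv p \<in> U" using U unfolding bnbhd_def by metis
  then have "real_analytic_at h (cayley_inv p)" using h by (simp add: real_analytic_P1_def)
  then obtain \<eta> M \<Phi> where "\<eta> > 0" "hol2 (ball p \<eta> \<times> ball (cnj p) \<eta>) \<Phi>"
    "\<And>q. q \<in> ball p \<eta> \<times> ball (cnj p) \<eta> \<Longrightarrow> norm (\<Phi> q) \<le> M"
    "\<And>w. w \<in> ball p \<eta> \<Longrightarrow> h (cayley_inv w) = \<Phi> (w, cnj w)"
    by (rule real_analytic_local_extension[OF _ cayley_inv_hol _ _ cayley_conj_inv_hol])
      (use False in \<open>auto simp: cnj_cayley_inv complex_eq_iff\<close>)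
  then show ?thesis by blast
next
  case True
  obtain c where c: "real_analytic_at (\<lambda>w. if w = 0 then c else h (1 / w)) 0"
    using h by (auto simp: real_analytic_P1_def)
  \<comment> \<open>The reciprocal of \<open>cayley_inv\<close>, holomorphic at w = 1 with value 0;
    \<open>g\<close> is its conjugate.\<close>
  define f where "f w = - \<i> * (1 - w) / (1 + w)" for w
  define g where "g w = \<i> * (1 - w) / (1 + w)" for w
  have fh: "f holomorphic_on - {- 1}" and gh: "g holomorphic_on - {- 1}"
    unfolding f_def g_def by (intro holomorphic_intros; simp add: add_eq_0_iff)+
  have "real_analytic_at (\<lambda>w. if w = 0 then c else h (1 / w)) (f p)" using c True by (simp add: f_def)
  then obtain \<eta> M \<Phi> where \<Phi>: "\<eta> > 0" "hol2 (ball p \<eta> \<times> ball (cnj p) \<eta>) \<Phi>"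
    "\<And>q. q \<in> ball p \<eta> \<times> ball (cnj p) \<eta> \<Longrightarrow> norm (\<Phi> q) \<le> M"
    "\<And>w. w \<in> ball p \<eta> \<Longrightarrow> (if f w = 0 then c else h (1 / f w)) = \<Phi> (w, cnj w)"
    by (rule real_analytic_local_extension[OF _ fh _ _ gh])
      (use True in \<open>auto simp: f_def g_def\<close>)
  have "h (cayley_inv w) = \<Phi> (w, cnj w)" if "w \<in> ball p \<eta>" "norm w < 1" for w
  proof -
    have n: "1 - w \<noteq> 0" using that(2) by auto
    have n': "1 + w \<noteq> 0"
    proof
      assume "1 + w = 0"
      then have "w = - 1" by (simp add: add_eq_0_iff)
      then show False using that(2) by simp
    qed
    then have "f w \<noteq> 0" "1 / f w = cayley_inv w" using n n' by (auto simp: f_def cayley_inv_def field_simps)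
    then show ?thesis using \<Phi>(4)[OF that(1)] by simp
  qed
  then show ?thesis using \<Phi>(1,2,3) by blast
qed

text \<open>Compactness of the circle: finitely many local extensions yield one depth \<delta> and
  one bound for all directions \<omega>.\<close>

lemma boundary_uniform_extension:
  assumes U: "bnbhd U" and h: "real_analytic_P1 U h"
  shows "\<exists>\<delta> M E. 0 < \<delta> \<and> \<delta> < 1 \<and> (\<forall>\<omega>. norm \<omega> = 1 \<longrightarrow> E \<omega> holomorphic_on ball 0 \<delta> \<and>
    (\<forall>s\<in>ball 0 \<delta>. norm (E \<omega> s) \<le> M) \<and>
    (\<forall>t. 0 < t \<longrightarrow> t < \<delta> \<longrightarrow> E \<omega> (of_real t) = h (cayley_inv (of_real (1 - t) * \<omega>))))"
proof -
  have "\<forall>p\<in>sphere 0 1. \<exists>\<eta> M \<Phi>. \<eta> > 0 \<and> hol2 (ball p \<eta> \<times> ball (cnj p) \<eta>) \<Phi> \<and>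
    (\<forall>q\<in>ball p \<eta> \<times> ball (cnj p) \<eta>. norm (\<Phi> q) \<le> M) \<and>
    (\<forall>w\<in>ball p \<eta>. norm w < 1 \<longrightarrow> h (cayley_inv w) = \<Phi> (w, cnj w))"
    using boundary_local_extension[OF U h] by simp
  then obtain \<eta> where "\<forall>p\<in>sphere 0 1. \<exists>M \<Phi>. \<eta> p > 0 \<and> hol2 (ball p (\<eta> p) \<times> ball (cnj p) (\<eta> p)) \<Phi> \<and>
    (\<forall>q\<in>ball p (\<eta> p) \<times> ball (cnj p) (\<eta> p). norm (\<Phi> q) \<le> M) \<and>
    (\<forall>w\<in>ball p (\<eta> p). norm w < 1 \<longrightarrow> h (cayley_inv w) = \<Phi> (w, cnj w))"
    by (rule bchoice[THEN exE])
  then obtain M where "\<forall>p\<in>sphere 0 1. \<exists>\<Phi>. \<eta> p > 0 \<and> hol2 (ball p (\<eta> p) \<times> ball (cnj p) (\<eta> p)) \<Phi> \<and>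
    (\<forall>q\<in>ball p (\<eta> p) \<times> ball (cnj p) (\<eta> p). norm (\<Phi> q) \<le> M p) \<and>
    (\<forall>w\<in>ball p (\<eta> p). norm w < 1 \<longrightarrow> h (cayley_inv w) = \<Phi> (w, cnj w))"
    by (rule bchoice[THEN exE])
  then obtain \<Phi> where \<Phi>: "\<forall>p\<in>sphere 0 1. \<eta> p > 0 \<and> hol2 (ball p (\<eta> p) \<times> ball (cnj p) (\<eta> p)) (\<Phi> p) \<and>
    (\<forall>q\<in>ball p (\<eta> p) \<times> ball (cnj p) (\<eta> p). norm (\<Phi> p q) \<le> M p) \<and>
    (\<forall>w\<in>ball p (\<eta> p). norm w < 1 \<longrightarrow> h (cayley_inv w) = \<Phi> p (w, cnj w))"
    by (rule bchoice[THEN exE])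
  have cov: "sphere 0 1 \<subseteq> (\<Union>p\<in>sphere 0 1. ball p (\<eta> p / 2))"
  proof
    fix p :: complex assume "p \<in> sphere 0 1"
    then show "p \<in> (\<Union>p\<in>sphere 0 1. ball p (\<eta> p / 2))" using \<Phi> by (intro UN_I[of p]) auto
  qed
  obtain C where C: "C \<subseteq> sphere 0 1" "finite C" "sphere (0::complex) 1 \<subseteq> (\<Union>p\<in>C. ball p (\<eta> p / 2))"
    by (rule compactE_image[OF compact_sphere _ cov]) auto
  \<comment> \<open>A point within \<open>\<eta> p / 2\<close> of the centre, moved by less than
    \<open>\<eta> p / 2\<close>, stays in the ball; the value 1/2 keeps \<delta> below 1.\<close>
  define \<delta> where "\<delta> = Min (insert (1/2) ((\<lambda>p. \<eta> p / 2) ` C))"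
  define M' where "M' = Max (insert 0 (M ` C))"
  have \<delta>0: "0 < \<delta>" unfolding \<delta>_def using C \<Phi> by (subst Min_gr_iff) auto
  have \<delta>1: "\<delta> \<le> 1/2" unfolding \<delta>_def using C by (intro Min_le) auto
  have \<delta>C: "\<delta> \<le> \<eta> p / 2" if "p \<in> C" for p unfolding \<delta>_def using C that by (intro Min_le) auto
  have MC: "M p \<le> M'" if "p \<in> C" for p unfolding M'_def using C that by (intro Max_ge) auto
  have "\<forall>\<omega>\<in>sphere 0 1. \<exists>p. p \<in> C \<and> \<omega> \<in> ball p (\<eta> p / 2)" using C(3) by blast
  then obtain P where P: "\<forall>\<omega>\<in>sphere 0 1. P \<omega> \<in> C \<and> \<omega> \<in> ball (P \<omega>) (\<eta> (P \<omega>) / 2)"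
    by (rule bchoice[THEN exE])
  \<comment> \<open>The second argument is (1-s) conj \<omega> with s unconjugated: it is conj w for
    real s and holomorphic in complex s.\<close>
  define E where "E \<omega> s = \<Phi> (P \<omega>) ((1 - s) * \<omega>, (1 - s) * cnj \<omega>)" for \<omega> s
  have inb: "(1 - s) * \<omega> \<in> ball (P \<omega>) (\<eta> (P \<omega>))" "(1 - s) * cnj \<omega> \<in> ball (cnj (P \<omega>)) (\<eta> (P \<omega>))"
    if \<omega>: "norm \<omega> = 1" and s: "s \<in> ball 0 \<delta>" for \<omega> s
  proof -
    have p: "P \<omega> \<in> C" "dist (P \<omega>) \<omega> < \<eta> (P \<omega>) / 2" using P \<omega> by auto
    have d: "norm s < \<eta> (P \<omega>) / 2" using \<delta>C[OF p(1)] s by auto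
    have d': "dist (cnj (P \<omega>)) (cnj \<omega>) < \<eta> (P \<omega>) / 2" using p(2) by (simp add: dist_norm flip: complex_cnj_diff)
    have gen: "(1 - s) * y \<in> ball q \<epsilon>" if "dist q y < \<epsilon> / 2" "norm s < \<epsilon> / 2" "norm y = 1" for q y \<epsilon>
    proof -
      have "dist q ((1 - s) * y) \<le> dist q y + dist y ((1 - s) * y)" by (rule dist_triangle)
      also have "dist y ((1 - s) * y) = norm (s * y)" by (simp add: dist_norm algebra_simps)
      finally show ?thesis using that by (simp add: norm_mult)
    qed
    show "(1 - s) * \<omega> \<in> ball (P \<omega>) (\<eta> (P \<omega>))" by (rule gen[OF p(2) d \<omega>])
    show "(1 - s) * cnj \<omega> \<in> ball (cnj (P \<omega>)) (\<eta> (P \<omega>))" by (rule gen[OF d' d]) (simp add: \<omega>)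
  qed
  have PS: "P \<omega> \<in> C" "P \<omega> \<in> sphere 0 1" if "norm \<omega> = 1" for \<omega>
  proof -
    show "P \<omega> \<in> C" using P that by simp
    then show "P \<omega> \<in> sphere 0 1" using C(1) by blast
  qed
  show ?thesis
  proof (rule exI[of _ \<delta>], rule exI[of _ M'], rule exI[of _ E], intro conjI allI impI ballI)
    show "0 < \<delta>" by (rule \<delta>0)
    show "\<delta> < 1" using \<delta>1 by simp
    fix \<omega> :: complex assume \<omega>: "norm \<omega> = 1"
    note \<Phi>p = bspec[OF \<Phi> PS(2)[OF \<omega>]]
    have op: "open (ball (P \<omega>) (\<eta> (P \<omega>)) \<times> ball (cnj (P \<omega>)) (\<eta> (P \<omega>)))" by (simp add: open_Times)
    show "E \<omega> holomorphic_on ball 0 \<delta>"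
      unfolding E_def
      by (rule hol2_comp_hol[OF op _ open_ball]) (use \<Phi>p inb[OF \<omega>] in \<open>auto intro!: holomorphic_intros\<close>)
    show "norm (E \<omega> s) \<le> M'" if "s \<in> ball 0 \<delta>" for s
    proof -
      have "norm (E \<omega> s) \<le> M (P \<omega>)" unfolding E_def using \<Phi>p inb[OF \<omega> that] by blast
      then show ?thesis using MC[OF PS(1)[OF \<omega>]] by linarith
    qed
    fix t assume t: "0 < t" "t < \<delta>"
    have s: "complex_of_real t \<in> ball 0 \<delta>" using t by simp
    define w where "w = of_real (1 - t) * \<omega>"
    have we: "w = (1 - of_real t) * \<omega>" "cnj w = (1 - of_real t) * cnj \<omega>" by (simp_all add: w_def)
    have "norm w < 1" unfolding w_def norm_mult norm_of_real using \<omega> t \<delta>1 by simp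
    moreover have "w \<in> ball (P \<omega>) (\<eta> (P \<omega>))" using inb(1)[OF \<omega> s] we(1) by simp
    ultimately have "h (cayley_inv w) = \<Phi> (P \<omega>) (w, cnj w)" using \<Phi>p by blast
    then show "E \<omega> (of_real t) = h (cayley_inv (of_real (1 - t) * \<omega>))" unfolding E_def we[symmetric] w_def[symmetric] by simp
  qed
qed

lemma bnbhd_Int: "bnbhd U \<Longrightarrow> bnbhd V \<Longrightarrow> bnbhd (U \<inter> V)"
proof -
  assume U: "bnbhd U" and V: "bnbhd V"
  obtain R S where "\<And>z. norm z > R \<Longrightarrow> z \<in> U" "\<And>z. norm z > S \<Longrightarrow> z \<in> V"
    using U V unfolding bnbhd_def by blast
  then have "\<forall>z. norm z > max R S \<longrightarrow> z \<in> U \<inter> V" by simp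
  then have "\<exists>R. \<forall>z. norm z > R \<longrightarrow> z \<in> U \<inter> V" by blast
  moreover have "open (U \<inter> V)" "\<forall>x::real. complex_of_real x \<in> U \<inter> V"
    using U V unfolding bnbhd_def by auto
  ultimately show ?thesis unfolding bnbhd_def by blast
qed

lemma conv_on_diff: "conv_on R a \<Longrightarrow> conv_on R b \<Longrightarrow> conv_on R (\<lambda>k. a k - b k)"
  unfolding conv_on_def by (auto simp: left_diff_distrib intro: summable_diff)

lemma interior_solution_diff:
  assumes "conv_on 1 a" "conv_on 1 b" "conv_on 1 x" "conv_on 1 y" "z \<in> UHP"
  shows "interior_solution r (\<lambda>k. a k - b k) (\<lambda>k. x k - y k) z = interior_solution r a x z - interior_solution r b y z"
proof -
  have w: "norm (cayley z) < 1" using cayley_in_disc[OF assms(5)] .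
  then have m: "(cayley z, cnj (cayley z)) \<in> ball 0 1 \<times> ball 0 1" by simp
  from sums_diff[OF interior_series_sums[OF assms(1) m] interior_series_sums[OF assms(2) m], of r r]
  have P: "interior_series r (\<lambda>k. a k - b k) (cayley z, cnj (cayley z)) = interior_series r a (cayley z, cnj (cayley z)) - interior_series r b (cayley z, cnj (cayley z))"
    by (simp add: interior_series_def sums_iff left_diff_distrib)
  have X: "(\<Sum>k. (x k - y k) * cayley z ^ k) = (\<Sum>k. x k * cayley z ^ k) - (\<Sum>k. y k * cayley z ^ k)"
    using suminf_diff[OF conv_onD[OF assms(3) w] conv_onD[OF assms(4) w]] by (simp add: left_diff_distrib)
  have "p * ((A - B) + (C - D)) = p * (A + C) - p * (B + D)" for p A B C D :: complex
    by (simp add: algebra_simps)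
  then show ?thesis unfolding interior_solution_def P X .
qed

text \<open>Near the boundary G1 - G2 = f_r (h2 - h1). The modes of the quotient force all
  coefficients of G1 - G2 to vanish, so equality holds on the whole half-plane.\<close>

lemma sum_decomposition_unique:
  assumes r: "\<And>j. of_nat j + 1 - r \<noteq> 0"
    and G: "G1 \<in> Hr r UHP" "G2 \<in> Hr r UHP" and W: "Wgerm r W1" "Wgerm r W2"
    and eq: "germ_eq (\<lambda>z. G1 z + W1 z) (\<lambda>z. G2 z + W2 z)" and z: "z \<in> UHP"
  shows "G1 z = G2 z"
proof -
  obtain a1 x1 where G1: "conv_on 1 a1" "conv_on 1 x1" "\<And>z. z \<in> UHP \<Longrightarrow> G1 z = interior_solution r a1 x1 z"
    using Hr_UHP_representation[OF G(1)] by blast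
  obtain a2 x2 where G2: "conv_on 1 a2" "conv_on 1 x2" "\<And>z. z \<in> UHP \<Longrightarrow> G2 z = interior_solution r a2 x2 z"
    using Hr_UHP_representation[OF G(2)] by blast
  obtain U1 V1 h1 where 1: "bnbhd U1" "real_analytic_P1 U1 h1"
    "\<forall>z\<in>(U1 \<inter> UHP) - {\<i>}. V1 z / fr r z = h1 z" "germ_eq W1 V1"
    using W(1) unfolding Wgerm_def by blast
  obtain U2 V2 h2 where 2: "bnbhd U2" "real_analytic_P1 U2 h2"
    "\<forall>z\<in>(U2 \<inter> UHP) - {\<i>}. V2 z / fr r z = h2 z" "germ_eq W2 V2"
    using W(2) unfolding Wgerm_def by blast
  obtain U0 U3 U4 where 3: "bnbhd U0" "\<forall>z\<in>U0 \<inter> UHP. G1 z + W1 z = G2 z + W2 z"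
    "bnbhd U3" "\<forall>z\<in>U3 \<inter> UHP. W1 z = V1 z" "bnbhd U4" "\<forall>z\<in>U4 \<inter> UHP. W2 z = V2 z"
    using eq 1(4) 2(4) unfolding germ_eq_def by blast
  have "bnbhd (U0 \<inter> U1 \<inter> U2 \<inter> U3 \<inter> U4)" by (intro bnbhd_Int 1 2 3)
  then obtain \<rho> where \<rho>: "0 < \<rho>" "\<rho> < 1" "UHP_annulus \<rho> \<subseteq> U0 \<inter> U1 \<inter> U2 \<inter> U3 \<inter> U4"
    by (rule bnbhd_contains_UHP_annulus)
  define a where "a k = a1 k - a2 k" for k
  define x where "x k = x1 k - x2 k" for k
  have ax: "conv_on 1 a" "conv_on 1 x" unfolding a_def x_def by (intro conv_on_diff G1 G2)+
  have D: "interior_solution r a x z = G1 z - G2 z" if "z \<in> UHP" for z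
    unfolding a_def x_def using interior_solution_diff[OF G1(1) G2(1) G1(2) G2(2) that] G1(3)[OF that] G2(3)[OF that] by simp
  obtain \<delta>1 M1 E1 where E1': "0 < \<delta>1 \<and> \<delta>1 < 1 \<and> (\<forall>\<omega>. norm \<omega> = 1 \<longrightarrow> E1 \<omega> holomorphic_on ball 0 \<delta>1 \<and>
    (\<forall>s\<in>ball 0 \<delta>1. norm (E1 \<omega> s) \<le> M1) \<and>
    (\<forall>t. 0 < t \<longrightarrow> t < \<delta>1 \<longrightarrow> E1 \<omega> (of_real t) = h1 (cayley_inv (of_real (1 - t) * \<omega>))))"
    using boundary_uniform_extension[OF 1(1,2)] by (elim exE) (rule that)
  then have E1: "0 < \<delta>1" "\<delta>1 < 1"
    "\<And>\<omega>. norm \<omega> = 1 \<Longrightarrow> E1 \<omega> holomorphic_on ball 0 \<delta>1"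
    "\<And>\<omega> s. norm \<omega> = 1 \<Longrightarrow> s \<in> ball 0 \<delta>1 \<Longrightarrow> norm (E1 \<omega> s) \<le> M1"
    "\<And>\<omega> t. norm \<omega> = 1 \<Longrightarrow> 0 < t \<Longrightarrow> t < \<delta>1 \<Longrightarrow> E1 \<omega> (of_real t) = h1 (cayley_inv (of_real (1 - t) * \<omega>))"
    by blast+
  obtain \<delta>2 M2 E2 where E2': "0 < \<delta>2 \<and> \<delta>2 < 1 \<and> (\<forall>\<omega>. norm \<omega> = 1 \<longrightarrow> E2 \<omega> holomorphic_on ball 0 \<delta>2 \<and>
    (\<forall>s\<in>ball 0 \<delta>2. norm (E2 \<omega> s) \<le> M2) \<and>
    (\<forall>t. 0 < t \<longrightarrow> t < \<delta>2 \<longrightarrow> E2 \<omega> (of_real t) = h2 (cayley_inv (of_real (1 - t) * \<omega>))))"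
    using boundary_uniform_extension[OF 2(1,2)] by (elim exE) (rule that)
  then have E2: "0 < \<delta>2" "\<delta>2 < 1"
    "\<And>\<omega>. norm \<omega> = 1 \<Longrightarrow> E2 \<omega> holomorphic_on ball 0 \<delta>2"
    "\<And>\<omega> s. norm \<omega> = 1 \<Longrightarrow> s \<in> ball 0 \<delta>2 \<Longrightarrow> norm (E2 \<omega> s) \<le> M2"
    "\<And>\<omega> t. norm \<omega> = 1 \<Longrightarrow> 0 < t \<Longrightarrow> t < \<delta>2 \<Longrightarrow> E2 \<omega> (of_real t) = h2 (cayley_inv (of_real (1 - t) * \<omega>))"
    by blast+
  \<comment> \<open>The bound 1 - \<rho> places (1-t) \<omega> in the annulus contained in all
    neighbourhoods at hand.\<close>
  define \<delta> where "\<delta> = min (min \<delta>1 \<delta>2) (1 - \<rho>)"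
  have \<delta>: "0 < \<delta>" "\<delta> < 1" "\<delta> \<le> \<delta>1" "\<delta> \<le> \<delta>2" "\<delta> \<le> 1 - \<rho>"
    using E1(1,2) E2(1,2) \<rho> by (auto simp: \<delta>_def)
  have sub: "ball (0::complex) \<delta> \<subseteq> ball 0 \<delta>1" "ball (0::complex) \<delta> \<subseteq> ball 0 \<delta>2" using \<delta> by auto
  define E where "E \<omega> s = E2 \<omega> s - E1 \<omega> s" for \<omega> s
  have Eh: "E \<omega> holomorphic_on ball 0 \<delta>" if "norm \<omega> = 1" for \<omega>
    unfolding E_def
    by (intro holomorphic_on_diff holomorphic_on_subset[OF E2(3)[OF that] sub(2)] holomorphic_on_subset[OF E1(3)[OF that] sub(1)])
  have EM: "norm (E \<omega> s) \<le> M2 + M1" if "norm \<omega> = 1" "s \<in> ball 0 \<delta>" for \<omega> s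
    unfolding E_def using norm_triangle_ineq4[of "E2 \<omega> s" "E1 \<omega> s"] E1(4)[of \<omega> s] E2(4)[of \<omega> s] that sub by force
  have Ev: "E \<omega> (of_real t) = w * (1 - w * cnj w) powr (r - 1) * (interior_series r a (w, cnj w) + (\<Sum>k. x k * w ^ k))"
    if \<omega>: "norm \<omega> = 1" and t: "0 < t" "t < \<delta>" and w: "w = of_real (1 - t) * \<omega>" for \<omega> t w
  proof -
    define z where "z = cayley_inv w"
    have nw: "norm w = 1 - t" unfolding w norm_mult norm_of_real using \<omega> t \<delta> by simp
    then have w1: "norm w < 1" "\<rho> < norm w" "w \<noteq> 0" "w \<noteq> 1" using t \<delta> \<rho> by auto
    have cz: "cayley z = w" unfolding z_def by (rule cayley_cayley_inv[OF w1(4)])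
    have zU: "z \<in> UHP" unfolding z_def by (rule cayley_inv_in_UHP[OF w1(1)])
    have zi: "z \<noteq> \<i>" using cz w1(3) by (auto simp: cayley_def)
    have zV: "z \<in> UHP_annulus \<rho>" using zU cz w1 by (simp add: UHP_annulus_def)
    then have zz: "z \<in> U0" "z \<in> U1" "z \<in> U2" "z \<in> U3" "z \<in> U4" using \<rho>(3) by auto
    define P where "P = (1 - w) powr r"
    define Q where "Q = (1 - w * cnj w) powr (1 - r)"
    define S where "S = interior_series r a (w, cnj w) + (\<Sum>k. x k * w ^ k)"
    have P0: "P \<noteq> 0" using w1 by (simp add: P_def)
    have s0: "1 - w * cnj w \<noteq> 0" using prod_norm_lt_1[of w "cnj w"] w1 by auto
    have Q0: "Q \<noteq> 0" using s0 by (simp add: Q_def)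
    have fz: "fr r z = P / w * Q" unfolding fr_disc[OF zU zi] cz P_def Q_def ..
    then have f0: "fr r z \<noteq> 0" using P0 Q0 w1 by simp
    have "V1 z / fr r z = h1 z" "V2 z / fr r z = h2 z" using 1(3) 2(3) zz zU zi by blast+
    then have V: "V1 z = fr r z * h1 z" "V2 z = fr r z * h2 z" using f0 by (auto simp: field_simps)
    have "G1 z + W1 z = G2 z + W2 z" "W1 z = V1 z" "W2 z = V2 z" using 3 zz zU by blast+
    then have "G1 z - G2 z = fr r z * (h2 z - h1 z)" using V by (simp add: algebra_simps)
    moreover have "G1 z - G2 z = P * S" using D[OF zU] by (simp add: interior_solution_def cz P_def S_def)
    ultimately have "P * S = P * (Q * (h2 z - h1 z) / w)" unfolding fz by simp
    then have "S = Q * (h2 z - h1 z) / w" using P0 unfolding mult_cancel_left by simp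
    then have "h2 z - h1 z = w * (1 / Q) * S" using Q0 w1 by (simp add: field_simps)
    also have "1 / Q = (1 - w * cnj w) powr (r - 1)"
      unfolding Q_def using powr_minus[of "1 - w * cnj w" "1 - r"] by (simp add: inverse_eq_divide)
    finally show ?thesis
      using E1(5)[OF \<omega> t(1), folded w] E2(5)[OF \<omega> t(1), folded w] t \<delta> by (simp add: E_def z_def S_def)
  qed
  have "x k = 0" for k
    by (rule boundary_modes_vanish(1)[OF r ax \<delta>(1,2), where E = E and M = "M2 + M1"]) (rule Eh EM Ev; assumption)+
  moreover have "a k = 0" for k
    by (rule boundary_modes_vanish(2)[OF r ax \<delta>(1,2), where E = E and M = "M2 + M1"]) (rule Eh EM Ev; assumption)+
  ultimately have "interior_solution r a x z = 0" by (simp add: interior_solution_def interior_series_def)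
  then show ?thesis using D[OF z] by simp
qed

theorem theorem8p5:
  fixes r :: complex
  assumes "\<forall>n::nat. n \<ge> 1 \<longrightarrow> r \<noteq> of_nat n"
  shows "(\<forall>F. Bgerm r F \<longrightarrow>
            (\<exists>G W. G \<in> Hr r UHP \<and> Wgerm r W \<and> germ_eq F (\<lambda>z. G z + W z)))
       \<and> (\<forall>G1 W1 G2 W2. G1 \<in> Hr r UHP \<and> G2 \<in> Hr r UHP \<and> Wgerm r W1 \<and> Wgerm r W2 \<and>
            germ_eq (\<lambda>z. G1 z + W1 z) (\<lambda>z. G2 z + W2 z) \<longrightarrow>
            germ_eq G1 G2 \<and> germ_eq W1 W2)"
proof -
  \<comment> \<open>The positive integers are the numbers j+1; nonvanishing of these denominators is
    the form used throughout.\<close>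
  have r: "of_nat j + 1 - r \<noteq> 0" for j
  proof
    assume "of_nat j + 1 - r = 0"
    then have "r = of_nat (Suc j)" by (simp add: add.commute)
    then show False using assms by (metis Suc_le_mono One_nat_def le0)
  qed
  show ?thesis
  proof (intro conjI allI impI)
    show "\<exists>G W. G \<in> Hr r UHP \<and> Wgerm r W \<and> germ_eq F (\<lambda>z. G z + W z)" if "Bgerm r F" for F
      by (rule sum_decomposition_exists[OF r that])
    fix G1 W1 G2 W2
    assume H: "G1 \<in> Hr r UHP \<and> G2 \<in> Hr r UHP \<and> Wgerm r W1 \<and> Wgerm r W2 \<and>
      germ_eq (\<lambda>z. G1 z + W1 z) (\<lambda>z. G2 z + W2 z)"
    then have G: "G1 z = G2 z" if "z \<in> UHP" for z
      using sum_decomposition_unique[OF r] that by blast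
    \<comment> \<open>G1 and G2 agree on all of the half-plane, so they cancel from the sums on this
      neighbourhood.\<close>
    obtain U where U: "bnbhd U" "\<forall>z\<in>U \<inter> UHP. G1 z + W1 z = G2 z + W2 z"
      using H unfolding germ_eq_def by blast
    show "germ_eq G1 G2" "germ_eq W1 W2"
      unfolding germ_eq_def using U G by (intro exI[of _ U]; auto)+
  qed
qed

end
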